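(* Let $p$ be a prime, $X=\Omega_p$, and let $\alpha=p^k c$, where $k\in\mathbb Z$ and $c=(c_0,c_1,\dots,c_n,\dots)\in\Delta_p^0$, be an arbitrary topological automorphism of $X$ (acting by multiplication). Then: 1. Let $\xi_1,\xi_2$ be independent random variables with values in $X$ and distributions $\mu_1,\mu_2$, and assume that the conditional distribution of the linear form $L_2=\xi_1+\alpha\xi_2$ given $L_1=\xi_1+\xi_2$ is symmetric. Then: (i) If $p>2$, $k=0$ and $c_0\neq p-1$, then $\mu_j=m_K*E_{x_j}$, $j=1,2$, where $K$ is a compact subgroup of $X$ (the same for $j=1,2$) and $x_j\in X$. Moreover, if $c_0=1$, then $\mu_1$ and $\mu_2$ are degenerate distributions. (ii) If $p=2$, $k=0$, $c_0=1$ and $c_1=0$, then $\mu_1$ and $\mu_2$ are degenerate distributions. (iii) If $p>2$ and $|k|=1$, then either $\mu_1\in I(X)$ or $\mu_2\in I(X)$. 2. If one of the following conditions holds: (i) $p>2$, $k=0$, $c_0=p-1$; (ii) $p=2$, $k=0$, $c_0=c_1=1$; (iii) $p=2$, $|k|=1$; (iv) $p\ge 2$, $|k|\ge 2$, then there exist independent random variables $\xi_1,\xi_2$ with values in $X$ and distributions $\mu_1,\mu_2$ such that the conditional distribution of $L_2=\xi_1+\alpha\xi_2$ given $L_1=\xi_1+\xi_2$ is symmetric, whereas $\mu_1\notin I(X)$ and $\mu_2\notin I(X)$.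
   Context: $\Omega_p$ is the field (and additive locally compact abelian group) of $p$-adic numbers: elements are formal series $x=\sum_{n\ge n_0}x_np^n$ with digits $x_n\in\{0,\dots,p-1\}$, with the usual topology given by the neighbourhood basis of zero $\{p^m\Delta_p\}_{m\in\mathbb Z}$. $\Delta_p=\{x\in\Omega_p: x_n=0 \text{ for } n<0\}$ is the compact subgroup of $p$-adic integers, whose elements are written $x=(x_0,x_1,\dots)$ (digit sequences), and $\Delta_p^0=\{x\in\Delta_p: x_0\neq 0\}$ is the set of invertible $p$-adic integers. Every topological automorphism of $\Omega_p$ is multiplication by a nonzero element of $\Omega_p$, and we identify the automorphism with that element; every nonzero element has the form $p^kc$ with $k\in\mathbb Z$, $c\in\Delta_p^0$, and $c_0,c_1,\dots$ denote the $p$-adic digits of $c$. For a compact subgroup $K$, $m_K$ is the Haar probability measure on $K$; $E_x$ is the point mass (degenerate distribution) at $x$. $I(X)$ denotes the set of idempotent distributions on $X$, i.e. the shifts $m_K*E_x$ of Haar distributions of compact subgroups $K$ of $X$. The conditional distribution of $L_2$ given $L_1$ is called symmetric if it coincides with the conditional distribution of $-L_2$ given $L_1$. *)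

theory Defs
  imports "HOL-Probability.Probability"
begin

text \<open>p-adic numbers represented by their digit sequences: x = sum_n x n * p^n.\<close>
type_synonym padic = "int \<Rightarrow> nat"

definition Omega :: "nat \<Rightarrow> padic set" where
  "Omega p = {x. (\<forall>n. x n < p) \<and> finite {n. n < 0 \<and> x n \<noteq> 0}}"

definition Delta :: "nat \<Rightarrow> padic set" where
  "Delta p = {x \<in> Omega p. \<forall>n<0. x n = 0}"

definition Delta0 :: "nat \<Rightarrow> padic set" where
  "Delta0 p = {x \<in> Delta p. x 0 \<noteq> 0}"

definition ptrunc :: "nat \<Rightarrow> padic \<Rightarrow> int \<Rightarrow> real" where
  "ptrunc p x N = (\<Sum>j\<in>{j. j < N \<and> x j \<noteq> 0}. real (x j) * real p powi j)"

text \<open>The n-th p-adic digit of a number A in Z[1/p].\<close>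
definition rdigit :: "nat \<Rightarrow> real \<Rightarrow> int \<Rightarrow> nat" where
  "rdigit p A n = nat (\<lfloor>A / real p powi n\<rfloor> mod int p)"

definition pzero :: padic where "pzero = (\<lambda>_. 0)"

definition padd :: "nat \<Rightarrow> padic \<Rightarrow> padic \<Rightarrow> padic" where
  "padd p x y = (\<lambda>n. rdigit p (ptrunc p x (n+1) + ptrunc p y (n+1)) n)"

definition pneg :: "nat \<Rightarrow> padic \<Rightarrow> padic" where
  "pneg p x = (\<lambda>n. rdigit p (- ptrunc p x (n+1)) n)"

definition pmul :: "nat \<Rightarrow> padic \<Rightarrow> padic \<Rightarrow> padic" where
  "pmul p x y = (\<lambda>n. THE d. \<exists>M. \<forall>N\<ge>M. rdigit p (ptrunc p x N * ptrunc p y N) n = d)"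

definition ppow :: "nat \<Rightarrow> int \<Rightarrow> padic" where
  "ppow p k = (\<lambda>n. if n = k then 1 else 0)"

text \<open>The p-adic topology: neighbourhood basis of x given by x + p^m Delta_p,
  i.e. the elements whose digits agree with those of x below index m.\<close>
definition ptop :: "nat \<Rightarrow> padic topology" where
  "ptop p = topology (\<lambda>U. U \<subseteq> Omega p \<and>
      (\<forall>x\<in>U. \<exists>m::int. {y \<in> Omega p. \<forall>n<m. y n = x n} \<subseteq> U))"

definition pborel :: "nat \<Rightarrow> padic measure" where
  "pborel p = sigma (Omega p) {U. openin (ptop p) U}"

definition compact_subgroup :: "nat \<Rightarrow> padic set \<Rightarrow> bool" where
  "compact_subgroup p K \<longleftrightarrow> K \<subseteq> Omega p \<and> compactin (ptop p) K \<and> pzero \<in> K \<and>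
     (\<forall>x\<in>K. \<forall>y\<in>K. padd p x y \<in> K) \<and> (\<forall>x\<in>K. pneg p x \<in> K)"

definition haar_distr :: "nat \<Rightarrow> padic set \<Rightarrow> padic measure \<Rightarrow> bool" where
  "haar_distr p K m \<longleftrightarrow> prob_space m \<and> sets m = sets (pborel p) \<and> emeasure m K = 1 \<and>
     (\<forall>k\<in>K. distr m (pborel p) (\<lambda>y. padd p y k) = m)"

definition pshift :: "nat \<Rightarrow> padic measure \<Rightarrow> padic \<Rightarrow> padic measure" where
  "pshift p m x = distr m (pborel p) (\<lambda>y. padd p y x)"

definition idempotent :: "nat \<Rightarrow> padic measure \<Rightarrow> bool" where
  "idempotent p \<mu> \<longleftrightarrow> (\<exists>K m x. compact_subgroup p K \<and> haar_distr p K m \<and> x \<in> Omega p \<and>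
      \<mu> = pshift p m x)"

definition degenerate :: "nat \<Rightarrow> padic measure \<Rightarrow> bool" where
  "degenerate p \<mu> \<longleftrightarrow> (\<exists>x\<in>Omega p. \<mu> = return (pborel p) x)"

definition cond_symmetric :: "nat \<Rightarrow> 'a measure \<Rightarrow> ('a \<Rightarrow> padic) \<Rightarrow> ('a \<Rightarrow> padic) \<Rightarrow> bool" where
  "cond_symmetric p M L1 L2 \<longleftrightarrow>
     (\<forall>B\<in>sets (pborel p). AE \<omega> in M.
        real_cond_exp M (vimage_algebra (space M) L1 (pborel p))
           (indicator {\<omega>\<in>space M. L2 \<omega> \<in> B}) \<omega> =
        real_cond_exp M (vimage_algebra (space M) L1 (pborel p))
           (indicator {\<omega>\<in>space M. pneg p (L2 \<omega>) \<in> B}) \<omega>)"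

definition sym_model :: "nat \<Rightarrow> padic \<Rightarrow> 'a measure \<Rightarrow> ('a \<Rightarrow> padic) \<Rightarrow> ('a \<Rightarrow> padic) \<Rightarrow> bool" where
  "sym_model p \<alpha> M \<xi>1 \<xi>2 \<longleftrightarrow> prob_space M \<and>
     \<xi>1 \<in> M \<rightarrow>\<^sub>M pborel p \<and> \<xi>2 \<in> M \<rightarrow>\<^sub>M pborel p \<and>
     prob_space.indep_var M (pborel p) \<xi>1 (pborel p) \<xi>2 \<and>
     cond_symmetric p M (\<lambda>\<omega>. padd p (\<xi>1 \<omega>) (\<xi>2 \<omega>))
                        (\<lambda>\<omega>. padd p (\<xi>1 \<omega>) (pmul p \<alpha> (\<xi>2 \<omega>)))"

end

theory Submission
  imports Defs "HOL-Number_Theory.Cong"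
begin

text \<open>
  Let \<open>f\<close> and \<open>g\<close> be the absolute values of the characteristic functions of \<open>\<xi>1\<close> and \<open>\<xi>2\<close>. The
  symmetry hypothesis says that \<open>(L1, L2)\<close> and \<open>(L1, -L2)\<close> are equally distributed, which gives
  \<open>f (u + v) g (u + \<alpha> v) = f (u - v) g (u - \<alpha> v)\<close>. Taking \<open>u = v\<close> yields
  \<open>g w = f (2 w / (1 - \<alpha>)) g (\<kappa> w)\<close> with \<open>\<kappa> = (1 + \<alpha>) / (1 - \<alpha>)\<close>, so \<open>g w \<le> g (\<kappa> w)\<close>.
  If \<open>\<kappa>\<close> is a unit, some powers of \<open>\<kappa>\<close> tend to 1; hence \<open>g w = g (\<kappa> w)\<close>, and \<open>g w \<noteq> 0\<close> forces
  \<open>f (2 w / (1 - \<alpha>)) = 1\<close>. The substitution \<open>u = \<alpha> v\<close> exchanges the roles of \<open>f\<close> and \<open>g\<close>. As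
  \<open>f y = 1\<close> means that \<open>\<xi>1\<close> is concentrated on a coset of \<open>y\<^sup>-\<^sup>1 \<Delta>\<close>, the supports of \<open>f\<close> and \<open>g\<close> are
  (almost) the subgroups on which they equal 1. If instead \<open>\<kappa>\<^sup>-\<^sup>1\<close> is a non-unit integer, then
  \<open>g w \<ge> g (\<kappa>\<^sup>-\<^sup>n w)\<close>, which tends to 1. The counterexamples are mixtures of the Haar distributions
  of two neighbouring balls \<open>p\<^sup>a \<Delta>\<close> and \<open>p\<^bsup>a+1\<^esup> \<Delta>\<close>.
\<close>

text \<open>Every case is decided by p-adic valuations. Absolute values are used because the unknown
  shifts x_j contribute only phases. Let 1 - \<alpha> and 1 + \<alpha> have the common valuation e,
  and let p > 2. A w of valuation b with g w nonzero gives |f| = 1 at valuation b - e, and one with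
  f w nonzero gives |g| = 1 at valuation b + k - e. For k = 0 (so e = 0) no level is lost, and both
  supports are the same subgroup. For |k| = 1 one level is lost in one direction, so at most one of
  f and g can have a gap between its support and the subgroup where its modulus is 1; for |k| >= 2
  both can. If p = 2, the factor 2 loses a further level each way, which already spoils |k| = 1.
  Units near 1 or -1 make the two valuations differ: a more divisible 1 - \<alpha> forces
  degeneracy, a more divisible 1 + \<alpha> allows counterexamples. Distributions are recovered from
  characteristic functions only on a compact p^(-J) Delta, where inversion is a finite sum over
  characters of p^(-J) Delta / p^n Delta.\<close>

locale padic_prime =
  fixes p :: nat
  assumes prime_p: "prime p"
begin

section \<open>Powers of p and congruences modulo p^N\<close>

lemma p_gt_1: "p > 1" and p_pos: "p > 0"
  using prime_gt_1_nat[OF prime_p] by auto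

lemma p_nz [simp]: "p \<noteq> 0" "0 < p"
  using p_gt_1 by auto

abbreviation pp :: "int \<Rightarrow> real" where "pp i \<equiv> real p powi i"

abbreviation Qp :: "padic set" where "Qp \<equiv> Omega p"

abbreviation BQ :: "padic measure" where "BQ \<equiv> pborel p"

lemma powi_add: "pp (m + n) = pp m * pp n"
  by (simp add: power_int_add)

lemma powi_cancel [simp]: "pp m * pp (- m) = 1" "pp (- m) * pp m = 1"
  by (simp_all flip: powi_add)

lemma powi_pos [simp]: "pp i > 0"
  using p_pos by (simp add: zero_less_power_int)

lemma powi_nz [simp]: "pp i \<noteq> 0"
  using powi_pos[of i] by linarith

text \<open>This is the intersection of p^N Delta with Z[1/p]. Congruences modulo p^N between
  elements of Z[1/p] can therefore be stated among real numbers.\<close>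

definition pZ :: "int \<Rightarrow> real set" where
  "pZ N = {A. \<exists>i::int. A = of_int i * pp N}"

lemma pZ_I: "of_int i * pp N \<in> pZ N"
  by (auto simp: pZ_def)

lemma pZ_0 [simp]: "0 \<in> pZ N"
  using pZ_I[of 0] by simp

lemma pZ_add: "A \<in> pZ N \<Longrightarrow> B \<in> pZ N \<Longrightarrow> A + B \<in> pZ N"
proof -
  assume "A \<in> pZ N" "B \<in> pZ N"
  then obtain i j :: int where "A = of_int i * pp N" "B = of_int j * pp N"
    by (auto simp: pZ_def)
  hence "A + B = of_int (i + j) * pp N" by (simp add: algebra_simps)
  thus ?thesis by (simp only: pZ_I)
qed

lemma pZ_minus: "A \<in> pZ N \<Longrightarrow> - A \<in> pZ N"
  using pZ_I[of "- i" N for i] by (auto simp: pZ_def)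

lemma pZ_diff: "A \<in> pZ N \<Longrightarrow> B \<in> pZ N \<Longrightarrow> A - B \<in> pZ N"
  using pZ_add[of A N "- B"] pZ_minus[of B N] by simp

lemma pZ_mult: "A \<in> pZ M \<Longrightarrow> B \<in> pZ N \<Longrightarrow> A * B \<in> pZ (M + N)"
proof -
  assume "A \<in> pZ M" "B \<in> pZ N"
  then obtain i j :: int where "A = of_int i * pp M" "B = of_int j * pp N"
    by (auto simp: pZ_def)
  hence "A * B = of_int (i * j) * pp (M + N)"
    by (simp add: powi_add)
  thus ?thesis by (simp only: pZ_I)
qed

lemma powi_in_pZ: "N \<le> M \<Longrightarrow> pp M \<in> pZ N"
proof -
  assume "N \<le> M"
  have "pp M = pp (M - N) * pp N"
    using powi_add[of "M - N" N] by simp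
  also have "pp (M - N) = of_int (int p ^ nat (M - N))"
    using \<open>N \<le> M\<close> by (simp add: power_int_def)
  finally show ?thesis by (simp only: pZ_I)
qed

lemma pZ_mono: "N \<le> M \<Longrightarrow> A \<in> pZ M \<Longrightarrow> A \<in> pZ N"
proof -
  assume "N \<le> M" "A \<in> pZ M"
  then obtain i :: int where i: "A = of_int i * pp M" by (auto simp: pZ_def)
  have "of_int i \<in> pZ 0" using pZ_I[of i 0] by simp
  from pZ_mult[OF this powi_in_pZ[OF \<open>N \<le> M\<close>]] show ?thesis by (simp add: i)
qed

lemma pZ_sym: "A - B \<in> pZ N \<Longrightarrow> B - A \<in> pZ N"
  using pZ_minus by fastforce

lemma pZ_trans: "A - B \<in> pZ N \<Longrightarrow> B - C \<in> pZ N \<Longrightarrow> A - C \<in> pZ N"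
  using pZ_add by fastforce

lemma pZ_sum: "(\<And>i. i \<in> I \<Longrightarrow> f i \<in> pZ N) \<Longrightarrow> sum f I \<in> pZ N"
  by (induction I rule: infinite_finite_induct) (auto intro: pZ_add)

lemma pZ_of_int_mult: "A \<in> pZ N \<Longrightarrow> of_int i * A \<in> pZ N"
  using pZ_mult[of "of_int i" 0 A N] pZ_I[of i 0] by simp

lemma pZ_0_iff: "A \<in> pZ 0 \<longleftrightarrow> A \<in> \<int>"
  by (auto simp: pZ_def elim: Ints_cases)

lemma pZ_mult_powi: "A * pp j \<in> pZ N \<longleftrightarrow> A \<in> pZ (N - j)"
proof
  assume "A * pp j \<in> pZ N"
  from pZ_mult[OF this powi_in_pZ[of "-j" "-j"]]
  show "A \<in> pZ (N - j)" by (simp add: mult.assoc)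
next
  assume "A \<in> pZ (N - j)"
  from pZ_mult[OF this powi_in_pZ[of j j]]
  show "A * pp j \<in> pZ N" by simp
qed

subsection \<open>Digits and truncations\<close>

lemma rdigit_cong:
  assumes "A - B \<in> pZ (N + 1)"
  shows "rdigit p A N = rdigit p B N"
proof -
  obtain i :: int where "A - B = of_int i * pp (N + 1)" using assms by (auto simp: pZ_def)
  hence "A / pp N = B / pp N + of_int (i * int p)"
    by (simp add: powi_add field_simps)
  hence "\<lfloor>A / pp N\<rfloor> = \<lfloor>B / pp N\<rfloor> + i * int p"
    by (metis floor_add_int)
  thus ?thesis by (simp add: rdigit_def)
qed

lemma rdigit_less: "rdigit p A N < p"
  using p_pos by (simp add: rdigit_def nat_less_iff)

lemma rdigit_low: "A \<in> pZ L \<Longrightarrow> N < L \<Longrightarrow> rdigit p A N = 0"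
  using rdigit_cong[of A 0 N] pZ_mono[of "N+1" L A] by (simp add: rdigit_def)

lemma Omega_less: "x \<in> Qp \<Longrightarrow> x n < p"
  by (auto simp: Omega_def)

text \<open>The parameter \<open>B\<close> pushes the bound as far down as desired, so that several
  numbers can be given a common bound.\<close>

lemma Omega_low:
  assumes "x \<in> Qp"
  obtains L where "L \<le> B" "\<forall>i<L. x i = 0"
proof -
  have f: "finite {n. n < 0 \<and> x n \<noteq> 0}" using assms by (auto simp: Omega_def)
  define L where "L = Min (insert (min 0 B) {n. n < 0 \<and> x n \<noteq> 0})"
  have "L \<le> min 0 B" using f unfolding L_def by (intro Min_le) auto
  moreover have "x i = 0" if "i < L" for i
  proof (rule ccontr)
    assume "x i \<noteq> 0"
    moreover have "i < 0" using that \<open>L \<le> min 0 B\<close> by linarith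
    ultimately have "L \<le> i" using f unfolding L_def by (intro Min_le) auto
    thus False using that by simp
  qed
  ultimately show ?thesis using that by auto
qed

lemma OmegaI: "(\<And>n. x n < p) \<Longrightarrow> (\<And>i. i < L \<Longrightarrow> x i = 0) \<Longrightarrow> x \<in> Qp"
proof -
  assume a: "\<And>n. x n < p" "\<And>i. i < L \<Longrightarrow> x i = 0"
  have "{n. n < 0 \<and> x n \<noteq> 0} \<subseteq> {L..<0}" using a(2) by (auto simp: not_less[symmetric])
  thus ?thesis using a(1) by (auto simp: Omega_def intro: finite_subset)
qed

lemma finite_supp:
  assumes "x \<in> Qp" shows "finite {j. j < N \<and> x j \<noteq> 0}"
proof -
  obtain L where "\<forall>i<L. x i = 0" using Omega_low[OF assms, of 0] by auto
  hence "{j. j < N \<and> x j \<noteq> 0} \<subseteq> {L..<N}" by (auto simp: not_less[symmetric])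
  thus ?thesis by (rule finite_subset) simp
qed

lemma ptrunc_step:
  assumes "x \<in> Qp"
  shows "ptrunc p x (N + 1) = ptrunc p x N + real (x N) * pp N"
proof (cases "x N = 0")
  case True
  have "{j. j < N + 1 \<and> x j \<noteq> 0} = {j. j < N \<and> x j \<noteq> 0}"
    using True by (auto simp: zle_add1_eq_le order.order_iff_strict)
  thus ?thesis using True by (simp add: ptrunc_def)
next
  case False
  have "{j. j < N + 1 \<and> x j \<noteq> 0} = insert N {j. j < N \<and> x j \<noteq> 0}"
    using False by (auto simp del: zless_add1_eq simp: zle_add1_eq_le)
  thus ?thesis using finite_supp[OF assms, of N] by (simp add: ptrunc_def)
qed

lemma ptrunc_low: "\<forall>i<L. x i = 0 \<Longrightarrow> N \<le> L \<Longrightarrow> ptrunc p x N = 0"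
  unfolding ptrunc_def by (intro sum.neutral) auto

lemma ptrunc_nonneg: "0 \<le> ptrunc p x N"
  unfolding ptrunc_def by (intro sum_nonneg) (auto intro: less_imp_le)

text \<open>A geometric sum with digits at most p - 1. Together with nonnegativity it makes the
  floor of \<open>ptrunc p x N / pp N\<close> zero, which is how single digits are read off.\<close>

lemma ptrunc_less:
  assumes "x \<in> Qp" shows "ptrunc p x N < pp N"
proof -
  obtain L where L: "L \<le> N" "\<forall>i<L. x i = 0" using Omega_low[OF assms] by blast
  show ?thesis using L(1)
  proof (induction N rule: int_ge_induct)
    case base
    show ?case using ptrunc_low[OF L(2), of L] by simp
  next
    case (step i)
    have "real (x i) \<le> real p - 1" using Omega_less[OF assms, of i] by linarith
    hence "real (x i) * pp i \<le> (real p - 1) * pp i"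
      by (intro mult_right_mono) (auto intro: less_imp_le)
    thus ?case using step
      unfolding ptrunc_step[OF assms] powi_add by (simp add: algebra_simps)
  qed
qed

lemma ptrunc_pZ: "\<forall>i<L. x i = 0 \<Longrightarrow> ptrunc p x N \<in> pZ L"
  unfolding ptrunc_def
proof (rule pZ_sum)
  fix j assume L: "\<forall>i<L. x i = 0" and "j \<in> {j. j < N \<and> x j \<noteq> 0}"
  hence "L \<le> j" by (auto simp: not_less[symmetric])
  from pZ_of_int_mult[OF powi_in_pZ[OF this], of "int (x j)"]
  show "real (x j) * pp j \<in> pZ L" by simp
qed

lemma ptrunc_diff:
  assumes "x \<in> Qp" "N \<le> M"
  shows "ptrunc p x M - ptrunc p x N \<in> pZ N"
  using assms(2)
proof (induction M rule: int_ge_induct)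
  case base show ?case by simp
next
  case (step i)
  have "real (x i) * pp i \<in> pZ N"
    using pZ_of_int_mult[OF powi_in_pZ[OF step(1)], of "int (x i)"] by simp
  from pZ_add[OF this step(2)] show ?case
    unfolding ptrunc_step[OF assms(1)] by (simp add: algebra_simps)
qed

lemma ptrunc_cong: "(\<And>i. i < N \<Longrightarrow> x i = y i) \<Longrightarrow> ptrunc p x N = ptrunc p y N"
  unfolding ptrunc_def by (intro sum.cong) auto

lemma rdigit_ptrunc:
  assumes "x \<in> Qp" "N < M" shows "rdigit p (ptrunc p x M) N = x N"
proof -
  have "rdigit p (ptrunc p x M) N = rdigit p (ptrunc p x (N + 1)) N"
    using assms by (intro rdigit_cong ptrunc_diff) auto
  moreover have "ptrunc p x (N + 1) / pp N = ptrunc p x N / pp N + of_int (int (x N))"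
    unfolding ptrunc_step[OF assms(1)] by (simp add: field_simps)
  hence "\<lfloor>ptrunc p x (N + 1) / pp N\<rfloor> = \<lfloor>ptrunc p x N / pp N\<rfloor> + int (x N)"
    by (metis floor_add_int)
  moreover have "\<lfloor>ptrunc p x N / pp N\<rfloor> = 0"
    using ptrunc_nonneg[of x N] ptrunc_less[OF assms(1), of N] by (simp add: floor_eq_iff)
  ultimately show ?thesis using Omega_less[OF assms(1), of N]
    by (simp add: rdigit_def)
qed

lemma digits_eq:
  assumes "x \<in> Qp" "y \<in> Qp" "ptrunc p x N - ptrunc p y N \<in> pZ N" "i < N"
  shows "x i = y i"
  using rdigit_ptrunc[OF assms(1,4)] rdigit_ptrunc[OF assms(2,4)]
    rdigit_cong[OF pZ_mono[OF _ assms(3), of "i+1"]] assms(4) by simp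

text \<open>Because \<open>rdigit\<close> takes the floor and the residue of A itself, negative A
  receive their p-adic expansion, which need not terminate; its truncations still represent A modulo
  p^N.\<close>

lemma ptrunc_rdigit:
  assumes "A \<in> pZ L"
  shows "rdigit p A \<in> Qp" and "ptrunc p (rdigit p A) N - A \<in> pZ N"
proof -
  show O: "rdigit p A \<in> Qp"
    using rdigit_less rdigit_low[OF assms] by (rule OmegaI)
  have low: "\<forall>i<L. rdigit p A i = 0" using rdigit_low[OF assms] by auto
  show "ptrunc p (rdigit p A) N - A \<in> pZ N"
  proof (cases "N \<le> L")
    case True
    thus ?thesis using ptrunc_low[OF low True] pZ_minus[OF pZ_mono[OF True assms]] by simp
  next
    case False
    hence "L \<le> N" by simp
    thus ?thesis
    proof (induction N rule: int_ge_induct)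
      case base
      show ?case using ptrunc_low[OF low, of L] pZ_minus[OF assms] by simp
    next
      case (step N)
      let ?t = "ptrunc p (rdigit p A) N"
      obtain m :: int where m: "A - ?t = of_int m * pp N"
        using pZ_sym[OF step(2)] by (auto simp: pZ_def)
      have "A / pp N = ?t / pp N + of_int m"
        using m by (simp add: field_simps add_divide_distrib diff_eq_eq)
      hence "\<lfloor>A / pp N\<rfloor> = \<lfloor>?t / pp N\<rfloor> + m" by (metis floor_add_int)
      also have "\<lfloor>?t / pp N\<rfloor> = 0"
        using ptrunc_nonneg[of _ N] ptrunc_less[OF O, of N] by (simp add: floor_eq_iff)
      finally have d: "int (rdigit p A N) = m mod int p"
        using p_pos by (simp add: rdigit_def)
      have "m - m mod int p = int p * (m div int p)"
        by (metis minus_mod_eq_mult_div)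
      have "A - ptrunc p (rdigit p A) (N + 1) = of_int (m - int (rdigit p A N)) * pp N"
        using m unfolding ptrunc_step[OF O] by (simp add: algebra_simps)
      also have "\<dots> = of_int (m div int p) * pp (N + 1)"
        unfolding d minus_mod_eq_mult_div by (simp add: powi_add)
      finally have "A - ptrunc p (rdigit p A) (N + 1) \<in> pZ (N + 1)" by (simp only: pZ_I)
      thus ?case by (rule pZ_sym)
    qed
  qed
qed

text \<open>All operations on digit sequences have the form \<open>z n = rdigit p (s (n + 1)) n\<close> for real numbers
  \<open>s N\<close> that are compatible modulo \<open>p\<^sup>N\<close>.\<close>

lemma coherent_digits:
  assumes L: "\<And>N. s N \<in> pZ L" and coh: "\<And>N M. N \<le> M \<Longrightarrow> s M - s N \<in> pZ N"
    and z: "z = (\<lambda>n. rdigit p (s (n + 1)) n)"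
  shows "z \<in> Qp" "\<forall>i<L. z i = 0" "ptrunc p z N - s N \<in> pZ N"
proof -
  show low: "\<forall>i<L. z i = 0" using rdigit_low[OF L] by (auto simp: z)
  show "z \<in> Qp" using rdigit_less low by (intro OmegaI[of z L]) (auto simp: z)
  have "z i = rdigit p (s N) i" if "i < N" for i
    unfolding z using that by (intro rdigit_cong[symmetric] coh) auto
  hence "ptrunc p z N = ptrunc p (rdigit p (s N)) N" by (intro ptrunc_cong) auto
  thus "ptrunc p z N - s N \<in> pZ N" using ptrunc_rdigit(2)[OF L] by simp
qed

lemma padd_trunc:
  assumes "x \<in> Qp" "y \<in> Qp"
  shows "padd p x y \<in> Qp" "ptrunc p (padd p x y) N - (ptrunc p x N + ptrunc p y N) \<in> pZ N"
proof -
  obtain L where Lx: "\<forall>i<L. x i = 0" using Omega_low[OF assms(1), of 0] by auto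
  obtain L' where L': "L' \<le> L" "\<forall>i<L'. y i = 0" using Omega_low[OF assms(2), of L] by auto
  have Lx': "\<forall>i<L'. x i = 0" using Lx L'(1) by auto
  have 1: "ptrunc p x N + ptrunc p y N \<in> pZ L'" for N
    using Lx' L'(2) by (intro pZ_add ptrunc_pZ)
  have 2: "ptrunc p x M + ptrunc p y M - (ptrunc p x N + ptrunc p y N) \<in> pZ N" if "N \<le> M" for N M
    using pZ_add[OF ptrunc_diff[OF assms(1) that] ptrunc_diff[OF assms(2) that]]
    by (simp add: algebra_simps)
  show "padd p x y \<in> Qp" by (rule coherent_digits(1)[OF 1 2 padd_def])
  show "ptrunc p (padd p x y) N - (ptrunc p x N + ptrunc p y N) \<in> pZ N"
    by (rule coherent_digits(3)[OF 1 2 padd_def])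
qed

lemma pneg_trunc:
  assumes "x \<in> Qp"
  shows "pneg p x \<in> Qp" "ptrunc p (pneg p x) N - (- ptrunc p x N) \<in> pZ N"
proof -
  obtain L where Lx: "\<forall>i<L. x i = 0" using Omega_low[OF assms(1), of 0] by auto
  have 1: "- ptrunc p x N \<in> pZ L" for N
    using Lx by (intro pZ_minus ptrunc_pZ)
  have 2: "- ptrunc p x M - (- ptrunc p x N) \<in> pZ N" if "N \<le> M" for N M
    using pZ_minus[OF ptrunc_diff[OF assms(1) that]] by simp
  show "pneg p x \<in> Qp" by (rule coherent_digits(1)[OF 1 2 pneg_def])
  show "ptrunc p (pneg p x) N - (- ptrunc p x N) \<in> pZ N"
    by (rule coherent_digits(3)[OF 1 2 pneg_def])
qed

text \<open>A factor whose digits start at -J can move an error modulo p^M down to p^(M - J), so the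
  digits of the product below N require truncations up to N + J. In particular the digits in the
  definition of \<open>pmul\<close> stabilise, and its description is well defined.\<close>

lemma pmul_trunc:
  assumes "x \<in> Qp" "y \<in> Qp"
    and J: "J \<ge> 0" "\<forall>i < -J. x i = 0" "\<forall>i < -J. y i = 0"
  shows "pmul p x y \<in> Qp"
    and "M \<ge> N + J \<Longrightarrow> ptrunc p (pmul p x y) N - ptrunc p x M * ptrunc p y M \<in> pZ N"
    and "M \<ge> n + 1 + J \<Longrightarrow> pmul p x y n = rdigit p (ptrunc p x M * ptrunc p y M) n"
proof -
  define s where "s N = ptrunc p x (N + J) * ptrunc p y (N + J)" for N
  have coh: "ptrunc p x M * ptrunc p y M - s N \<in> pZ N" if "M \<ge> N + J" for N M
  proof -
    have "ptrunc p x M * ptrunc p y M - s N =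
      ptrunc p x M * (ptrunc p y M - ptrunc p y (N + J)) + (ptrunc p x M - ptrunc p x (N + J)) * ptrunc p y (N + J)"
      by (simp add: s_def algebra_simps)
    moreover have "ptrunc p x M * (ptrunc p y M - ptrunc p y (N + J)) \<in> pZ (- J + (N + J))"
      using that J assms by (intro pZ_mult ptrunc_pZ ptrunc_diff)
    moreover have "(ptrunc p x M - ptrunc p x (N + J)) * ptrunc p y (N + J) \<in> pZ ((N + J) + - J)"
      using that J assms by (intro pZ_mult ptrunc_pZ ptrunc_diff)
    ultimately show ?thesis using pZ_add[of _ N] by simp
  qed
  have 1: "s N \<in> pZ (- J + - J)" for N
    unfolding s_def using J by (intro pZ_mult ptrunc_pZ)
  have 2: "s M - s N \<in> pZ N" if "N \<le> M" for N M
    unfolding s_def[of M] using that by (intro coh) auto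
  have dig: "rdigit p (ptrunc p x M * ptrunc p y M) n = rdigit p (s (n + 1)) n"
    if "M \<ge> n + 1 + J" for M n
    using that by (intro rdigit_cong coh) auto
  have eq: "pmul p x y n = rdigit p (s (n + 1)) n" for n
    unfolding pmul_def
  proof (rule the_equality)
    show "\<exists>M. \<forall>N\<ge>M. rdigit p (ptrunc p x N * ptrunc p y N) n = rdigit p (s (n + 1)) n"
      using dig by blast
  next
    fix d assume "\<exists>M. \<forall>N\<ge>M. rdigit p (ptrunc p x N * ptrunc p y N) n = d"
    then obtain M where M: "\<forall>N\<ge>M. rdigit p (ptrunc p x N * ptrunc p y N) n = d" by auto
    show "d = rdigit p (s (n + 1)) n"
      using M dig[of n "max M (n + 1 + J)"] by auto
  qed
  have z: "pmul p x y = (\<lambda>n. rdigit p (s (n + 1)) n)" using eq by auto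
  show "pmul p x y \<in> Qp" by (rule coherent_digits(1)[OF 1 2 z])
  show "ptrunc p (pmul p x y) N - ptrunc p x M * ptrunc p y M \<in> pZ N" if "M \<ge> N + J"
    using coherent_digits(3)[OF 1 2 z, of N] coh[OF that] pZ_sym pZ_trans by blast
  show "M \<ge> n + 1 + J \<Longrightarrow> pmul p x y n = rdigit p (ptrunc p x M * ptrunc p y M) n"
    using eq dig by simp
qed

lemma pmul_ex:
  assumes "x \<in> Qp" "y \<in> Qp"
  obtains J where "J \<ge> 0" "\<forall>i < -J. x i = 0" "\<forall>i < -J. y i = 0"
proof -
  obtain L where L: "L \<le> 0" "\<forall>i<L. x i = 0" using Omega_low[OF assms(1), of 0] by auto
  obtain L' where L': "L' \<le> L" "\<forall>i<L'. y i = 0" using Omega_low[OF assms(2), of L] by auto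
  show ?thesis using L L' by (intro that[of "- L'"]) auto
qed

lemma pmul_Omega: "x \<in> Qp \<Longrightarrow> y \<in> Qp \<Longrightarrow> pmul p x y \<in> Qp"
  using pmul_ex pmul_trunc(1) by metis

lemmas padd_Omega = padd_trunc(1)
lemmas pneg_Omega = pneg_trunc(1)

text \<open>Instead of building the field of p-adic numbers, we compute with real sequences in
  \<open>\<int>[1/p]\<close> that converge p-adically: \<open>evZ b s\<close> says that the limit lies in \<open>p\<^sup>b \<Delta>\<close>, and \<open>rep x\<close> is the
  sequence of truncations of \<open>x\<close>. Ring identities thereby hold pointwise.\<close>

definition evZ :: "int \<Rightarrow> (nat \<Rightarrow> real) \<Rightarrow> bool" where
  "evZ b s \<longleftrightarrow> (\<forall>\<^sub>F n in sequentially. s n \<in> pZ b)"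

text \<open>The p-adic Cauchy sequences: the second clause makes s eventually constant modulo every
  p^N. Since A may be any real number there, the first clause is what keeps the terms in Z[1/p] and
  bounded.\<close>

definition adic :: "(nat \<Rightarrow> real) \<Rightarrow> bool" where
  "adic s \<longleftrightarrow> (\<exists>b. evZ b s) \<and> (\<forall>N. \<exists>A. evZ N (\<lambda>n. s n - A))"

definition rep :: "padic \<Rightarrow> nat \<Rightarrow> real" where
  "rep x n = ptrunc p x (int n)"

lemma evZ_add: "evZ b s \<Longrightarrow> evZ b t \<Longrightarrow> evZ b (\<lambda>n. s n + t n)"
  unfolding evZ_def by (erule (1) eventually_elim2) (auto intro: pZ_add)

lemma evZ_diff: "evZ b s \<Longrightarrow> evZ b t \<Longrightarrow> evZ b (\<lambda>n. s n - t n)"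
  unfolding evZ_def by (erule (1) eventually_elim2) (auto intro: pZ_diff)

lemma evZ_minus: "evZ b s \<Longrightarrow> evZ b (\<lambda>n. - s n)"
  unfolding evZ_def by (erule eventually_mono) (auto intro: pZ_minus)

lemma evZ_mult: "evZ b s \<Longrightarrow> evZ c t \<Longrightarrow> evZ (b + c) (\<lambda>n. s n * t n)"
  unfolding evZ_def by (erule (1) eventually_elim2) (auto intro: pZ_mult)

lemma evZ_mono: "evZ b s \<Longrightarrow> c \<le> b \<Longrightarrow> evZ c s"
  unfolding evZ_def by (erule eventually_mono) (auto intro: pZ_mono)

lemma evZ_const: "A \<in> pZ b \<Longrightarrow> evZ b (\<lambda>_. A)"
  by (simp add: evZ_def)

lemma evZ_const_iff: "evZ b (\<lambda>_. A) \<longleftrightarrow> A \<in> pZ b"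
  by (simp add: evZ_def)

lemma evZ_eq: "evZ b s \<Longrightarrow> (\<And>n. s n = t n) \<Longrightarrow> evZ b t"
  by (simp add: evZ_def)

lemma evZ_trans: "evZ b (\<lambda>n. s n - t n) \<Longrightarrow> evZ b (\<lambda>n. t n - u n) \<Longrightarrow> evZ b (\<lambda>n. s n - u n)"
  using evZ_add[of b "\<lambda>n. s n - t n" "\<lambda>n. t n - u n"] by simp

lemma evZ_sym: "evZ b (\<lambda>n. s n - t n) \<Longrightarrow> evZ b (\<lambda>n. t n - s n)"
  using evZ_minus[of b "\<lambda>n. s n - t n"] by simp

lemma adicD: "adic s \<Longrightarrow> \<exists>b. evZ b s" "adic s \<Longrightarrow> \<exists>A. evZ N (\<lambda>n. s n - A)"
  by (auto simp: adic_def)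

lemma adic_const: "A \<in> pZ b \<Longrightarrow> adic (\<lambda>_. A)"
  unfolding adic_def by (auto intro!: evZ_const exI[of _ A] exI[of _ b])

lemma adic_of_int: "adic (\<lambda>_. of_int i)"
  using adic_const[OF pZ_I[of i 0]] by simp

lemma adic_1: "adic (\<lambda>_. 1)" and adic_2: "adic (\<lambda>_. 2)" and adic_0: "adic (\<lambda>_. 0)"
  using adic_of_int[of 1] adic_of_int[of 2] adic_of_int[of 0] by simp_all

lemma adic_powi: "adic (\<lambda>_. pp b)"
  by (rule adic_const[OF powi_in_pZ[OF order.refl]])

lemma adic_add: assumes "adic s" "adic t" shows "adic (\<lambda>n. s n + t n)"
proof -
  obtain b c where "evZ b s" "evZ c t" using assms adicD by blast
  hence "evZ (min b c) (\<lambda>n. s n + t n)" by (intro evZ_add) (auto elim: evZ_mono)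
  moreover have "\<exists>A. evZ N (\<lambda>n. s n + t n - A)" for N
  proof -
    obtain A B where "evZ N (\<lambda>n. s n - A)" "evZ N (\<lambda>n. t n - B)" using assms adicD by blast
    from evZ_add[OF this] have "evZ N (\<lambda>n. s n + t n - (A + B))" by (rule evZ_eq) simp
    thus ?thesis ..
  qed
  ultimately show ?thesis by (auto simp: adic_def)
qed

lemma adic_mult: assumes "adic s" "adic t" shows "adic (\<lambda>n. s n * t n)"
proof -
  obtain b c where bc: "evZ b s" "evZ c t" using assms adicD by blast
  have "\<exists>A. evZ N (\<lambda>n. s n * t n - A)" for N
  proof -
    obtain A where A: "evZ (N - c) (\<lambda>n. s n - A)" using assms adicD by blast
    \<comment> \<open>The modulus is at least p^c so that B inherits the bound of t; only then is
      \<open>(s n - A) * B\<close> divisible by p^N.\<close>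
    obtain B where B: "evZ (max (N - b) c) (\<lambda>n. t n - B)" using assms adicD by blast
    have "evZ c (\<lambda>n. t n - (t n - B))"
      by (rule evZ_diff[OF bc(2) evZ_mono[OF B]]) simp
    hence "evZ c (\<lambda>_. B)" by simp
    from evZ_mult[OF A this] have 1: "evZ N (\<lambda>n. (s n - A) * B)" by simp
    have "evZ (N - b) (\<lambda>n. t n - B)" by (rule evZ_mono[OF B]) simp
    from evZ_mult[OF bc(1) this] have 2: "evZ N (\<lambda>n. s n * (t n - B))" by simp
    from evZ_add[OF 1 2] have "evZ N (\<lambda>n. s n * t n - A * B)" by (rule evZ_eq) (simp add: algebra_simps)
    thus ?thesis ..
  qed
  thus ?thesis using evZ_mult[OF bc] by (auto simp: adic_def)
qed

lemma adic_minus: "adic s \<Longrightarrow> adic (\<lambda>n. - s n)"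
  using adic_mult[OF adic_of_int[of "-1"]] by simp

lemma adic_diff: "adic s \<Longrightarrow> adic t \<Longrightarrow> adic (\<lambda>n. s n - t n)"
  using adic_add[OF _ adic_minus] by simp

lemma adic_power: "adic s \<Longrightarrow> adic (\<lambda>n. s n ^ k)"
  by (induction k) (auto intro: adic_mult adic_1)

lemmas adic_intros = adic_add adic_mult adic_minus adic_diff adic_1 adic_2 adic_0 adic_power adic_powi

lemma evZ_rep: "\<forall>i<b. x i = 0 \<Longrightarrow> evZ b (rep x)"
  by (simp add: evZ_def rep_def ptrunc_pZ)

lemma rep_trunc: assumes "x \<in> Qp" shows "evZ N (\<lambda>n. rep x n - ptrunc p x N)"
  unfolding evZ_def eventually_sequentially rep_def
proof (intro exI allI impI)
  fix n assume "nat N \<le> n"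
  thus "ptrunc p x (int n) - ptrunc p x N \<in> pZ N" using assms by (intro ptrunc_diff) auto
qed

lemma adic_rep: assumes "x \<in> Qp" shows "adic (rep x)"
proof -
  obtain L where "\<forall>i<L. x i = 0" using Omega_low[OF assms, of 0] by auto
  thus ?thesis using rep_trunc[OF assms] evZ_rep unfolding adic_def by blast
qed

text \<open>The interface between digits and sequences: equality of digits becomes a congruence,
  which is stable under the ring operations.\<close>

lemma agree_iff:
  assumes "x \<in> Qp" "y \<in> Qp"
  shows "(\<forall>i<N. x i = y i) \<longleftrightarrow> evZ N (\<lambda>n. rep x n - rep y n)"
proof
  assume "\<forall>i<N. x i = y i"
  hence eq: "ptrunc p x N = ptrunc p y N" by (intro ptrunc_cong) auto
  show "evZ N (\<lambda>n. rep x n - rep y n)"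
    by (rule evZ_trans[OF rep_trunc[OF assms(1), of N, unfolded eq] evZ_sym[OF rep_trunc[OF assms(2), of N]]])
next
  assume "evZ N (\<lambda>n. rep x n - rep y n)"
  from evZ_trans[OF evZ_sym[OF rep_trunc[OF assms(1), of N]] this]
  have "evZ N (\<lambda>n. ptrunc p x N - rep y n)" .
  from evZ_trans[OF this rep_trunc[OF assms(2), of N]]
  have "ptrunc p x N - ptrunc p y N \<in> pZ N" by (simp add: evZ_const_iff)
  thus "\<forall>i<N. x i = y i" using digits_eq[OF assms] by blast
qed

lemma rep_padd:
  assumes "x \<in> Qp" "y \<in> Qp"
  shows "evZ N (\<lambda>n. rep (padd p x y) n - (rep x n + rep y n))"
  unfolding evZ_def eventually_sequentially
proof (intro exI allI impI)
  fix n assume "nat N \<le> n"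
  hence "N \<le> int n" by simp
  thus "rep (padd p x y) n - (rep x n + rep y n) \<in> pZ N"
    using pZ_mono[OF _ padd_trunc(2)[OF assms, of "int n"]] by (simp add: rep_def)
qed

lemma rep_pneg:
  assumes "x \<in> Qp"
  shows "evZ N (\<lambda>n. rep (pneg p x) n - (- rep x n))"
  unfolding evZ_def eventually_sequentially
proof (intro exI allI impI)
  fix n assume "nat N \<le> n"
  hence "N \<le> int n" by simp
  thus "rep (pneg p x) n - (- rep x n) \<in> pZ N"
    using pZ_mono[OF _ pneg_trunc(2)[OF assms, of "int n"]] by (simp add: rep_def)
qed

lemma rep_pmul:
  assumes "x \<in> Qp" "y \<in> Qp"
  shows "evZ N (\<lambda>n. rep (pmul p x y) n - (rep x n * rep y n))"
proof -
  obtain J where J: "J \<ge> 0" "\<forall>i < -J. x i = 0" "\<forall>i < -J. y i = 0" using pmul_ex[OF assms] .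
  have "evZ N (\<lambda>n. ptrunc p (pmul p x y) N - (rep x n * rep y n))"
    unfolding evZ_def eventually_sequentially
  proof (intro exI allI impI)
    fix n assume "nat (N + J) \<le> n"
    hence "N + J \<le> int n" by simp
    from pmul_trunc(2)[OF assms J this]
    show "ptrunc p (pmul p x y) N - rep x n * rep y n \<in> pZ N" by (simp add: rep_def)
  qed
  from evZ_trans[OF rep_trunc[OF pmul_Omega[OF assms]] this] show ?thesis .
qed

subsection \<open>Characters\<close>

text \<open>The standard additive character \<open>x \<mapsto> exp (2 \<pi> i {x})\<close>: for convergent sequences \<open>t\<close> the limit
  is attained, as \<open>t n\<close> is eventually constant modulo 1.\<close>

definition ecis :: "(nat \<Rightarrow> real) \<Rightarrow> complex" where
  "ecis t = lim (\<lambda>n. cis (2 * pi * t n))"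

lemma cis_int: "A - B \<in> pZ 0 \<Longrightarrow> cis (2 * pi * A) = cis (2 * pi * B)"
proof -
  assume "A - B \<in> pZ 0"
  then obtain i where i: "A = B + of_int i" by (auto simp: pZ_0_iff elim!: Ints_cases) (metis add.commute diff_add_cancel)
  have "2 * pi * A = 2 * pi * B + 2 * pi * of_int i" by (simp add: i algebra_simps)
  thus ?thesis by (simp add: cis_mult[symmetric] cis_multiple_2pi)
qed

lemma cis_eq_1: "cis (2 * pi * A) = 1 \<Longrightarrow> A \<in> pZ 0"
proof -
  assume "cis (2 * pi * A) = 1"
  hence "cos (2 * pi * A) = 1" by (metis cis.sel(1) one_complex.sel(1))
  then obtain n :: int where "2 * pi * A = of_int n * 2 * pi" by (auto simp: cos_one_2pi_int)
  thus ?thesis using pZ_I[of n 0] by simp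
qed

lemma ecis_ev: assumes "adic t" shows "\<forall>\<^sub>F n in sequentially. cis (2 * pi * t n) = ecis t"
proof -
  obtain A where "evZ 0 (\<lambda>n. t n - A)" using assms adicD by blast
  hence ev: "\<forall>\<^sub>F n in sequentially. cis (2 * pi * t n) = cis (2 * pi * A)"
    unfolding evZ_def by (rule eventually_mono) (rule cis_int)
  hence "(\<lambda>n. cis (2 * pi * t n)) \<longlonglongrightarrow> cis (2 * pi * A)"
    by (rule tendsto_eventually)
  hence "ecis t = cis (2 * pi * A)" unfolding ecis_def by (rule limI)
  thus ?thesis using ev by simp
qed

lemma ecis_eqI: assumes "adic t" "\<forall>\<^sub>F n in sequentially. cis (2 * pi * t n) = z" shows "ecis t = z"
proof -
  have "\<forall>\<^sub>F n in sequentially. ecis t = z" using ecis_ev[OF assms(1)] assms(2) by eventually_elim simp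
  thus ?thesis by simp
qed

lemma ecis_cong: assumes "adic s" "adic t" "evZ 0 (\<lambda>n. s n - t n)" shows "ecis s = ecis t"
proof (rule ecis_eqI[OF assms(1)])
  show "\<forall>\<^sub>F n in sequentially. cis (2 * pi * s n) = ecis t"
    using ecis_ev[OF assms(2)] assms(3)[unfolded evZ_def] by eventually_elim (simp add: cis_int)
qed

lemma ecis_add: assumes "adic s" "adic t" shows "ecis (\<lambda>n. s n + t n) = ecis s * ecis t"
  by (rule ecis_eqI[OF adic_add[OF assms]], use ecis_ev[OF assms(1)] ecis_ev[OF assms(2)] in eventually_elim)
     (simp add: distrib_left flip: cis_mult)

lemma ecis_minus: assumes "adic s" shows "ecis (\<lambda>n. - s n) = cnj (ecis s)"
  by (rule ecis_eqI[OF adic_minus[OF assms]], use ecis_ev[OF assms(1)] in eventually_elim)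
     (metis cis_cnj mult_minus_right)

lemma norm_ecis: assumes "adic s" shows "norm (ecis s) = 1"
proof -
  have "\<forall>\<^sub>F n in sequentially. norm (ecis s) = 1" using ecis_ev[OF assms]
    by eventually_elim (metis norm_cis)
  thus ?thesis by simp
qed

lemma ecis_0: "adic s \<Longrightarrow> evZ 0 s \<Longrightarrow> ecis s = 1"
  using ecis_cong[OF _ adic_0, of s] ecis_eqI[OF adic_0, of 1] by simp

lemma ecis_eq_1: assumes "adic s" "ecis s = 1" shows "evZ 0 s"
  unfolding evZ_def using ecis_ev[OF assms(1)] by eventually_elim (simp add: assms(2) cis_eq_1)

text \<open>Omega_p is its own dual: this is the character x |-> exp (2 pi i {sx}) belonging to the
  limit of s. Sequences as parameters allow frequencies such as (1 - \<alpha>) w to be written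
  pointwise.\<close>

definition chi :: "(nat \<Rightarrow> real) \<Rightarrow> padic \<Rightarrow> complex" where
  "chi s x = ecis (\<lambda>n. s n * rep x n)"

lemma adic_pair: "adic s \<Longrightarrow> x \<in> Qp \<Longrightarrow> adic (\<lambda>n. s n * rep x n)"
  by (intro adic_mult adic_rep)

lemma chi_norm: "adic s \<Longrightarrow> x \<in> Qp \<Longrightarrow> norm (chi s x) = 1"
  unfolding chi_def by (intro norm_ecis adic_pair)

text \<open>Representatives of sums, negatives and products agree with the pointwise operations only
  modulo every p^N. A p-adically bounded factor preserves this, and the character does not see the
  difference.\<close>

lemma ecis_mult_cong:
  assumes "adic s" "adic u" "adic v" "\<And>N. evZ N (\<lambda>n. u n - v n)"
  shows "ecis (\<lambda>n. s n * u n) = ecis (\<lambda>n. s n * v n)"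
proof -
  obtain b where "evZ b s" using assms adicD by blast
  from evZ_mult[OF this assms(4)[of "-b"]] have "evZ 0 (\<lambda>n. s n * u n - s n * v n)"
    by (simp add: algebra_simps)
  thus ?thesis by (intro ecis_cong adic_mult assms)
qed

lemma chi_padd:
  assumes "adic s" "x \<in> Qp" "y \<in> Qp"
  shows "chi s (padd p x y) = chi s x * chi s y"
proof -
  have "chi s (padd p x y) = ecis (\<lambda>n. s n * (rep x n + rep y n))"
    unfolding chi_def using assms
    by (intro ecis_mult_cong adic_add adic_rep rep_padd padd_Omega)
  also have "\<dots> = chi s x * chi s y"
    unfolding chi_def using assms by (simp add: distrib_left ecis_add adic_pair)
  finally show ?thesis .
qed

lemma chi_pneg:
  assumes "adic s" "x \<in> Qp"
  shows "chi s (pneg p x) = cnj (chi s x)" "chi (\<lambda>n. - s n) x = cnj (chi s x)"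
proof -
  have "chi s (pneg p x) = ecis (\<lambda>n. s n * (- rep x n))"
    unfolding chi_def using assms
    by (intro ecis_mult_cong adic_minus adic_rep rep_pneg pneg_Omega)
  also have "\<dots> = cnj (chi s x)"
    unfolding chi_def using assms by (simp add: ecis_minus adic_pair)
  finally show "chi s (pneg p x) = cnj (chi s x)" .
  show "chi (\<lambda>n. - s n) x = cnj (chi s x)"
    unfolding chi_def using assms by (simp add: ecis_minus adic_pair)
qed

lemma chi_pmul:
  assumes "adic s" "a \<in> Qp" "x \<in> Qp"
  shows "chi s (pmul p a x) = chi (\<lambda>n. s n * rep a n) x"
  unfolding chi_def mult.assoc using assms
  by (intro ecis_mult_cong adic_mult adic_rep rep_pmul pmul_Omega)

lemma chi_add:
  assumes "adic s" "adic t" "x \<in> Qp"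
  shows "chi (\<lambda>n. s n + t n) x = chi s x * chi t x"
  unfolding chi_def using assms by (simp add: distrib_right ecis_add adic_pair)

text \<open>The annihilator of p^b Delta is p^(-b) Delta, so a character evaluated on p^b Delta
  depends on its frequency only modulo p^(-b).\<close>

lemma chi_cong:
  assumes "adic s" "adic t" "\<forall>i<b. x i = 0" "x \<in> Qp" "evZ (-b) (\<lambda>n. s n - t n)"
  shows "chi s x = chi t x"
proof -
  from evZ_mult[OF assms(5) evZ_rep[OF assms(3)]] have "evZ 0 (\<lambda>n. s n * rep x n - t n * rep x n)"
    by (simp add: algebra_simps)
  thus ?thesis unfolding chi_def using assms by (intro ecis_cong adic_pair)
qed

lemma chi_agree:
  assumes "adic s" "evZ b s" "x \<in> Qp" "y \<in> Qp" "\<forall>i < -b. x i = y i"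
  shows "chi s x = chi s y"
proof -
  have "evZ (-b) (\<lambda>n. rep x n - rep y n)" using agree_iff assms by blast
  from evZ_mult[OF assms(2) this] have "evZ 0 (\<lambda>n. s n * rep x n - s n * rep y n)"
    by (simp add: algebra_simps)
  thus ?thesis unfolding chi_def using assms by (intro ecis_cong adic_pair)
qed

subsection \<open>Levels and inverses\<close>

text \<open>\<open>lev b s\<close>: the limit of \<open>s\<close> has p-adic valuation exactly \<open>b\<close>.\<close>

definition lev :: "int \<Rightarrow> (nat \<Rightarrow> real) \<Rightarrow> bool" where
  "lev b s \<longleftrightarrow> (\<forall>\<^sub>F n in sequentially. \<exists>i::int. s n = of_int i * pp b \<and> \<not> int p dvd i)"

lemma lev_evZ: "lev b s \<Longrightarrow> evZ b s"
  unfolding lev_def evZ_def by (erule eventually_mono) (auto simp: pZ_def)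

lemma prime_int_p: "prime (int p)"
  using prime_p by simp

lemma lev_mult: "lev b s \<Longrightarrow> lev c t \<Longrightarrow> lev (b + c) (\<lambda>n. s n * t n)"
  unfolding lev_def
proof (erule (1) eventually_elim2, elim exE conjE)
  fix n i j assume "s n = of_int i * pp b" "t n = of_int j * pp c"
    "\<not> int p dvd i" "\<not> int p dvd j"
  thus "\<exists>i. s n * t n = of_int i * pp (b + c) \<and> \<not> int p dvd i"
    using prime_int_p by (intro exI[of _ "i * j"]) (auto simp: powi_add prime_dvd_mult_iff)
qed

lemma lev_const: "\<not> int p dvd i \<Longrightarrow> lev b (\<lambda>_. of_int i * pp b)"
  by (auto simp: lev_def)

lemma lev_powi: "lev b (\<lambda>_. pp b)"
  using lev_const[of 1 b] p_gt_1 by (simp add: zdvd1_eq)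

lemma lev_minus: "lev b s \<Longrightarrow> lev b (\<lambda>n. - s n)"
  unfolding lev_def by (erule eventually_mono) (metis dvd_minus_iff mult_minus_left of_int_minus)

text \<open>The premise \<open>t \<in> pZ k\<close> excludes denominators other than powers of p;
  without it t could have i in its denominator. Once t is in Z[1/p], coprimality of i and p
  transfers the divisibility to t.\<close>

lemma lev_cancel_pZ:
  assumes "\<not> int p dvd i" "t \<in> pZ k" "of_int i * pp b * t \<in> pZ c"
  shows "t \<in> pZ (c - b)"
proof (cases "k \<ge> c - b")
  case True thus ?thesis using assms pZ_mono by blast
next
  case False
  obtain j :: int where j: "t = of_int j * pp k" using assms by (auto simp: pZ_def)
  obtain l :: int where "of_int i * pp b * t = of_int l * pp c" using assms by (auto simp: pZ_def)
  hence l: "of_int (i * j) * pp (b + k) = of_int l * pp c"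
    by (simp add: j powi_add mult_ac)
  define m where "m = nat (c - b - k)"
  have c: "c = int m + (b + k)" using False by (simp add: m_def)
  have "of_int (i * j) * pp (b + k) = of_int (l * int p ^ m) * pp (b + k)"
    unfolding l unfolding c powi_add[of "int m"] by simp
  hence "(of_int (i * j)::real) = of_int (l * int p ^ m)" by simp
  hence "i * j = l * int p ^ m" by linarith
  hence "int p ^ m dvd i * j" by simp
  moreover have "coprime (int p ^ m) i" using assms(1) prime_int_p
    by (simp add: prime_imp_coprime)
  ultimately have "int p ^ m dvd j" by (simp add: coprime_dvd_mult_right_iff)
  then obtain j' where j': "j = int p ^ m * j'" by blast
  have "c - b = int m + k" by (simp add: c)
  hence "t = of_int j' * pp (c - b)" by (simp add: j j' powi_add)
  thus ?thesis by (simp add: pZ_I)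
qed

lemma lev_cancel:
  assumes "lev b s" "evZ k t" "evZ c (\<lambda>n. s n * t n)"
  shows "evZ (c - b) t"
  using assms unfolding lev_def evZ_def
  by eventually_elim (metis lev_cancel_pZ)

text \<open>The inverse modulo \<open>p\<^sup>n\<close> of the n-th term is taken for every n separately; these inverses
  converge automatically because they are unique modulo \<open>p\<^sup>n\<close>.\<close>

lemma lev_inverse:
  assumes "adic s" "lev b s"
  obtains t where "adic t" "lev (-b) t" "\<And>N. evZ N (\<lambda>n. s n * t n - 1)"
proof -
  have "\<forall>n. \<exists>t. \<forall>i::int. s n = of_int i * pp b \<and> \<not> int p dvd i \<longrightarrow>
     (\<exists>j. t = of_int j * pp (-b) \<and> \<not> int p dvd j \<and> s n * t - 1 \<in> pZ (int n))"
  proof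
    fix n
    show "\<exists>t. \<forall>i::int. s n = of_int i * pp b \<and> \<not> int p dvd i \<longrightarrow>
     (\<exists>j. t = of_int j * pp (-b) \<and> \<not> int p dvd j \<and> s n * t - 1 \<in> pZ (int n))"
    proof (cases "\<exists>i::int. s n = of_int i * pp b \<and> \<not> int p dvd i")
      case True
      then obtain i :: int where i: "s n = of_int i * pp b" "\<not> int p dvd i" by blast
      \<comment> \<open>The exponent is \<open>Suc n\<close> rather than n so that
        \<open>i * j - 1\<close> is divisible by p even for n = 0, which is what makes j prime to
        p.\<close>
      have "coprime (int p ^ Suc n) i" using i(2) prime_int_p
        by (meson coprime_power_left_iff prime_imp_coprime)
      hence "coprime i (int p ^ Suc n)" by (simp add: coprime_commute)
      then obtain j where j: "[i * j = 1] (mod (int p ^ Suc n))" using cong_solve_coprime_int by blast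
      then obtain l where l: "i * j - 1 = int p ^ Suc n * l" by (auto simp: cong_iff_dvd_diff)
      have nd: "\<not> int p dvd j"
      proof
        assume "int p dvd j"
        hence "int p dvd i * j - int p ^ Suc n * l" by simp
        also have "i * j - int p ^ Suc n * l = 1" using l by simp
        finally show False using p_gt_1 by simp
      qed
      have "s n * (of_int j * pp (-b)) - 1 = of_int (i * j - 1)"
        by (simp add: i)
      also have "\<dots> = of_int (int p * l) * pp (int n)"
        by (simp add: l)
      finally have "s n * (of_int j * pp (-b)) - 1 \<in> pZ (int n)" by (simp only: pZ_I)
      thus ?thesis using nd by blast
    qed blast
  qed
  from choice[OF this] obtain t where t: "\<And>n i. s n = of_int i * pp b \<Longrightarrow> \<not> int p dvd i \<Longrightarrow>
     \<exists>j. t n = of_int j * pp (-b) \<and> \<not> int p dvd j \<and> s n * t n - 1 \<in> pZ (int n)"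
    by blast
  have lev: "lev (-b) t" using assms(2) unfolding lev_def by (rule eventually_mono) (use t in blast)
  have inv: "evZ N (\<lambda>n. s n * t n - 1)" for N
  proof -
    have "\<forall>\<^sub>F n in sequentially. N \<le> int n"
      using eventually_ge_at_top[of "nat N"] by eventually_elim simp
    with assms(2)[unfolded lev_def] show ?thesis unfolding evZ_def
      by eventually_elim (metis t pZ_mono)
  qed
  have "\<exists>A. evZ N (\<lambda>n. t n - A)" for N
  proof -
    \<comment> \<open>Multiplication by \<open>t m\<close>, of level -b, costs b digits of
      precision, and cancelling \<open>s n\<close>, of level b, costs b more.\<close>
    obtain C where C: "evZ (N + 2 * b) (\<lambda>n. s n - C)" using assms adicD by blast
    have "\<forall>\<^sub>F n in sequentially. s n - C \<in> pZ (N + 2 * b) \<and> t n \<in> pZ (-b) \<and> s n * t n - 1 \<in> pZ (N + b)"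
      using C lev_evZ[OF lev] inv[of "N + b"] unfolding evZ_def by eventually_elim simp
    then obtain m where m: "s m - C \<in> pZ (N + 2 * b)" "t m \<in> pZ (-b)" "s m * t m - 1 \<in> pZ (N + b)"
      using eventually_happens trivial_limit_sequentially by blast
    have "evZ (N + 2 * b) (\<lambda>n. s n - s m)"
      by (rule evZ_trans[OF C evZ_const[OF pZ_sym[OF m(1)]]])
    from evZ_mult[OF this evZ_const[OF m(2)]] have "evZ (N + b) (\<lambda>n. (s n - s m) * t m)"
      by (rule evZ_mono) simp
    from evZ_add[OF this evZ_const[OF m(3)]] have "evZ (N + b) (\<lambda>n. s n * t m - 1)"
      by (rule evZ_eq) (simp add: algebra_simps)
    from evZ_diff[OF inv this] have "evZ (N + b) (\<lambda>n. s n * (t n - t m))"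
      by (rule evZ_eq) (simp add: algebra_simps)
    from lev_cancel[OF assms(2) evZ_diff[OF lev_evZ[OF lev] evZ_const[OF m(2)]] this]
    show ?thesis by auto
  qed
  hence "adic t" using lev_evZ[OF lev] by (auto simp: adic_def)
  thus ?thesis using lev inv by (rule that)
qed

lemma lev_inverse_mult:
  assumes "adic s" "lev b s"
  obtains t where "adic t" "lev (-b) t" "\<And>N v. adic v \<Longrightarrow> evZ N (\<lambda>n. s n * (t n * v n) - v n)"
proof -
  obtain t where t: "adic t" "lev (-b) t" and inv: "\<And>N. evZ N (\<lambda>n. s n * t n - 1)"
    using lev_inverse[OF assms] by blast
  have "evZ N (\<lambda>n. s n * (t n * v n) - v n)" if v: "adic v" for v N
  proof -
    obtain c where c: "evZ c v" using adicD v by blast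
    have "evZ N (\<lambda>n. (s n * t n - 1) * v n)" using evZ_mult[OF inv[of "N - c"] c] by simp
    thus ?thesis by (rule evZ_eq) (simp add: algebra_simps)
  qed
  with t show ?thesis by (rule that)
qed

section \<open>Topology, Borel sets and measurability\<close>

definition pball :: "int \<Rightarrow> padic \<Rightarrow> padic set" where
  "pball n x = {y \<in> Qp. \<forall>i<n. y i = x i}"

lemma pball_subset: "pball n x \<subseteq> Qp"
  by (auto simp: pball_def)

lemma pball_self: "x \<in> Qp \<Longrightarrow> x \<in> pball n x"
  by (auto simp: pball_def)

lemma pball_mono: "m \<le> n \<Longrightarrow> pball n x \<subseteq> pball m x"
  by (auto simp: pball_def)

lemma pball_eq: "y \<in> pball n x \<Longrightarrow> pball n y = pball n x"
  by (auto simp: pball_def)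

lemma openin_ptop:
  "openin (ptop p) U \<longleftrightarrow> U \<subseteq> Qp \<and> (\<forall>x\<in>U. \<exists>m. pball m x \<subseteq> U)"
proof -
  have "istopology (\<lambda>U. U \<subseteq> Qp \<and> (\<forall>x\<in>U. \<exists>m. pball m x \<subseteq> U))"
    unfolding istopology_def
  proof (intro conjI allI impI)
    fix S T
    assume S: "S \<subseteq> Qp \<and> (\<forall>x\<in>S. \<exists>m. pball m x \<subseteq> S)" and T: "T \<subseteq> Qp \<and> (\<forall>x\<in>T. \<exists>m. pball m x \<subseteq> T)"
    show "S \<inter> T \<subseteq> Qp" using S by auto
    show "\<forall>x\<in>S \<inter> T. \<exists>m. pball m x \<subseteq> S \<inter> T"
    proof
      fix x assume "x \<in> S \<inter> T"
      then obtain m n where "pball m x \<subseteq> S" "pball n x \<subseteq> T" using S T by blast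
      hence "pball (max m n) x \<subseteq> S \<inter> T"
        using pball_mono[of m "max m n" x] pball_mono[of n "max m n" x] by auto
      thus "\<exists>m. pball m x \<subseteq> S \<inter> T" ..
    qed
  next
    fix K assume K: "\<forall>S\<in>K. S \<subseteq> Qp \<and> (\<forall>x\<in>S. \<exists>m. pball m x \<subseteq> S)"
    show "\<Union> K \<subseteq> Qp" using K by auto
    show "\<forall>x\<in>\<Union> K. \<exists>m. pball m x \<subseteq> \<Union> K" using K by (meson Union_iff Union_upper order.trans)
  qed
  thus ?thesis by (simp add: ptop_def pball_def)
qed

lemma openin_pball: "openin (ptop p) (pball n x)"
  unfolding openin_ptop
proof (intro conjI ballI)
  fix y assume "y \<in> pball n x"
  hence "pball n y \<subseteq> pball n x" using pball_eq by auto
  thus "\<exists>m. pball m y \<subseteq> pball n x" ..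
qed (rule pball_subset)

lemma topspace_ptop: "topspace (ptop p) = Qp"
proof
  have "openin (ptop p) (Qp)" using pball_subset by (auto simp: openin_ptop)
  thus "Qp \<subseteq> topspace (ptop p)" by (rule openin_subset)
  show "topspace (ptop p) \<subseteq> Qp" using openin_topspace[of "ptop p"] unfolding openin_ptop by blast
qed

lemma space_pborel [simp]: "space BQ = Qp"
  unfolding pborel_def by (intro space_measure_of) (auto simp: openin_ptop)

lemma sets_pborel: "sets BQ = sigma_sets (Qp) {U. openin (ptop p) U}"
  unfolding pborel_def by (intro sets_measure_of) (auto simp: openin_ptop)

lemma open_sets: "openin (ptop p) U \<Longrightarrow> U \<in> sets BQ"
  unfolding sets_pborel by auto

lemma pball_sets [measurable]: "pball n x \<in> sets BQ"
  by (intro open_sets openin_pball)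

text \<open>A locally constant function has open preimages of arbitrary sets. Digits, truncations
  and characters are all of this kind.\<close>

lemma locconst_measurable:
  assumes "\<And>x. x \<in> Qp \<Longrightarrow> f x \<in> space N"
    and "\<And>x. x \<in> Qp \<Longrightarrow> \<exists>m. \<forall>y\<in>pball m x. f y = f x"
  shows "f \<in> measurable BQ N"
proof (rule measurableI)
  fix x assume "x \<in> space BQ" thus "f x \<in> space N" using assms by simp
next
  fix A
  have "openin (ptop p) (f -` A \<inter> Qp)"
    unfolding openin_ptop
  proof (intro conjI ballI)
    fix x assume x: "x \<in> f -` A \<inter> Qp"
    then obtain m where "\<forall>y\<in>pball m x. f y = f x" using assms(2) by blast
    hence "pball m x \<subseteq> f -` A \<inter> Qp" using x pball_subset by auto
    thus "\<exists>m. pball m x \<subseteq> f -` A \<inter> Qp" ..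
  qed auto
  thus "f -` A \<inter> space BQ \<in> sets BQ" by (auto intro: open_sets)
qed

lemma measurable_digit [measurable]: "(\<lambda>x. x i) \<in> measurable BQ (count_space UNIV)"
  by (rule locconst_measurable) (auto simp: pball_def intro!: exI[of _ "i + 1"])

lemma measurable_ptrunc [measurable]: "(\<lambda>x. ptrunc p x N) \<in> borel_measurable BQ"
  by (rule locconst_measurable) (auto simp: pball_def intro!: exI[of _ N] ptrunc_cong)

text \<open>The nonnegative elements of Z[1/p], a countable dense set: every ball has a centre in
  it, so there are only countably many balls.\<close>

definition fin_digits :: "padic set" where "fin_digits = {c \<in> Qp. finite {i. c i \<noteq> 0}}"

lemma countable_fin_digits: "countable fin_digits"
proof (rule countableI')
  let ?f = "\<lambda>c::padic. (\<lambda>i. (i, c i)) ` {i. c i \<noteq> 0}"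
  have "countable {A :: (int \<times> nat) set. finite A}" by (rule countable_Collect_finite)
  hence c: "countable (?f ` fin_digits)" by (rule countable_subset[rotated]) (auto simp: fin_digits_def)
  have "inj_on ?f fin_digits"
  proof (rule inj_onI)
    fix c d :: padic assume eq: "?f c = ?f d"
    have "c i = d i" for i
    proof -
      have "(i, k) \<in> ?f c \<longleftrightarrow> c i = k \<and> k \<noteq> 0" "(i, k) \<in> ?f d \<longleftrightarrow> d i = k \<and> k \<noteq> 0" for k by auto
      thus ?thesis unfolding eq by (metis (no_types))
    qed
    thus "c = d" by auto
  qed
  with c have "countable fin_digits" using countable_image_inj_on by blast
  thus "inj_on (to_nat_on fin_digits) fin_digits" by (rule inj_on_to_nat_on)
qed

lemma pball_fin_digits:
  assumes "x \<in> Qp" obtains c where "c \<in> fin_digits" "pball n c = pball n x"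
proof
  let ?c = "\<lambda>i. if i < n then x i else 0"
  obtain L where L: "\<forall>i<L. x i = 0" using Omega_low[OF assms, of 0] by auto
  have "?c \<in> Qp" using Omega_less[OF assms] L by (intro OmegaI[of _ L]) auto
  moreover have "{i. ?c i \<noteq> 0} = {j. j < n \<and> x j \<noteq> 0}" by auto
  ultimately show "?c \<in> fin_digits" using finite_supp[OF assms, of n] by (simp add: fin_digits_def)
  show "pball n ?c = pball n x" by (auto simp: pball_def)
qed

lemma Union_pball_fin_digits: "\<Union> (pball a ` fin_digits) = Qp"
proof (intro equalityI subsetI)
  fix x assume x: "x \<in> Qp"
  obtain c where "c \<in> fin_digits" "pball a c = pball a x" using pball_fin_digits[OF x] .
  thus "x \<in> \<Union> (pball a ` fin_digits)" using pball_self[OF x] by blast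
qed (use pball_subset in auto)

lemma fin_digits_Omega: "c \<in> fin_digits \<Longrightarrow> c \<in> Qp" by (simp add: fin_digits_def)

text \<open>The balls of radius at most p^(-a). Measures are computed, or recovered by Fourier
  inversion, only on balls that are small enough, and for each a these still generate all Borel
  sets.\<close>

definition balls :: "int \<Rightarrow> padic set set" where
  "balls a = insert {} {pball n x | n x. a \<le> n \<and> x \<in> Qp}"

lemma sets_pborel_balls: "sets BQ = sigma_sets (Qp) (balls a)"
proof
  show "sigma_sets (Qp) (balls a) \<subseteq> sets BQ"
  proof -
    have "balls a \<subseteq> sets BQ" unfolding balls_def by (auto simp: pball_sets)
    from sets.sigma_sets_subset[OF this] show ?thesis by simp
  qed
  have "U \<in> sigma_sets (Qp) (balls a)" if U: "openin (ptop p) U" for U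
  proof -
    interpret sigma_algebra "Qp" "sigma_sets (Qp) (balls a)"
      by (rule sigma_algebra_sigma_sets) (use pball_subset in \<open>auto simp: balls_def\<close>)
    define I where "I = {(n, c). a \<le> n \<and> c \<in> fin_digits \<and> pball n c \<subseteq> U}"
    have "I \<subseteq> UNIV \<times> fin_digits" by (auto simp: I_def)
    hence "countable I" using countable_fin_digits by (rule_tac countable_subset) auto
    moreover have "U = (\<Union>i\<in>I. pball (fst i) (snd i))"
    proof (intro equalityI subsetI)
      fix x assume x: "x \<in> U"
      hence xO: "x \<in> Qp" using U by (auto simp: openin_ptop)
      obtain m where "pball m x \<subseteq> U" using x U by (auto simp: openin_ptop)
      hence m: "pball (max a m) x \<subseteq> U" using pball_mono[of m "max a m" x] by auto
      obtain c where c: "c \<in> fin_digits" "pball (max a m) c = pball (max a m) x" using pball_fin_digits[OF xO] .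
      hence "(max a m, c) \<in> I" using m by (simp add: I_def)
      moreover have "x \<in> pball (max a m) c" using c pball_self[OF xO] by simp
      ultimately show "x \<in> (\<Union>i\<in>I. pball (fst i) (snd i))" by force
    qed (auto simp: I_def)
    moreover have "pball (fst i) (snd i) \<in> sigma_sets (Qp) (balls a)" if "i \<in> I" for i
      using that fin_digits_Omega by (intro sigma_sets.Basic) (force simp: I_def balls_def)
    ultimately show ?thesis using countable_UN'[of I "\<lambda>i. pball (fst i) (snd i)"] by auto
  qed
  thus "sets BQ \<subseteq> sigma_sets (Qp) (balls a)"
    unfolding sets_pborel by (intro sigma_sets_mono) auto
qed

lemma measurable_into:
  assumes "\<And>w. w \<in> space M \<Longrightarrow> f w \<in> Qp"
    and [measurable]: "\<And>i. (\<lambda>w. f w i) \<in> measurable M (count_space UNIV)"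
  shows "f \<in> measurable M BQ"
proof (rule measurable_sigma_sets[OF sets_pborel_balls[of 0]])
  show "balls 0 \<subseteq> Pow (Qp)" using pball_subset by (auto simp: balls_def)
  show "f \<in> space M \<rightarrow> Qp" using assms(1) by auto
  fix B assume "B \<in> balls 0"
  then consider "B = {}" | n x where "B = pball n x" by (auto simp: balls_def)
  thus "f -` B \<inter> space M \<in> sets M"
  proof cases
    case 2
    hence "f -` B \<inter> space M = {w \<in> space M. \<forall>i. i < n \<longrightarrow> f w i = x i}"
      using assms(1) by (auto simp: pball_def)
    also have "\<dots> \<in> sets M" by measurable
    finally show ?thesis .
  qed simp
qed

lemma measurable_rdigit [measurable]: "(\<lambda>A. rdigit p A n) \<in> measurable borel (count_space UNIV)"
proof -
  have "(\<lambda>A. A / pp n) \<in> borel_measurable borel" by simp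
  from measurable_compose[OF this measurable_real_floor]
  have "(\<lambda>A. \<lfloor>A / pp n\<rfloor>) \<in> measurable borel (count_space UNIV)" .
  from measurable_compose[OF this, of "\<lambda>i. nat (i mod int p)" "count_space UNIV"]
  show ?thesis by (simp add: rdigit_def)
qed

lemma measurable_padd:
  assumes [measurable]: "f \<in> measurable M BQ" "g \<in> measurable M BQ"
  shows "(\<lambda>w. padd p (f w) (g w)) \<in> measurable M BQ"
proof (rule measurable_into)
  show "padd p (f w) (g w) \<in> Qp" if "w \<in> space M" for w
    using measurable_space[OF assms(1) that] measurable_space[OF assms(2) that] by (simp add: padd_Omega)
qed (unfold padd_def, measurable)

lemma measurable_pneg:
  assumes [measurable]: "f \<in> measurable M BQ"
  shows "(\<lambda>w. pneg p (f w)) \<in> measurable M BQ"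
proof (rule measurable_into)
  show "pneg p (f w) \<in> Qp" if "w \<in> space M" for w
    using measurable_space[OF assms(1) that] by (simp add: pneg_Omega)
qed (unfold pneg_def, measurable)

text \<open>\<open>pmul\<close> is given by a description and does not decompose into measurable
  pieces. Instead, if a lies in p^b Delta, digit i of the product depends only on the digits of x
  below i + 1 - b, so it is locally constant.\<close>

lemma measurable_pmul:
  assumes a: "a \<in> Qp" and f: "f \<in> measurable M BQ"
  shows "(\<lambda>w. pmul p a (f w)) \<in> measurable M BQ"
proof (rule measurable_compose[OF f], rule measurable_into)
  fix i
  obtain b where b: "evZ b (rep a)" using adic_rep[OF a] adicD by blast
  show "(\<lambda>x. pmul p a x i) \<in> measurable BQ (count_space UNIV)"
  proof (rule locconst_measurable)
    fix x assume x: "x \<in> Qp"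
    have "pmul p a y i = pmul p a x i" if y: "y \<in> pball (i + 1 - b) x" for y
    proof -
      have yO: "y \<in> Qp" using y pball_subset by auto
      have "evZ (i + 1 - b) (\<lambda>n. rep y n - rep x n)"
        using y agree_iff[OF yO x] by (simp add: pball_def)
      from evZ_mult[OF b this] have 1: "evZ (i + 1) (\<lambda>n. rep a n * rep y n - rep a n * rep x n)"
        by (simp add: algebra_simps)
      have "evZ (i + 1) (\<lambda>n. rep (pmul p a y) n - rep (pmul p a x) n)"
        by (rule evZ_trans[OF rep_pmul[OF a yO] evZ_trans[OF 1 evZ_sym[OF rep_pmul[OF a x]]]])
      thus ?thesis using agree_iff[OF pmul_Omega[OF a yO] pmul_Omega[OF a x], of "i + 1"] by simp
    qed
    thus "\<exists>m. \<forall>y\<in>pball m x. pmul p a y i = pmul p a x i" by blast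
  qed simp
qed (simp add: pmul_Omega a)

lemma measurable_chi:
  assumes "adic s" shows "chi s \<in> borel_measurable BQ"
proof (rule locconst_measurable)
  obtain b where "evZ b s" using adicD assms by blast
  fix x assume x: "x \<in> Qp"
  show "\<exists>m. \<forall>y\<in>pball m x. chi s y = chi s x"
    using chi_agree[OF assms \<open>evZ b s\<close> _ x] by (intro exI[of _ "-b"]) (auto simp: pball_def)
qed simp

text \<open>By the ultrametric property two balls are disjoint or nested; the disjoint case is why
  the empty set belongs to \<open>balls\<close>.\<close>

lemma Int_stable_balls: "Int_stable (balls a)"
proof (rule Int_stableI)
  have *: "pball m x \<inter> pball n y = {} \<or> pball m x \<inter> pball n y = pball n y"
    if "m \<le> n" for m n x y
  proof (cases "pball m x \<inter> pball n y = {}")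
    case False
    then obtain z where "z \<in> pball m x" "z \<in> pball n y" by blast
    thus ?thesis using pball_mono[OF that, of z] pball_eq by auto
  qed simp
  fix A B assume AB: "A \<in> balls a" "B \<in> balls a"
  show "A \<inter> B \<in> balls a"
  proof (cases "A = {} \<or> B = {}")
    case True thus ?thesis by (auto simp: balls_def)
  next
    case False
    then obtain m x n y where "A = pball m x" "a \<le> m" "x \<in> Qp" "B = pball n y" "a \<le> n" "y \<in> Qp"
      using AB by (auto simp: balls_def)
    thus ?thesis using *[of m n x y] *[of n m y x] AB
      by (cases "m \<le> n") (auto simp: Int_commute balls_def)
  qed
qed

section \<open>Distributions, characteristic functions and the functional equation\<close>

definition pprob :: "padic measure \<Rightarrow> bool" where
  "pprob \<mu> \<longleftrightarrow> prob_space \<mu> \<and> sets \<mu> = sets BQ"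

lemma pprob_prob: "pprob \<mu> \<Longrightarrow> prob_space \<mu>" by (simp add: pprob_def)

lemma measure_eqI_balls:
  assumes M: "pprob M" and N: "pprob N"
    and eq: "\<And>n x. a \<le> n \<Longrightarrow> x \<in> Qp \<Longrightarrow> emeasure M (pball n x) = emeasure N (pball n x)"
  shows "M = N"
proof (rule measure_eqI_generator_eq_countable[where E = "balls a" and \<Omega> = "Qp" and A = "pball a ` fin_digits"])
  interpret prob_space M using M by (rule pprob_prob)
  show "Int_stable (balls a)" by (rule Int_stable_balls)
  show "balls a \<subseteq> Pow (Qp)" using pball_subset by (auto simp: balls_def)
  show "emeasure M X = emeasure N X" if "X \<in> balls a" for X using that eq by (auto simp: balls_def)
  show "sets M = sigma_sets (Qp) (balls a)" "sets N = sigma_sets (Qp) (balls a)"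
    using M N sets_pborel_balls unfolding pprob_def by auto
  show "pball a ` fin_digits \<subseteq> balls a" using fin_digits_Omega by (auto simp: balls_def)
  show "\<Union> (pball a ` fin_digits) = Qp" by (rule Union_pball_fin_digits)
  show "countable (pball a ` fin_digits)" using countable_fin_digits by simp
  show "emeasure M X \<noteq> \<infinity>" for X by simp
qed

lemma pprob_space: "pprob \<mu> \<Longrightarrow> space \<mu> = Qp"
  unfolding pprob_def by (metis sets_eq_imp_space_eq space_pborel)

lemma pprob_measurable: "pprob \<mu> \<Longrightarrow> measurable \<mu> N = measurable BQ N"
  unfolding pprob_def by (intro measurable_cong_sets) auto

lemma pprob_distr: "prob_space M \<Longrightarrow> f \<in> measurable M BQ \<Longrightarrow> pprob (distr M BQ f)"
  unfolding pprob_def by (simp add: prob_space.prob_space_distr)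

definition chf :: "padic measure \<Rightarrow> (nat \<Rightarrow> real) \<Rightarrow> complex" where
  "chf \<mu> s = (\<integral>x. chi s x \<partial>\<mu>)"

lemma chf_distr:
  assumes "adic s" "f \<in> measurable M BQ"
  shows "chf (distr M BQ f) s = (\<integral>w. chi s (f w) \<partial>M)"
  unfolding chf_def by (rule integral_distr[OF assms(2) measurable_chi[OF assms(1)]])

lemma measurable_chi':
  assumes "adic s" "f \<in> measurable M BQ"
  shows "(\<lambda>w. chi s (f w)) \<in> borel_measurable M"
  by (rule measurable_compose[OF assms(2) measurable_chi[OF assms(1)]])

lemma integrable_chi:
  assumes "prob_space M" "adic s" "f \<in> measurable M BQ"
  shows "integrable M (\<lambda>w. chi s (f w))"
proof -
  interpret prob_space M by fact
  show ?thesis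
    by (rule integrable_const_bound[where B = 1])
       (use chi_norm[OF assms(2)] measurable_space[OF assms(3)] measurable_chi'[OF assms(2,3)] in auto)
qed

text \<open>Only the limit of s matters: each x lies in some p^L Delta, and agreement modulo p^(-L)
  gives equality of the characters at this x, with L depending on x.\<close>

lemma chf_cong:
  assumes "pprob \<mu>" "adic s" "adic t" "\<And>N. evZ N (\<lambda>n. s n - t n)"
  shows "chf \<mu> s = chf \<mu> t"
  unfolding chf_def
proof (rule Bochner_Integration.integral_cong[OF refl])
  fix x assume "x \<in> space \<mu>"
  hence x: "x \<in> Qp" using pprob_space[OF assms(1)] by simp
  obtain L where "\<forall>i<L. x i = 0" using Omega_low[OF x, of 0] by auto
  thus "chi s x = chi t x" using assms x by (intro chi_cong)
qed

lemma Omega_sets [simp]: "Qp \<in> sets BQ"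
  using sets.top[of "BQ"] by simp

text \<open>The sigma-algebra generated by L1 consists of the preimages of Borel sets A. Integrating
  the two conditional probabilities over such a preimage gives P(L1 in A, L2 in B) = P(L1 in A, -L2
  in B), and these rectangles determine the joint distribution.\<close>

lemma cond_symmetric_iff:
  assumes "prob_space M" and L1[measurable]: "L1 \<in> measurable M BQ" and L2[measurable]: "L2 \<in> measurable M BQ"
  shows "cond_symmetric p M L1 L2 \<longleftrightarrow>
    distr M (BQ \<Otimes>\<^sub>M BQ) (\<lambda>w. (L1 w, L2 w)) = distr M (BQ \<Otimes>\<^sub>M BQ) (\<lambda>w. (L1 w, pneg p (L2 w)))"
    (is "_ \<longleftrightarrow> ?J1 = ?J2")
proof -
  interpret prob_space M by fact
  note [measurable] = measurable_pneg[OF L2]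
  define F where "F = vimage_algebra (space M) L1 BQ"
  have L1sp: "L1 \<in> space M \<rightarrow> space BQ" using measurable_space[OF L1] by auto
  have sF: "sets F = {L1 -` A \<inter> space M | A. A \<in> sets BQ}"
    unfolding F_def by (rule sets_vimage_algebra2[OF L1sp])
  have sub: "subalgebra M F"
    unfolding subalgebra_def
  proof
    show "space F = space M" by (simp add: F_def)
    show "sets F \<subseteq> sets M" unfolding sF using measurable_sets[OF L1] by auto
  qed
  interpret finite_measure_subalgebra M F by unfold_locales (rule sub)
  define R where "R X A B = measure M {w \<in> space M. L1 w \<in> A \<and> X w \<in> B}" for X :: "'a \<Rightarrow> padic" and A B
  have setint: "(LINT w:(L1 -` A \<inter> space M)|M. indicator {w\<in>space M. X w \<in> B} w) = R X A B"
    if [measurable]: "A \<in> sets BQ" "B \<in> sets BQ" "X \<in> measurable M BQ" for X A B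
  proof -
    have "(LINT w:(L1 -` A \<inter> space M)|M. indicator {w\<in>space M. X w \<in> B} w)
        = (LINT w|M. indicator {w\<in>space M. L1 w \<in> A \<and> X w \<in> B} w)"
      unfolding set_lebesgue_integral_def
      by (rule Bochner_Integration.integral_cong) (auto simp: indicator_def)
    also have "\<dots> = R X A B" unfolding R_def by simp
    finally show ?thesis .
  qed
  have int: "integrable M (indicator {w\<in>space M. X w \<in> B} :: 'a \<Rightarrow> real)"
    if [measurable]: "B \<in> sets BQ" "X \<in> measurable M BQ" for X B
    by (rule integrable_const_bound[where B = 1]) auto
  have 1: "cond_symmetric p M L1 L2 \<longleftrightarrow>
    (\<forall>A\<in>sets BQ. \<forall>B\<in>sets BQ. R L2 A B = R (\<lambda>w. pneg p (L2 w)) A B)"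
  proof (intro iffI ballI)
    fix A B assume cs: "cond_symmetric p M L1 L2" and [measurable]: "A \<in> sets BQ" "B \<in> sets BQ"
    let ?C = "L1 -` A \<inter> space M"
    have C: "?C \<in> sets F" by (auto simp: sF)
    let ?r = "\<lambda>X. real_cond_exp M F (indicator {w\<in>space M. X w \<in> B})"
    have "R L2 A B = (LINT w:?C|M. ?r L2 w)"
      by (subst setint[symmetric], simp_all) (rule real_cond_exp_intA[OF int C]; simp)
    also have "\<dots> = (LINT w:?C|M. ?r (\<lambda>w. pneg p (L2 w)) w)"
      unfolding set_lebesgue_integral_def
    proof (rule integral_cong_AE)
      show "AE w in M. indicat_real ?C w *\<^sub>R ?r L2 w = indicat_real ?C w *\<^sub>R ?r (\<lambda>w. pneg p (L2 w)) w"
        using cs unfolding cond_symmetric_def F_def[symmetric] by auto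
    qed (measurable)
    also have "\<dots> = R (\<lambda>w. pneg p (L2 w)) A B"
      by (subst setint[symmetric], simp_all) (rule real_cond_exp_intA[OF int C, symmetric]; simp)
    finally show "R L2 A B = R (\<lambda>w. pneg p (L2 w)) A B" .
  next
    assume eq: "\<forall>A\<in>sets BQ. \<forall>B\<in>sets BQ. R L2 A B = R (\<lambda>w. pneg p (L2 w)) A B"
    show "cond_symmetric p M L1 L2"
      unfolding cond_symmetric_def F_def[symmetric]
    proof
      fix B assume B[measurable]: "B \<in> sets BQ"
      show "AE w in M. real_cond_exp M F (indicator {w\<in>space M. L2 w \<in> B}) w =
         real_cond_exp M F (indicator {w\<in>space M. pneg p (L2 w) \<in> B}) w"
      proof (rule real_cond_exp_charact)
        fix C assume C: "C \<in> sets F"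
        then obtain A where A: "C = L1 -` A \<inter> space M" "A \<in> sets BQ" by (auto simp: sF)
        have "(LINT w:C|M. indicator {w\<in>space M. L2 w \<in> B} w) = R L2 A B"
          unfolding A(1) by (rule setint[OF A(2) B L2])
        also have "\<dots> = R (\<lambda>w. pneg p (L2 w)) A B" using eq A B by blast
        also have "\<dots> = (LINT w:C|M. indicator {w\<in>space M. pneg p (L2 w) \<in> B} w)"
          unfolding A(1) by (rule setint[OF A(2) B measurable_pneg[OF L2], symmetric])
        also have "\<dots> = (LINT w:C|M. real_cond_exp M F (indicator {w\<in>space M. pneg p (L2 w) \<in> B}) w)"
          by (rule real_cond_exp_intA[OF int[OF B measurable_pneg[OF L2]] C])
        finally show "(LINT w:C|M. indicator {w\<in>space M. L2 w \<in> B} w) = (LINT w:C|M. real_cond_exp M F (indicator {w\<in>space M. pneg p (L2 w) \<in> B}) w)" .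
      qed (simp_all add: int[OF B L2] real_cond_exp_int(1)[OF int[OF B measurable_pneg[OF L2]]])
    qed
  qed
  have em: "emeasure (distr M (BQ \<Otimes>\<^sub>M BQ) (\<lambda>w. (L1 w, X w))) (A \<times> B) = ennreal (R X A B)"
    if [measurable]: "A \<in> sets BQ" "B \<in> sets BQ" "X \<in> measurable M BQ" for X A B
  proof -
    have "(\<lambda>w. (L1 w, X w)) -` (A \<times> B) \<inter> space M = {w \<in> space M. L1 w \<in> A \<and> X w \<in> B}" by auto
    thus ?thesis unfolding R_def by (subst emeasure_distr) (auto simp: emeasure_eq_measure)
  qed
  have 2: "?J1 = ?J2 \<longleftrightarrow> (\<forall>A\<in>sets BQ. \<forall>B\<in>sets BQ. R L2 A B = R (\<lambda>w. pneg p (L2 w)) A B)"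
  proof (intro iffI ballI)
    fix A B assume "?J1 = ?J2" and AB: "A \<in> sets BQ" "B \<in> sets BQ"
    thus "R L2 A B = R (\<lambda>w. pneg p (L2 w)) A B"
      using em[OF AB L2] em[OF AB measurable_pneg[OF L2]] by (simp add: R_def)
  next
    assume eq: "\<forall>A\<in>sets BQ. \<forall>B\<in>sets BQ. R L2 A B = R (\<lambda>w. pneg p (L2 w)) A B"
    show "?J1 = ?J2"
    proof (rule measure_eqI_generator_eq[where E = "{a \<times> b |a b. a \<in> sets BQ \<and> b \<in> sets BQ}"
          and \<Omega> = "space BQ \<times> space BQ" and A = "\<lambda>_. space BQ \<times> space BQ"])
      fix X assume "X \<in> {a \<times> b |a b. a \<in> sets BQ \<and> b \<in> sets BQ}"
      then obtain A B where "X = A \<times> B" and AB: "A \<in> sets BQ" "B \<in> sets BQ" by auto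
      thus "emeasure ?J1 X = emeasure ?J2 X" using eq em[OF AB L2] em[OF AB measurable_pneg[OF L2]] by auto
    next
      interpret J: prob_space ?J1 by (rule prob_space_distr) measurable
      show "emeasure ?J1 (space BQ \<times> space BQ) \<noteq> \<infinity>" by simp
    next
      show "{a \<times> b |a b. a \<in> sets BQ \<and> b \<in> sets BQ} \<subseteq> Pow (space BQ \<times> space BQ)"
        using sets.space_closed[of "BQ"] by blast
    qed (auto simp: Int_stable_pair_measure_generator sets_pair_measure intro!: exI[of _ "Qp"])
  qed
  from 1 2 show ?thesis by simp
qed

text \<open>Since u L1 + v L2 = (u + v) \<xi>1 + (u + \<alpha> v) \<xi>2, independence factors the
  expectation; the second identity is the first one at -v.\<close>

lemma model_char:
  assumes "prob_space M" and x1: "\<xi>1 \<in> measurable M BQ" and x2: "\<xi>2 \<in> measurable M BQ"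
    and ind: "prob_space.indep_var M BQ \<xi>1 BQ \<xi>2"
    and a: "\<alpha> \<in> Qp" and u: "adic u" and v: "adic v"
  defines "L1 \<equiv> \<lambda>w. padd p (\<xi>1 w) (\<xi>2 w)" and "L2 \<equiv> \<lambda>w. padd p (\<xi>1 w) (pmul p \<alpha> (\<xi>2 w))"
  shows "(\<integral>w. chi u (L1 w) * chi v (L2 w) \<partial>M) =
     chf (distr M BQ \<xi>1) (\<lambda>n. u n + v n) * chf (distr M BQ \<xi>2) (\<lambda>n. u n + v n * rep \<alpha> n)"
    and "(\<integral>w. chi u (L1 w) * chi v (pneg p (L2 w)) \<partial>M) =
     chf (distr M BQ \<xi>1) (\<lambda>n. u n - v n) * chf (distr M BQ \<xi>2) (\<lambda>n. u n - v n * rep \<alpha> n)"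
proof -
  interpret prob_space M by fact
  have main: "(\<integral>w. chi u (L1 w) * chi y (L2 w) \<partial>M) =
     chf (distr M BQ \<xi>1) (\<lambda>n. u n + y n) * chf (distr M BQ \<xi>2) (\<lambda>n. u n + y n * rep \<alpha> n)"
    if y: "adic y" for y
  proof -
    have ya: "adic (\<lambda>n. y n * rep \<alpha> n)" by (intro adic_mult adic_rep y a)
    have s: "adic (\<lambda>n. u n + y n)" and t: "adic (\<lambda>n. u n + y n * rep \<alpha> n)"
      by (intro adic_add u y ya)+
    have "(\<integral>w. chi u (L1 w) * chi y (L2 w) \<partial>M) =
      (\<integral>w. chi (\<lambda>n. u n + y n) (\<xi>1 w) * chi (\<lambda>n. u n + y n * rep \<alpha> n) (\<xi>2 w) \<partial>M)"
    proof (rule Bochner_Integration.integral_cong[OF refl])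
      fix w assume "w \<in> space M"
      hence O: "\<xi>1 w \<in> Qp" "\<xi>2 w \<in> Qp" using measurable_space[OF x1] measurable_space[OF x2] by auto
      show "chi u (L1 w) * chi y (L2 w) = chi (\<lambda>n. u n + y n) (\<xi>1 w) * chi (\<lambda>n. u n + y n * rep \<alpha> n) (\<xi>2 w)"
        unfolding L1_def L2_def using O a
        by (simp add: chi_padd chi_add chi_pmul pmul_Omega u y ya)
    qed
    also have "\<dots> = (\<integral>w. chi (\<lambda>n. u n + y n) (\<xi>1 w) \<partial>M) * (\<integral>w. chi (\<lambda>n. u n + y n * rep \<alpha> n) (\<xi>2 w) \<partial>M)"
    proof (rule indep_var_lebesgue_integral)
      show "indep_var borel (\<lambda>w. chi (\<lambda>n. u n + y n) (\<xi>1 w)) borel (\<lambda>w. chi (\<lambda>n. u n + y n * rep \<alpha> n) (\<xi>2 w))"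
        using indep_var_compose[OF ind measurable_chi[OF s] measurable_chi[OF t]] by (simp add: comp_def)
    qed (intro integrable_chi assms s t prob_space_axioms)+
    finally show ?thesis by (simp add: chf_distr s t x1 x2)
  qed
  show "(\<integral>w. chi u (L1 w) * chi v (L2 w) \<partial>M) =
     chf (distr M BQ \<xi>1) (\<lambda>n. u n + v n) * chf (distr M BQ \<xi>2) (\<lambda>n. u n + v n * rep \<alpha> n)"
    by (rule main[OF v])
  have "(\<integral>w. chi u (L1 w) * chi v (pneg p (L2 w)) \<partial>M) = (\<integral>w. chi u (L1 w) * chi (\<lambda>n. - v n) (L2 w) \<partial>M)"
  proof (rule Bochner_Integration.integral_cong[OF refl])
    fix w assume "w \<in> space M"
    hence O: "\<xi>1 w \<in> Qp" "\<xi>2 w \<in> Qp" using measurable_space[OF x1] measurable_space[OF x2] by auto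
    hence "L2 w \<in> Qp" unfolding L2_def by (intro padd_Omega pmul_Omega a)
    thus "chi u (L1 w) * chi v (pneg p (L2 w)) = chi u (L1 w) * chi (\<lambda>n. - v n) (L2 w)"
      by (simp add: chi_pneg v)
  qed
  with main[OF adic_minus[OF v]]
  show "(\<integral>w. chi u (L1 w) * chi v (pneg p (L2 w)) \<partial>M) =
     chf (distr M BQ \<xi>1) (\<lambda>n. u n - v n) * chf (distr M BQ \<xi>2) (\<lambda>n. u n - v n * rep \<alpha> n)"
    by simp
qed

lemma heyde:
  assumes sm: "sym_model p \<alpha> M \<xi>1 \<xi>2" and a: "\<alpha> \<in> Qp" and u: "adic u" and v: "adic v"
  defines "f \<equiv> chf (distr M BQ \<xi>1)" and "g \<equiv> chf (distr M BQ \<xi>2)"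
  shows "f (\<lambda>n. u n + v n) * g (\<lambda>n. u n + v n * rep \<alpha> n) = f (\<lambda>n. u n - v n) * g (\<lambda>n. u n - v n * rep \<alpha> n)"
proof -
  define L1 where "L1 = (\<lambda>w. padd p (\<xi>1 w) (\<xi>2 w))"
  define L2 where "L2 = (\<lambda>w. padd p (\<xi>1 w) (pmul p \<alpha> (\<xi>2 w)))"
  have P: "prob_space M" and x[measurable]: "\<xi>1 \<in> measurable M BQ" "\<xi>2 \<in> measurable M BQ"
    and ind: "prob_space.indep_var M BQ \<xi>1 BQ \<xi>2" and cs: "cond_symmetric p M L1 L2"
    using sm by (auto simp: sym_model_def L1_def L2_def)
  have L[measurable]: "L1 \<in> measurable M BQ" "L2 \<in> measurable M BQ"
    unfolding L1_def L2_def by (intro measurable_padd measurable_pmul x a)+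
  note [measurable] = measurable_pneg[OF L(2)] measurable_chi[OF u] measurable_chi[OF v]
  have J: "distr M (BQ \<Otimes>\<^sub>M BQ) (\<lambda>w. (L1 w, L2 w)) = distr M (BQ \<Otimes>\<^sub>M BQ) (\<lambda>w. (L1 w, pneg p (L2 w)))"
    using cs cond_symmetric_iff[OF P L] by simp
  have h: "(\<lambda>z. chi u (fst z) * chi v (snd z)) \<in> borel_measurable (BQ \<Otimes>\<^sub>M BQ)" by measurable
  have "(\<integral>w. chi u (L1 w) * chi v (L2 w) \<partial>M) = (\<integral>w. chi u (L1 w) * chi v (pneg p (L2 w)) \<partial>M)"
    using arg_cong[OF J, of "\<lambda>m. \<integral>z. chi u (fst z) * chi v (snd z) \<partial>m"] h
    by (simp add: integral_distr)
  thus ?thesis unfolding f_def g_def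
    using model_char[OF P x ind a u v] by (simp add: L1_def L2_def)
qed

subsection \<open>Fourier inversion\<close>

lemma chi_of_nat:
  assumes "A \<in> pZ b" "x \<in> Qp"
  shows "chi (\<lambda>_. of_nat t * A) x = chi (\<lambda>_. A) x ^ t"
proof (induction t)
  case 0
  show ?case using ecis_0[OF adic_0] by (simp add: chi_def evZ_const_iff)
next
  case (Suc t)
  have "adic (\<lambda>_. of_nat t * A)" by (rule adic_const[OF pZ_of_int_mult[OF assms(1), of "int t", simplified]])
  from chi_add[OF this adic_const[OF assms(1)] assms(2)] Suc show ?case
    by (simp add: algebra_simps)
qed

lemma pzero_Omega [simp]: "pzero \<in> Qp"
  by (auto simp: Omega_def pzero_def)

lemma rep_pzero [simp]: "rep pzero n = 0"
  by (simp add: rep_def ptrunc_def pzero_def)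

lemma pball_pzero_iff: "x \<in> pball m pzero \<longleftrightarrow> x \<in> Qp \<and> evZ m (rep x)"
  using agree_iff[of x pzero m] by (auto simp: pball_def)

lemma padd_pball_pzero:
  assumes "x \<in> pball m pzero" "y \<in> pball m pzero" shows "padd p x y \<in> pball m pzero"
proof -
  have xy: "x \<in> Qp" "y \<in> Qp" "evZ m (rep x)" "evZ m (rep y)" using assms by (auto simp: pball_pzero_iff)
  have "evZ m (rep (padd p x y))" using evZ_add[OF rep_padd[OF xy(1,2), of m] evZ_add[OF xy(3,4)]] by simp
  thus ?thesis using xy by (simp add: pball_pzero_iff padd_Omega)
qed

lemma pneg_pball_pzero:
  assumes "x \<in> pball m pzero" shows "pneg p x \<in> pball m pzero"
proof -
  have x: "x \<in> Qp" "evZ m (rep x)" using assms by (auto simp: pball_pzero_iff)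
  have "evZ m (rep (pneg p x))" using evZ_add[OF rep_pneg[OF x(1), of m] evZ_minus[OF x(2)]] by simp
  thus ?thesis using x by (simp add: pball_pzero_iff pneg_Omega)
qed

lemma pball_iff: "z \<in> Qp \<Longrightarrow> x \<in> pball m z \<longleftrightarrow> x \<in> Qp \<and> evZ m (\<lambda>n. rep x n - rep z n)"
  using agree_iff[of x z m] by (auto simp: pball_def)

text \<open>Orthogonality of characters on the cyclic group p^(-J) Delta / p^n Delta of order p^(n +
  J), whose characters are given by the frequencies t p^(-n) with t < N. The sum is a geometric
  series in w, the value of the generating character at x - z, and w = 1 exactly when x and z lie in
  the same ball.\<close>

lemma indicator_pball_fourier:
  assumes x: "x \<in> pball (-J) pzero" and z: "z \<in> pball (-J) pzero" and n: "-J \<le> n"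
  defines "N \<equiv> p ^ nat (n + J)" and "S \<equiv> \<lambda>_::nat. pp (-n)"
  shows "indicator (pball n z) x = (\<Sum>t<N. chi (\<lambda>_. of_nat t * pp (-n)) x * cnj (chi (\<lambda>_. of_nat t * pp (-n)) z)) / of_nat N"
proof -
  have O: "x \<in> Qp" "z \<in> Qp" using x z by (auto simp: pball_pzero_iff)
  have S: "adic S" unfolding S_def by (rule adic_powi)
  have d: "adic (\<lambda>k. rep x k - rep z k)" by (intro adic_diff adic_rep O)
  define w where "w = chi S x * cnj (chi S z)"
  have w: "w = ecis (\<lambda>k. pp (-n) * (rep x k - rep z k))"
  proof -
    have "w = ecis (\<lambda>k. S k * rep x k) * ecis (\<lambda>k. - (S k * rep z k))"
      unfolding w_def chi_def by (simp add: ecis_minus[OF adic_pair[OF S O(2)]])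
    also have "\<dots> = ecis (\<lambda>k. S k * rep x k + - (S k * rep z k))"
      by (rule ecis_add[symmetric]) (intro adic_minus adic_pair S O)+
    finally show ?thesis by (simp add: S_def algebra_simps)
  qed
  have ad: "adic (\<lambda>k. pp (-n) * (rep x k - rep z k))"
    by (intro adic_mult adic_powi d)
  have w1: "w = 1 \<longleftrightarrow> x \<in> pball n z"
  proof -
    have "w = 1 \<longleftrightarrow> evZ 0 (\<lambda>k. pp (-n) * (rep x k - rep z k))"
      unfolding w using ecis_0[OF ad] ecis_eq_1[OF ad] by blast
    also have "\<dots> \<longleftrightarrow> evZ n (\<lambda>k. rep x k - rep z k)"
    proof -
      have "pp (-n) * A \<in> pZ 0 \<longleftrightarrow> A \<in> pZ n" for A
        using pZ_mult_powi[of A "-n" 0] by (subst mult.commute) simp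
      thus ?thesis by (simp add: evZ_def)
    qed
    finally show ?thesis using pball_iff[OF O(2), of x n] O by simp
  qed
  have Nint: "real N = pp (n + J)" using n by (simp add: N_def power_int_def)
  have wN: "w ^ N = 1"
  proof -
    have "chi S y ^ N = 1" if "y \<in> pball (-J) pzero" for y
    proof -
      have y: "y \<in> Qp" "evZ (-J) (rep y)" using that by (auto simp: pball_pzero_iff)
      have "chi S y ^ N = chi (\<lambda>_. real N * pp (-n)) y"
        unfolding S_def by (rule chi_of_nat[symmetric, OF powi_in_pZ[OF order.refl] y(1)])
      also have "real N * pp (-n) = pp J" by (simp add: Nint flip: powi_add)
      also have "chi (\<lambda>_. pp J) y = 1"
        unfolding chi_def using evZ_mult[OF evZ_const[OF powi_in_pZ[OF order.refl]] y(2), of J]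
        by (intro ecis_0 adic_mult adic_powi adic_rep y) simp
      finally show ?thesis .
    qed
    thus ?thesis using x z by (simp add: w_def power_mult_distrib flip: complex_cnj_power)
  qed
  have "(\<Sum>t<N. chi (\<lambda>_. of_nat t * pp (-n)) x * cnj (chi (\<lambda>_. of_nat t * pp (-n)) z)) = (\<Sum>t<N. w ^ t)"
    unfolding w_def S_def
    by (simp add: chi_of_nat[OF powi_in_pZ[OF order.refl]] O power_mult_distrib)
  also have "\<dots> = (if w = 1 then of_nat N else 0)"
    using wN geometric_sum[of w N] by simp
  finally show ?thesis using w1 by (auto simp: N_def indicator_def)
qed

text \<open>Concentration on p^(-J) Delta turns the inversion into a finite sum. The weights h and
  h' make it possible to invert in one coordinate of a pair while the other is held inside the
  weight.\<close>

lemma fourier_weighted: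
  fixes h :: "'a \<Rightarrow> complex" and h' :: "'b \<Rightarrow> complex"
  assumes M: "prob_space M" and N: "prob_space N"
    and X: "X \<in> measurable M BQ" and Y: "Y \<in> measurable N BQ"
    and h: "h \<in> borel_measurable M" "\<And>w. w \<in> space M \<Longrightarrow> norm (h w) \<le> 1"
    and h': "h' \<in> borel_measurable N" "\<And>w. w \<in> space N \<Longrightarrow> norm (h' w) \<le> 1"
    and cX: "AE w in M. X w \<in> pball (-J) pzero" and cY: "AE w in N. Y w \<in> pball (-J) pzero"
    and eq: "\<And>A b. A \<in> pZ b \<Longrightarrow> (\<integral>w. h w * chi (\<lambda>_. A) (X w) \<partial>M) = (\<integral>w. h' w * chi (\<lambda>_. A) (Y w) \<partial>N)"
    and n: "-J \<le> n" and z: "z \<in> Qp"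
  shows "(\<integral>w. h w * indicator (pball n z) (X w) \<partial>M) = (\<integral>w. h' w * indicator (pball n z) (Y w) \<partial>N)"
proof (cases "z \<in> pball (-J) pzero")
  case False
  have no: "x \<notin> pball n z" if "x \<in> pball (-J) pzero" for x
  proof
    assume "x \<in> pball n z"
    hence "z \<in> pball (-J) x" using pball_mono[OF n, of z] z by (auto simp: pball_def)
    thus False using False pball_eq[OF that] by simp
  qed
  have 1: "(\<integral>w. h w * indicator (pball n z) (X w) \<partial>M) = 0"
    by (rule integral_eq_zero_AE, use cX in eventually_elim) (simp add: no)
  have 2: "(\<integral>w. h' w * indicator (pball n z) (Y w) \<partial>N) = 0"
    by (rule integral_eq_zero_AE, use cY in eventually_elim) (simp add: no)
  show ?thesis using 1 2 by simp
next
  case True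
  define K where "K = p ^ nat (n + J)"
  define S where "S t = real t * pp (-n)" for t :: nat
  have S: "S t \<in> pZ (-n)" for t
    unfolding S_def using pZ_of_int_mult[OF powi_in_pZ[OF order.refl], of "int t"] by simp
  have expand: "(\<integral>w. h w * indicator (pball n z) (X w) \<partial>M) =
     (\<Sum>t<K. (\<integral>w. h w * chi (\<lambda>_. S t) (X w) \<partial>M) * (cnj (chi (\<lambda>_. S t) z) / of_nat K))"
    if M: "prob_space M" and X: "X \<in> measurable M BQ" and h[measurable]: "h \<in> borel_measurable M"
      and hb: "\<And>w. w \<in> space M \<Longrightarrow> norm (h w) \<le> 1" and cX: "AE w in M. X w \<in> pball (-J) pzero"
    for M :: "'c measure" and X h
  proof -
    interpret prob_space M by fact
    have sa: "adic (\<lambda>_. S t)" for t by (rule adic_const[OF S])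
    have mc[measurable]: "(\<lambda>w. chi (\<lambda>_. S t) (X w)) \<in> borel_measurable M" for t
      by (rule measurable_chi'[OF sa X])
    have i: "integrable M (\<lambda>w. h w * chi (\<lambda>_. S t) (X w))" for t
    proof (rule integrable_const_bound[where B = 1])
      show "AE w in M. norm (h w * chi (\<lambda>_. S t) (X w)) \<le> 1"
      proof (rule AE_I2)
        fix w assume "w \<in> space M"
        thus "norm (h w * chi (\<lambda>_. S t) (X w)) \<le> 1"
          using chi_norm[OF sa, of "X w" t] measurable_space[OF X] hb by (simp add: norm_mult)
      qed
    qed measurable
    have "(\<integral>w. h w * indicator (pball n z) (X w) \<partial>M) =
      (\<integral>w. (\<Sum>t<K. (h w * chi (\<lambda>_. S t) (X w)) * (cnj (chi (\<lambda>_. S t) z) / of_nat K)) \<partial>M)"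
    proof (rule integral_cong_AE)
      have [measurable]: "(\<lambda>w. indicator (pball n z) (X w) :: complex) \<in> borel_measurable M"
        by (rule measurable_compose[OF X]) (rule borel_measurable_indicator[OF pball_sets])
      show "(\<lambda>w. h w * indicator (pball n z) (X w)) \<in> borel_measurable M" by measurable
      show "AE w in M. h w * indicator (pball n z) (X w) = (\<Sum>t<K. (h w * chi (\<lambda>_. S t) (X w)) * (cnj (chi (\<lambda>_. S t) z) / of_nat K))"
        using cX
      proof eventually_elim
        case (elim w)
        show ?case unfolding indicator_pball_fourier[OF elim True n] S_def K_def
          by (simp add: sum_divide_distrib sum_distrib_left mult_ac)
      qed
    qed measurable
    also have "\<dots> = (\<Sum>t<K. (\<integral>w. h w * chi (\<lambda>_. S t) (X w) \<partial>M) * (cnj (chi (\<lambda>_. S t) z) / of_nat K))"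
      by (subst Bochner_Integration.integral_sum) (auto intro!: integrable_mult_left i)
    finally show ?thesis .
  qed
  have "(\<integral>w. h w * indicator (pball n z) (X w) \<partial>M) = (\<Sum>t<K. (\<integral>w. h w * chi (\<lambda>_. S t) (X w) \<partial>M) * (cnj (chi (\<lambda>_. S t) z) / of_nat K))"
    by (rule expand[OF M X h cX])
  also have "\<dots> = (\<Sum>t<K. (\<integral>w. h' w * chi (\<lambda>_. S t) (Y w) \<partial>N) * (cnj (chi (\<lambda>_. S t) z) / of_nat K))"
    by (simp add: eq[OF S])
  also have "\<dots> = (\<integral>w. h' w * indicator (pball n z) (Y w) \<partial>N)"
    by (rule expand[OF N Y h' cY, symmetric])
  finally show ?thesis .
qed

lemma AE_imp_ex:
  assumes "prob_space M" "AE x in M. P x" shows "\<exists>x. P x"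
proof (rule ccontr)
  interpret prob_space M by fact
  assume no: "\<not> (\<exists>x. P x)"
  from assms(2) have "AE x in M. False" by (rule eventually_mono) (use no in blast)
  thus False by simp
qed

lemma integral_indicator_complex:
  assumes "S \<in> sets M"
  shows "(\<integral>w. indicator S w \<partial>M) = complex_of_real (measure M S)"
proof -
  have "(\<integral>w. indicator S w \<partial>M) = (\<integral>w. complex_of_real (indicator S w) \<partial>M)"
    by (rule Bochner_Integration.integral_cong) (auto simp: indicator_def)
  also have "\<dots> = complex_of_real (measure M S)"
    using assms sets.sets_into_space[OF assms] by (simp add: Int_absorb2)
  finally show ?thesis .
qed

text \<open>Constant frequencies from Z[1/p] suffice, because the inversion on p^(-J) Delta uses
  only the frequencies t p^(-n).\<close>

lemma measure_eqI_char:
  assumes \<mu>: "pprob \<mu>" and \<nu>: "pprob \<nu>"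
    and c: "AE x in \<mu>. x \<in> pball (-J) pzero" "AE x in \<nu>. x \<in> pball (-J) pzero"
    and eq: "\<And>A b. A \<in> pZ b \<Longrightarrow> chf \<mu> (\<lambda>_. A) = chf \<nu> (\<lambda>_. A)"
  shows "\<mu> = \<nu>"
proof (rule measure_eqI_balls[OF \<mu> \<nu>, where a = "-J"])
  interpret \<mu>: prob_space \<mu> using \<mu> by (simp add: pprob_def)
  interpret \<nu>: prob_space \<nu> using \<nu> by (simp add: pprob_def)
  have s: "sets \<mu> = sets BQ" "sets \<nu> = sets BQ" using \<mu> \<nu> by (auto simp: pprob_def)
  fix n z assume n: "-J \<le> n" and z: "z \<in> Qp"
  have id: "(\<lambda>x. x) \<in> measurable \<mu> BQ" "(\<lambda>x. x) \<in> measurable \<nu> BQ"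
    by (simp_all add: measurable_ident_sets s)
  have b: "pball n z \<in> sets \<mu>" "pball n z \<in> sets \<nu>" by (simp_all add: s pball_sets)
  have "(\<integral>x. 1 * indicator (pball n z) x \<partial>\<mu>) = (\<integral>x. 1 * indicator (pball n z) x \<partial>\<nu> :: complex)"
    by (rule fourier_weighted[OF \<mu>.prob_space_axioms \<nu>.prob_space_axioms id _ _ _ _ c _ n z])
       (use eq in \<open>auto simp: chf_def\<close>)
  hence "complex_of_real (measure \<mu> (pball n z)) = complex_of_real (measure \<nu> (pball n z))"
    using b by (simp add: integral_indicator_complex)
  thus "emeasure \<mu> (pball n z) = emeasure \<nu> (pball n z)"
    by (simp add: \<mu>.emeasure_eq_measure \<nu>.emeasure_eq_measure)
qed

text \<open>Two inversions: with a character of L as weight, X and Y are compared on balls; with the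
  indicator of such a ball as weight, L is then treated in the same way. Products of balls determine
  the joint distribution.\<close>

lemma distr_pair_eqI:
  assumes M: "prob_space M" and L[measurable]: "L \<in> measurable M BQ"
    and X[measurable]: "X \<in> measurable M BQ" and Y[measurable]: "Y \<in> measurable M BQ"
    and c: "AE w in M. L w \<in> pball (-J) pzero" "AE w in M. X w \<in> pball (-J) pzero" "AE w in M. Y w \<in> pball (-J) pzero"
    and eq: "\<And>A B a b. A \<in> pZ a \<Longrightarrow> B \<in> pZ b \<Longrightarrow>
      (\<integral>w. chi (\<lambda>_. A) (L w) * chi (\<lambda>_. B) (X w) \<partial>M) = (\<integral>w. chi (\<lambda>_. A) (L w) * chi (\<lambda>_. B) (Y w) \<partial>M)"
  shows "distr M (BQ \<Otimes>\<^sub>M BQ) (\<lambda>w. (L w, X w)) = distr M (BQ \<Otimes>\<^sub>M BQ) (\<lambda>w. (L w, Y w))"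
    (is "?J1 = ?J2")
proof -
  interpret prob_space M by fact
  have ind[measurable]: "(\<lambda>w. indicator (pball n z) (W w) :: complex) \<in> borel_measurable M"
    if "W \<in> measurable M BQ" for W n z
    by (rule measurable_compose[OF that]) (rule borel_measurable_indicator[OF pball_sets])
  have 1: "(\<integral>w. chi (\<lambda>_. A) (L w) * indicator (pball n z) (X w) \<partial>M) = (\<integral>w. chi (\<lambda>_. A) (L w) * indicator (pball n z) (Y w) \<partial>M)"
    if A: "A \<in> pZ a" and n: "-J \<le> n" and z: "z \<in> Qp" for A a n z
  proof (rule fourier_weighted[OF M M X Y _ _ _ _ c(2,3) _ n z])
    show "(\<lambda>w. chi (\<lambda>_. A) (L w)) \<in> borel_measurable M" "(\<lambda>w. chi (\<lambda>_. A) (L w)) \<in> borel_measurable M"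
      by (rule measurable_chi'[OF adic_const[OF A] L])+
    show "norm (chi (\<lambda>_. A) (L w)) \<le> 1" "norm (chi (\<lambda>_. A) (L w)) \<le> 1" if "w \<in> space M" for w
      using chi_norm[OF adic_const[OF A]] measurable_space[OF L that] by simp_all
  qed (rule eq[OF A])
  have 2: "(\<integral>w. indicator (pball n z) (X w) * indicator (pball m y) (L w) \<partial>M) =
      (\<integral>w. indicator (pball n z) (Y w) * indicator (pball m y) (L w) \<partial>M :: complex)"
    if n: "-J \<le> n" and z: "z \<in> Qp" and m: "-J \<le> m" and y: "y \<in> Qp" for n z m y
  proof (rule fourier_weighted[OF M M L L ind[OF X] _ ind[OF Y] _ c(1,1) _ m y])
    fix A b assume "A \<in> pZ b"
    from 1[OF this n z]
    show "(\<integral>w. indicator (pball n z) (X w) * chi (\<lambda>_. A) (L w) \<partial>M) = (\<integral>w. indicator (pball n z) (Y w) * chi (\<lambda>_. A) (L w) \<partial>M)"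
      by (simp add: mult.commute)
  qed (auto simp: indicator_def)
  have em: "emeasure (distr M (BQ \<Otimes>\<^sub>M BQ) (\<lambda>w. (L w, W w))) (pball m y \<times> pball n z)
     = ennreal (Re (\<integral>w. indicator (pball n z) (W w) * indicator (pball m y) (L w) \<partial>M))"
    if W[measurable]: "W \<in> measurable M BQ" for W m y n z
  proof -
    let ?S = "{w \<in> space M. L w \<in> pball m y \<and> W w \<in> pball n z}"
    have [measurable]: "?S \<in> sets M" by measurable
    have "(\<integral>w. indicator (pball n z) (W w) * indicator (pball m y) (L w) \<partial>M) = (\<integral>w. indicator ?S w \<partial>M :: complex)"
      by (rule Bochner_Integration.integral_cong) (auto simp: indicator_def)
    also have "\<dots> = of_real (measure M ?S)" by (rule integral_indicator_complex) measurable
    finally have e: "(\<integral>w. indicator (pball n z) (W w) * indicator (pball m y) (L w) \<partial>M) = complex_of_real (measure M ?S)" .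
    have "(\<lambda>w. (L w, W w)) -` (pball m y \<times> pball n z) \<inter> space M = ?S" by auto
    thus ?thesis unfolding e by (subst emeasure_distr) (auto simp: emeasure_eq_measure)
  qed
  define BB where "BB = {a \<times> b |a b. a \<in> balls (-J) \<and> b \<in> balls (-J)}"
  have sub: "balls (-J) \<subseteq> Pow (space BQ)" using pball_subset by (auto simp: balls_def)
  have sp: "sets BQ = sigma_sets (space BQ) (balls (-J))" using sets_pborel_balls by simp
  note cover = Union_pball_fin_digits[of "-J"]
  have bsub: "pball (-J) ` fin_digits \<subseteq> balls (-J)" using fin_digits_Omega by (auto simp: balls_def)
  have cnt: "countable (pball (-J) ` fin_digits)" using countable_fin_digits by simp
  have "sets (BQ \<Otimes>\<^sub>M BQ) = sets (sigma (space BQ \<times> space BQ) BB)"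
    unfolding BB_def
    by (rule sets_pair_eq[OF sub sp cnt bsub _ sub sp cnt bsub]) (simp_all add: cover)
  also have "\<dots> = sigma_sets (Qp \<times> Qp) BB"
    unfolding BB_def using sub by (subst sets_measure_of) auto
  finally have sets2: "sets (BQ \<Otimes>\<^sub>M BQ) = sigma_sets (Qp \<times> Qp) BB" .
  show ?thesis
  proof (rule measure_eqI_generator_eq_countable[where E = BB and \<Omega> = "Qp \<times> Qp" and A = "(\<lambda>(a, b). pball (-J) a \<times> pball (-J) b) ` (fin_digits \<times> fin_digits)"])
    show "Int_stable BB"
    proof (rule Int_stableI)
      fix U V assume "U \<in> BB" "V \<in> BB"
      then obtain a b a' b' where ab: "U = a \<times> b" "V = a' \<times> b'" "a \<in> balls (-J)" "b \<in> balls (-J)" "a' \<in> balls (-J)" "b' \<in> balls (-J)"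
        by (auto simp: BB_def)
      hence "a \<inter> a' \<in> balls (-J)" "b \<inter> b' \<in> balls (-J)"
        using Int_stable_balls[of "-J"] by (auto simp: Int_stable_def)
      thus "U \<inter> V \<in> BB" unfolding ab BB_def by (auto simp: Times_Int_Times)
    qed
    show "BB \<subseteq> Pow (Qp \<times> Qp)" using sub by (force simp: BB_def)
    show "sets ?J1 = sigma_sets (Qp \<times> Qp) BB" "sets ?J2 = sigma_sets (Qp \<times> Qp) BB"
      using sets2 by auto
    show "(\<lambda>(a, b). pball (-J) a \<times> pball (-J) b) ` (fin_digits \<times> fin_digits) \<subseteq> BB"
      using bsub by (auto simp: BB_def)
    show "\<Union> ((\<lambda>(a, b). pball (-J) a \<times> pball (-J) b) ` (fin_digits \<times> fin_digits)) = Qp \<times> Qp"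
      unfolding cover[symmetric] by auto
    show "countable ((\<lambda>(a, b). pball (-J) a \<times> pball (-J) b) ` (fin_digits \<times> fin_digits))"
      using countable_fin_digits by auto
    interpret J: prob_space ?J1 by (rule prob_space_distr) measurable
    show "emeasure ?J1 U \<noteq> \<infinity>" for U by simp
    fix U assume "U \<in> BB"
    then obtain a b where ab: "U = a \<times> b" "a \<in> balls (-J)" "b \<in> balls (-J)" by (auto simp: BB_def)
    show "emeasure ?J1 U = emeasure ?J2 U"
    proof (cases "a = {} \<or> b = {}")
      case True thus ?thesis using ab by auto
    next
      case False
      then obtain m y n z where "a = pball m y" "-J \<le> m" "y \<in> Qp" "b = pball n z" "-J \<le> n" "z \<in> Qp"
        using ab by (auto simp: balls_def)
      thus ?thesis using 2 unfolding ab by (simp add: em[OF X] em[OF Y])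
    qed
  qed
qed

lemma AE_pball_mono:
  "AE w in M. X w \<in> pball m z \<Longrightarrow> k \<le> m \<Longrightarrow> AE w in M. X w \<in> pball k z"
  by (erule eventually_mono) (use pball_mono in blast)

text \<open>The converse of the passage to the functional equation, for compactly supported
  distributions: the coordinates of the product space are independent, and inversion turns the
  equation back into an identity of joint distributions.\<close>

lemma cond_symmetricI:
  assumes "pprob \<mu>" "pprob \<nu>" and a: "\<alpha> \<in> Qp"
    and c: "AE x in \<mu>. x \<in> pball J pzero" "AE x in \<nu>. x \<in> pball J pzero"
    and eq: "\<And>u v. adic u \<Longrightarrow> adic v \<Longrightarrow>
      chf \<mu> (\<lambda>n. u n + v n) * chf \<nu> (\<lambda>n. u n + v n * rep \<alpha> n) = chf \<mu> (\<lambda>n. u n - v n) * chf \<nu> (\<lambda>n. u n - v n * rep \<alpha> n)"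
  shows "sym_model p \<alpha> (\<mu> \<Otimes>\<^sub>M \<nu>) fst snd"
    and "distr (\<mu> \<Otimes>\<^sub>M \<nu>) BQ fst = \<mu>" "distr (\<mu> \<Otimes>\<^sub>M \<nu>) BQ snd = \<nu>"
proof -
  interpret \<mu>: prob_space \<mu> using assms by (simp add: pprob_def)
  interpret \<nu>: prob_space \<nu> using assms by (simp add: pprob_def)
  interpret pair_prob_space \<mu> \<nu> ..
  have s[measurable_cong]: "sets \<mu> = sets BQ" "sets \<nu> = sets BQ" using assms by (auto simp: pprob_def)
  have sp: "space \<mu> = Qp" "space \<nu> = Qp" using assms pprob_space by auto
  let ?M = "\<mu> \<Otimes>\<^sub>M \<nu>"
  have m[measurable]: "fst \<in> measurable ?M BQ" "snd \<in> measurable ?M BQ" by measurable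
  have "distr ?M BQ fst = distr ?M \<mu> fst" by (rule distr_cong) (auto simp: s)
  also have "\<dots> = \<mu>" by (rule \<nu>.distr_pair_fst)
  finally show d1: "distr ?M BQ fst = \<mu>" .
  show d2: "distr ?M BQ snd = \<nu>"
  proof (rule measure_eqI)
    fix A assume "A \<in> sets (distr ?M BQ snd)"
    hence A: "A \<in> sets BQ" by simp
    have "snd -` A \<inter> space ?M = space \<mu> \<times> A"
      using sets.sets_into_space[OF A] by (auto simp: space_pair_measure sp)
    moreover have "emeasure ?M (space \<mu> \<times> A) = emeasure \<mu> (space \<mu>) * emeasure \<nu> A"
      by (rule \<nu>.emeasure_pair_measure_Times) (use A s in auto)
    ultimately show "emeasure (distr ?M BQ snd) A = emeasure \<nu> A"
      using A by (subst emeasure_distr) (auto simp: \<mu>.emeasure_space_1)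
  qed (simp add: s)
  have ind: "prob_space.indep_var ?M BQ fst BQ snd"
    unfolding indep_var_distribution_eq d1 d2
  proof (intro conjI m)
    have "distr ?M (BQ \<Otimes>\<^sub>M BQ) (\<lambda>x. (fst x, snd x)) = distr ?M ?M (\<lambda>x. x)"
      by (rule distr_cong) (auto intro!: sets_pair_measure_cong simp: s)
    thus "?M = distr ?M (BQ \<Otimes>\<^sub>M BQ) (\<lambda>x. (fst x, snd x))" by simp
  qed
  let ?L1 = "\<lambda>w. padd p (fst w) (snd w)" and ?L2 = "\<lambda>w. padd p (fst w) (pmul p \<alpha> (snd w))"
  have L: "?L1 \<in> measurable ?M BQ" "?L2 \<in> measurable ?M BQ"
    by (intro measurable_padd measurable_pmul m a)+
  obtain b where b: "evZ b (rep \<alpha>)" using adic_rep[OF a] adicD by blast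
  \<comment> \<open>As \<alpha> lies in p^b Delta, this p^(-K) Delta contains both p^J Delta and
    \<alpha> p^J Delta, hence the values of both linear forms.\<close>
  define K where "K = - min (min J (b + J)) 0"
  have K: "-K \<le> J" "-K \<le> b + J" by (auto simp: K_def)
  have "AE x in distr ?M BQ fst. x \<in> pball J pzero" "AE x in distr ?M BQ snd. x \<in> pball J pzero"
    unfolding d1 d2 by (rule c)+
  from AE_distrD[OF m(1) this(1)] AE_distrD[OF m(2) this(2)]
  have cc: "AE w in ?M. fst w \<in> pball J pzero" "AE w in ?M. snd w \<in> pball J pzero" .
  have mul: "pmul p \<alpha> x \<in> pball (-K) pzero" if "x \<in> pball J pzero" for x
  proof -
    have x: "x \<in> Qp" "evZ J (rep x)" using that by (auto simp: pball_pzero_iff)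
    have "evZ (-K) (\<lambda>n. rep \<alpha> n * rep x n)" by (rule evZ_mono[OF evZ_mult[OF b x(2)] K(2)])
    from evZ_add[OF rep_pmul[OF a x(1), of "-K"] this] show ?thesis
      using x a by (simp add: pball_pzero_iff pmul_Omega)
  qed
  have cL: "AE w in ?M. ?L1 w \<in> pball (-K) pzero" "AE w in ?M. ?L2 w \<in> pball (-K) pzero"
    "AE w in ?M. pneg p (?L2 w) \<in> pball (-K) pzero"
  proof -
    have "AE w in ?M. ?L1 w \<in> pball (-K) pzero \<and> ?L2 w \<in> pball (-K) pzero \<and> pneg p (?L2 w) \<in> pball (-K) pzero"
      using cc
    proof eventually_elim
      case (elim w)
      have f: "fst w \<in> pball (-K) pzero" and g: "snd w \<in> pball (-K) pzero"
        using elim pball_mono[OF K(1), of pzero] by auto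
      have "?L2 w \<in> pball (-K) pzero" by (rule padd_pball_pzero[OF f mul[OF elim(2)]])
      thus ?case using padd_pball_pzero[OF f g] pneg_pball_pzero[of "?L2 w"] by blast
    qed
    thus "AE w in ?M. ?L1 w \<in> pball (-K) pzero" "AE w in ?M. ?L2 w \<in> pball (-K) pzero"
      "AE w in ?M. pneg p (?L2 w) \<in> pball (-K) pzero"
      by simp_all
  qed
  have "cond_symmetric p ?M ?L1 ?L2"
    unfolding cond_symmetric_iff[OF prob_space_axioms L]
  proof (rule distr_pair_eqI[OF prob_space_axioms L measurable_pneg[OF L(2)] cL])
    fix A B a' b' assume "A \<in> pZ a'" "B \<in> pZ b'"
    hence uv: "adic (\<lambda>_. A)" "adic (\<lambda>_. B)" by (auto intro: adic_const)
    show "(\<integral>w. chi (\<lambda>_. A) (?L1 w) * chi (\<lambda>_. B) (?L2 w) \<partial>?M) = (\<integral>w. chi (\<lambda>_. A) (?L1 w) * chi (\<lambda>_. B) (pneg p (?L2 w)) \<partial>?M)"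
      unfolding model_char[OF prob_space_axioms m ind a uv] d1 d2 by (rule eq[OF uv])
  qed
  thus "sym_model p \<alpha> ?M fst snd"
    unfolding sym_model_def using m ind prob_space_axioms by simp
qed

subsection \<open>Characteristic functions and concentration\<close>

lemma chf_norm_le: assumes "pprob \<mu>" "adic s" shows "norm (chf \<mu> s) \<le> 1"
proof -
  interpret prob_space \<mu> using assms by (simp add: pprob_def)
  have "norm (chf \<mu> s) \<le> (\<integral>x. norm (chi s x) \<partial>\<mu>)" unfolding chf_def by (rule integral_norm_bound)
  also have "\<dots> = (\<integral>x. 1 \<partial>\<mu>)"
    by (rule Bochner_Integration.integral_cong) (use chi_norm[OF assms(2)] pprob_space[OF assms(1)] in auto)
  finally show ?thesis using prob_space by simp
qed

lemma chf_AE_const: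
  assumes "pprob \<mu>" "adic s" "AE x in \<mu>. chi s x = z" shows "chf \<mu> s = z"
proof -
  interpret prob_space \<mu> using assms by (simp add: pprob_def)
  have m: "chi s \<in> borel_measurable \<mu>"
    unfolding pprob_measurable[OF assms(1)] by (rule measurable_chi[OF assms(2)])
  have "chf \<mu> s = (\<integral>x. z \<partial>\<mu>)"
    unfolding chf_def by (rule integral_cong_AE[OF m _ assms(3)]) simp
  thus ?thesis using prob_space by simp
qed

text \<open>The equality case of the triangle inequality for integrals: after multiplication by the
  conjugate of the mean, 1 minus the real part is nonnegative with integral 0, and a number of
  modulus 1 with real part 1 equals 1.\<close>

lemma chf_AE_norm_1:
  assumes \<mu>: "pprob \<mu>" and s: "adic s" and n1: "norm (chf \<mu> s) = 1"
  shows "AE x in \<mu>. chi s x = chf \<mu> s"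
proof -
  interpret prob_space \<mu> using \<mu> by (simp add: pprob_def)
  let ?c = "chf \<mu> s"
  have m: "chi s \<in> borel_measurable \<mu>" unfolding pprob_measurable[OF \<mu>] by (rule measurable_chi[OF s])
  have nb: "norm (chi s x) = 1" if "x \<in> space \<mu>" for x using that chi_norm[OF s] pprob_space[OF \<mu>] by simp
  have i: "integrable \<mu> (chi s)" by (rule integrable_const_bound[where B = 1]) (use nb m in auto)
  have cc: "?c * cnj ?c = 1" using n1 by (metis complex_norm_square mult.commute of_real_1 one_power2)
  have "(\<integral>x. 1 - Re (cnj ?c * chi s x) \<partial>\<mu>) = 1 - Re (\<integral>x. cnj ?c * chi s x \<partial>\<mu>)"
    using i by (subst Bochner_Integration.integral_diff) (auto simp: prob_space)
  also have "(\<integral>x. cnj ?c * chi s x \<partial>\<mu>) = cnj ?c * ?c" using i by (simp add: chf_def)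
  also have "1 - Re (cnj ?c * ?c) = 0" using cc by (simp add: mult.commute)
  finally have I: "(\<integral>x. 1 - Re (cnj ?c * chi s x) \<partial>\<mu>) = 0" .
  have "AE x in \<mu>. 1 - Re (cnj ?c * chi s x) = 0"
  proof (subst integral_nonneg_eq_0_iff_AE[symmetric])
    show "AE x in \<mu>. 0 \<le> 1 - Re (cnj ?c * chi s x)"
    proof (rule AE_I2)
      fix x assume "x \<in> space \<mu>"
      hence "norm (cnj ?c * chi s x) = 1" using nb n1 by (simp add: norm_mult)
      thus "0 \<le> 1 - Re (cnj ?c * chi s x)" using complex_Re_le_cmod[of "cnj ?c * chi s x"] by simp
    qed
  qed (use i I in auto)
  with AE_space show ?thesis
  proof eventually_elim
    case (elim x)
    let ?w = "cnj ?c * chi s x"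
    have "norm ?w = 1" using nb elim n1 by (simp add: norm_mult)
    moreover have "Re ?w = 1" using elim by simp
    ultimately have "?w = 1" by (simp add: complex_eq_iff cmod_def)
    hence "?c * ?w = ?c" by simp
    thus ?case using cc by (simp add: mult.assoc[symmetric])
  qed
qed

text \<open>The sign is chosen to count on the dual side: p^(-b) Delta is the annihilator of p^b
  Delta, so this says that the characteristic function has modulus 1 on all of p^b Delta. It becomes
  weaker as b grows.\<close>

definition conc :: "padic measure \<Rightarrow> int \<Rightarrow> bool" where
  "conc \<mu> b \<longleftrightarrow> (\<exists>x\<in>Qp. AE y in \<mu>. y \<in> pball (-b) x)"

lemma conc_mono: "conc \<mu> b \<Longrightarrow> b \<le> c \<Longrightarrow> conc \<mu> c"
proof -
  assume "conc \<mu> b" "b \<le> c"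
  then obtain x where x: "x \<in> Qp" "AE y in \<mu>. y \<in> pball (-b) x" by (auto simp: conc_def)
  have "AE y in \<mu>. y \<in> pball (-c) x" by (rule AE_pball_mono[where X = "\<lambda>x. x", OF x(2)]) (use \<open>b \<le> c\<close> in simp)
  thus ?thesis using x by (auto simp: conc_def)
qed

lemma chf_ball:
  assumes \<mu>: "pprob \<mu>" and s: "adic s" "evZ b s" and x: "x \<in> Qp" "AE y in \<mu>. y \<in> pball (-b) x"
  shows "chf \<mu> s = chi s x"
proof (rule chf_AE_const[OF \<mu> s(1)])
  show "AE y in \<mu>. chi s y = chi s x" using x(2)
    by eventually_elim (rule chi_agree[OF s], use x in \<open>auto simp: pball_def\<close>)
qed

lemma conc_chf: "pprob \<mu> \<Longrightarrow> adic s \<Longrightarrow> evZ b s \<Longrightarrow> conc \<mu> b \<Longrightarrow> norm (chf \<mu> s) = 1"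
  unfolding conc_def using chf_ball chi_norm by metis

text \<open>A single frequency of exact valuation b suffices: its character is almost surely
  constant, and s (y - x) in Delta means that y - x is in p^(-b) Delta.\<close>

lemma chf_conc:
  assumes \<mu>: "pprob \<mu>" and s: "adic s" "lev b s" and n1: "norm (chf \<mu> s) = 1"
  shows "conc \<mu> b"
proof -
  interpret prob_space \<mu> using \<mu> by (simp add: pprob_def)
  have ae: "AE x in \<mu>. x \<in> Qp \<and> chi s x = chf \<mu> s"
    using AE_space chf_AE_norm_1[OF \<mu> s(1) n1] by eventually_elim (simp add: pprob_space[OF \<mu>])
  from AE_imp_ex[OF prob_space_axioms this]
  obtain x where x: "x \<in> Qp" "chi s x = chf \<mu> s" by blast
  have "AE y in \<mu>. y \<in> pball (-b) x" using ae
  proof eventually_elim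
    case (elim y)
    have y: "y \<in> Qp" and eq: "chi s y = chi s x" using elim x by auto
    have d: "adic (\<lambda>n. rep y n - rep x n)" by (intro adic_diff adic_rep x y)
    have "ecis (\<lambda>n. s n * (rep y n - rep x n)) = ecis (\<lambda>n. s n * rep y n + - (s n * rep x n))"
      by (simp add: algebra_simps)
    also have "\<dots> = chi s y * cnj (chi s x)"
      unfolding chi_def ecis_minus[OF adic_pair[OF s(1) x(1)], symmetric]
      by (rule ecis_add[OF adic_pair[OF s(1) y] adic_minus[OF adic_pair[OF s(1) x(1)]]])
    also have "\<dots> = 1" unfolding eq using complex_norm_square[of "chi s x"] chi_norm[OF s(1) x(1)] by simp
    finally have "evZ 0 (\<lambda>n. s n * (rep y n - rep x n))"
      using ecis_eq_1 adic_mult[OF s(1) d] by blast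
    moreover obtain k where "evZ k (\<lambda>n. rep y n - rep x n)" using adicD d by blast
    ultimately have "evZ (-b) (\<lambda>n. rep y n - rep x n)" using lev_cancel[OF s(2)] by fastforce
    thus ?case using pball_iff[OF x(1)] y by simp
  qed
  thus ?thesis using x by (auto simp: conc_def)
qed

text \<open>For fixed x the values \<open>chi (s k) x\<close> are eventually constant, so dominated
  convergence applies with bound 1.\<close>

lemma chf_tendsto:
  assumes \<mu>: "pprob \<mu>" and s: "\<And>k. adic (s k)" and t: "adic t"
    and lim: "\<And>N. \<forall>\<^sub>F k in sequentially. evZ N (\<lambda>n. s k n - t n)"
  shows "(\<lambda>k. chf \<mu> (s k)) \<longlonglongrightarrow> chf \<mu> t"
proof -
  interpret prob_space \<mu> using \<mu> by (simp add: pprob_def)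
  have m: "chi u \<in> borel_measurable \<mu>" if "adic u" for u
    unfolding pprob_measurable[OF \<mu>] by (rule measurable_chi[OF that])
  show ?thesis unfolding chf_def
  proof (rule integral_dominated_convergence[where w = "\<lambda>_. 1"])
    show "AE x in \<mu>. (\<lambda>k. chi (s k) x) \<longlonglongrightarrow> chi t x"
    proof (rule AE_I2)
      fix x assume "x \<in> space \<mu>"
      hence x: "x \<in> Qp" using pprob_space[OF \<mu>] by simp
      obtain L where L: "\<forall>i<L. x i = 0" using Omega_low[OF x, of 0] by auto
      have "\<forall>\<^sub>F k in sequentially. chi (s k) x = chi t x"
        using lim[of "-L"] by eventually_elim (rule chi_cong[OF s t L x])
      thus "(\<lambda>k. chi (s k) x) \<longlonglongrightarrow> chi t x" by (rule tendsto_eventually)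
    qed
    show "AE x in \<mu>. norm (chi (s k) x) \<le> 1" for k
      by (rule AE_I2) (use chi_norm[OF s] pprob_space[OF \<mu>] in auto)
  qed (use m s t in auto)
qed

section \<open>Compact subgroups, degenerate and idempotent distributions\<close>

lemma compactin_pball: "compactin (ptop p) (pball a pzero)"
proof -
  let ?T = "product_topology (\<lambda>i::int. discrete_topology (UNIV::nat set)) UNIV"
  let ?S = "\<lambda>i::int. if i < a then {0} else {..<p}"
  let ?K = "PiE UNIV ?S"
  have K: "?K = pball a pzero"
  proof (intro equalityI subsetI)
    fix x assume "x \<in> ?K"
    hence S: "x i \<in> ?S i" for i by (rule PiE_mem) simp
    hence "x i < p" for i using S[of i] by (cases "i < a") auto
    moreover have "x i = 0" if "i < a" for i using S[of i] that by auto
    ultimately show "x \<in> pball a pzero" unfolding pball_def by (auto intro!: OmegaI[of x a] simp: pzero_def)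
  qed (auto simp: pball_def pzero_def Omega_less)
  have "compactin (discrete_topology UNIV) {..<p}" by (rule finite_imp_compactin) auto
  hence comp: "compactin ?T ?K" unfolding compactin_PiE by auto
  \<comment> \<open>The digit box is compact as a product of finite discrete sets, and compactness
    passes to the ball along the identity map.\<close>
  have "continuous_map (subtopology ?T ?K) (ptop p) id"
    unfolding continuous_map_def
  proof (intro conjI allI impI)
    show "id \<in> topspace (subtopology ?T ?K) \<rightarrow> topspace (ptop p)"
      unfolding K by (auto simp: topspace_ptop pball_def)
    fix U assume U: "openin (ptop p) U"
    show "openin (subtopology ?T ?K) {x \<in> topspace (subtopology ?T ?K). id x \<in> U}"
      unfolding openin_subtopology
    proof (intro exI conjI)
      \<comment> \<open>Only the indices between a and m are constrained, which are finitely many as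
        a product-open set requires; the digits below a agree automatically on
        \<open>?K\<close>.\<close>
      let ?C = "\<lambda>x m. PiE UNIV (\<lambda>i. if a \<le> i \<and> i < m then {x i} else (UNIV::nat set))"
      let ?V = "\<Union>{?C x m |x m. x \<in> ?K \<and> pball m x \<subseteq> U}"
      show "openin ?T ?V"
      proof (rule openin_Union, elim CollectE exE conjE)
        fix W x m assume W: "W = ?C x m"
        have "finite {i \<in> UNIV. (if a \<le> i \<and> i < m then {x i} else (UNIV::nat set)) \<noteq> topspace (discrete_topology UNIV)}"
          by (rule finite_subset[of _ "{a..<m}"]) auto
        thus "openin ?T W" unfolding W openin_PiE_gen by auto
      qed
      show "{x \<in> topspace (subtopology ?T ?K). id x \<in> U} = ?V \<inter> ?K"
      proof (intro equalityI subsetI)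
        fix x assume "x \<in> {x \<in> topspace (subtopology ?T ?K). id x \<in> U}"
        hence x: "x \<in> ?K" "x \<in> U" by auto
        then obtain m where "pball m x \<subseteq> U" using U openin_ptop by blast
        moreover have "x \<in> ?C x m" by (auto simp: PiE_def)
        ultimately show "x \<in> ?V \<inter> ?K" using x by blast
      next
        fix y assume "y \<in> ?V \<inter> ?K"
        then obtain x m where y: "y \<in> ?K" "y \<in> ?C x m" "x \<in> ?K" "pball m x \<subseteq> U" by blast
        have yK: "y \<in> pball a pzero" "x \<in> pball a pzero" using y K by simp_all
        have yx: "y i = x i" if "a \<le> i" "i < m" for i
        proof -
          have "y i \<in> (if a \<le> i \<and> i < m then {x i} else UNIV)" using y(2) by (rule PiE_mem) simp
          thus ?thesis using that by simp
        qed
        have "y i = x i" if "i < m" for i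
          using yx[OF _ that] yK by (cases "a \<le> i") (auto simp: pball_def)
        hence "y \<in> pball m x" using yK by (auto simp: pball_def)
        thus "y \<in> {x \<in> topspace (subtopology ?T ?K). id x \<in> U}" using y by auto
      qed
    qed
  qed
  hence "compactin (ptop p) (id ` ?K)"
    by (rule image_compactin[rotated]) (simp add: compactin_subtopology comp)
  thus ?thesis by (simp add: K)
qed

lemma compact_subgroup_pball: "compact_subgroup p (pball a pzero)"
  unfolding compact_subgroup_def
  by (auto simp: compactin_pball pball_self intro: padd_pball_pzero pneg_pball_pzero pball_subset[THEN subsetD])

lemma padic_eqI:
  assumes "x \<in> Qp" "y \<in> Qp" "\<And>N. evZ N (\<lambda>n. rep x n - rep y n)"
  shows "x = y"
proof
  fix i show "x i = y i" using agree_iff[OF assms(1,2), of "i + 1"] assms(3) by simp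
qed

lemma padd_pzero: assumes "x \<in> Qp" shows "padd p pzero x = x"
proof (rule padic_eqI)
  show "evZ N (\<lambda>n. rep (padd p pzero x) n - rep x n)" for N
    using rep_padd[OF pzero_Omega assms, of N] by simp
qed (simp_all add: padd_Omega assms)

lemma pneg_pzero: "pneg p pzero = pzero"
proof (rule padic_eqI)
  show "evZ N (\<lambda>n. rep (pneg p pzero) n - rep pzero n)" for N
    using rep_pneg[OF pzero_Omega, of N] by simp
qed (simp_all add: pneg_Omega)

lemma compact_subgroup_pzero: "compact_subgroup p {pzero}"
  unfolding compact_subgroup_def
  by (auto simp: padd_pzero pneg_pzero topspace_ptop intro!: finite_imp_compactin)

lemma pzero_sets: "{x} \<in> sets BQ" if "x \<in> Qp"
proof -
  have "{x} = {y \<in> space BQ. \<forall>i. y i = x i}" using that by auto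
  also have "\<dots> \<in> sets BQ" by measurable
  finally show ?thesis .
qed

lemma haar_return: "haar_distr p {pzero} (return BQ pzero)"
proof -
  have "distr (return BQ pzero) BQ (\<lambda>y. padd p y pzero) = return BQ (padd p pzero pzero)"
    by (rule distr_return) (auto intro!: measurable_padd)
  thus ?thesis unfolding haar_distr_def
    by (auto simp: padd_pzero prob_space_return pzero_sets)
qed

lemma pshift_return: assumes "x \<in> Qp" shows "pshift p (return BQ pzero) x = return BQ x"
proof -
  have "distr (return BQ pzero) BQ (\<lambda>y. padd p y x) = return BQ (padd p pzero x)"
    by (rule distr_return) (auto intro!: measurable_padd simp: assms)
  thus ?thesis by (simp add: pshift_def padd_pzero assms)
qed

text \<open>The levels b are countably many, so almost every y lies in all the chosen balls at once,
  and shrinking balls have at most one common point.\<close>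

lemma conc_all_degenerate:
  assumes \<mu>: "pprob \<mu>" and c: "\<And>b. conc \<mu> b"
  obtains x where "x \<in> Qp" "\<mu> = return BQ x"
proof -
  interpret prob_space \<mu> using \<mu> by (simp add: pprob_def)
  have "\<forall>b. \<exists>x. x \<in> Qp \<and> (AE y in \<mu>. y \<in> pball (-b) x)" using c by (auto simp: conc_def)
  from choice[OF this] obtain X where X: "\<And>b. X b \<in> Qp" "\<And>b. AE y in \<mu>. y \<in> pball (-b) (X b)" by blast
  have ae: "AE y in \<mu>. \<forall>b. y \<in> pball (-b) (X b)" using X(2) by (simp add: AE_all_countable)
  from AE_imp_ex[OF prob_space_axioms this]
  obtain x where x: "\<And>b. x \<in> pball (-b) (X b)" by blast
  have xO: "x \<in> Qp" using x[of 0] pball_subset by auto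
  have eq: "AE y in \<mu>. y = x" using ae
  proof (rule eventually_mono)
    fix y assume y: "\<forall>b. y \<in> pball (-b) (X b)"
    show "y = x"
    proof
      fix i show "y i = x i" using y[rule_format, of "-i - 1"] x[of "-i - 1"] by (simp add: pball_def)
    qed
  qed
  have "\<mu> = return BQ x"
  proof (rule measure_eqI)
    show s: "sets \<mu> = sets (return BQ x)" using \<mu> by (simp add: pprob_def)
    fix A assume A: "A \<in> sets \<mu>"
    show "emeasure \<mu> A = emeasure (return BQ x) A"
    proof (cases "x \<in> A")
      case True
      have "AE y in \<mu>. y \<in> A" using eq by (rule eventually_mono) (use True in blast)
      thus ?thesis using True A s by (simp add: emeasure_eq_1_AE)
    next
      case False
      have "AE y in \<mu>. y \<notin> A" using eq by (rule eventually_mono) (use False in blast)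
      hence "emeasure \<mu> A = 0" using A AE_iff_measurable[of A \<mu> "\<lambda>y. y \<notin> A"] sets.sets_into_space[OF A] by auto
      thus ?thesis using False A s by simp
    qed
  qed
  thus ?thesis using xO by (rule that[rotated])
qed

lemma padd_pball_iff:
  assumes "y \<in> Qp" "k \<in> Qp" "z \<in> Qp"
  shows "padd p y k \<in> pball n z \<longleftrightarrow> y \<in> pball n (padd p z (pneg p k))"
proof -
  have 1: "evZ n (\<lambda>i. rep (padd p y k) i - (rep y i + rep k i))" by (rule rep_padd) fact+
  have 2: "evZ n (\<lambda>i. rep (padd p z (pneg p k)) i - (rep z i - rep k i))"
    by (rule evZ_eq[OF evZ_add[OF rep_padd[OF assms(3) pneg_Omega[OF assms(2)], of n] rep_pneg[OF assms(2), of n]]]) simp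
  have "evZ n (\<lambda>i. rep (padd p y k) i - rep z i) \<longleftrightarrow> evZ n (\<lambda>i. rep y i - rep (padd p z (pneg p k)) i)"
  proof
    assume "evZ n (\<lambda>i. rep (padd p y k) i - rep z i)"
    from evZ_diff[OF evZ_diff[OF this 1] 2] show "evZ n (\<lambda>i. rep y i - rep (padd p z (pneg p k)) i)"
      by (rule evZ_eq) simp
  next
    assume "evZ n (\<lambda>i. rep y i - rep (padd p z (pneg p k)) i)"
    from evZ_add[OF evZ_add[OF this 1] 2] show "evZ n (\<lambda>i. rep (padd p y k) i - rep z i)"
      by (rule evZ_eq) simp
  qed
  thus ?thesis using assms by (simp add: pball_iff padd_Omega pneg_Omega)
qed

lemma pneg_pball_iff:
  assumes "y \<in> Qp" "z \<in> Qp"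
  shows "pneg p y \<in> pball n z \<longleftrightarrow> y \<in> pball n (pneg p z)"
proof -
  have 1: "evZ n (\<lambda>i. rep (pneg p y) i - (- rep y i))" "evZ n (\<lambda>i. rep (pneg p z) i - (- rep z i))"
    by (rule rep_pneg; fact)+
  have "evZ n (\<lambda>i. rep (pneg p y) i - rep z i) \<longleftrightarrow> evZ n (\<lambda>i. rep y i - rep (pneg p z) i)"
  proof
    assume "evZ n (\<lambda>i. rep (pneg p y) i - rep z i)"
    from evZ_diff[OF evZ_diff[OF 1(1) this] 1(2)] show "evZ n (\<lambda>i. rep y i - rep (pneg p z) i)"
      by (rule evZ_eq) simp
  next
    assume "evZ n (\<lambda>i. rep y i - rep (pneg p z) i)"
    from evZ_diff[OF evZ_diff[OF 1(1) this] 1(2)] show "evZ n (\<lambda>i. rep (pneg p y) i - rep z i)"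
      by (rule evZ_eq) simp
  qed
  thus ?thesis using assms by (simp add: pball_iff pneg_Omega)
qed

lemma pprob_measurable_padd:
  assumes "pprob m" "k \<in> Qp" shows "(\<lambda>y. padd p y k) \<in> measurable m BQ"
  unfolding pprob_measurable[OF assms(1)] using assms(2) by (intro measurable_padd) simp_all

lemma pprob_measurable_pneg:
  assumes "pprob m" shows "pneg p \<in> measurable m BQ"
  unfolding pprob_measurable[OF assms(1)] using measurable_pneg[of "\<lambda>y. y" "BQ"] by simp

lemma distr_padd_pball:
  assumes "pprob m" "k \<in> Qp" "z \<in> Qp"
  shows "emeasure (distr m BQ (\<lambda>y. padd p y k)) (pball n z) = emeasure m (pball n (padd p z (pneg p k)))"
proof -
  have me: "(\<lambda>y. padd p y k) \<in> measurable m BQ"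
    by (rule pprob_measurable_padd) (simp_all add: assms)
  have "(\<lambda>y. padd p y k) -` pball n z \<inter> space m = pball n (padd p z (pneg p k))"
    using padd_pball_iff[OF _ assms(2,3)] pprob_space[OF assms(1)] pball_subset by blast
  thus ?thesis by (simp add: emeasure_distr[OF me pball_sets])
qed

lemma distr_pneg_pball:
  assumes "pprob m" "z \<in> Qp"
  shows "emeasure (distr m BQ (pneg p)) (pball n z) = emeasure m (pball n (pneg p z))"
proof -
  have me: "pneg p \<in> measurable m BQ"
    by (rule pprob_measurable_pneg) (simp add: assms)
  have "pneg p -` pball n z \<inter> space m = pball n (pneg p z)"
    using pneg_pball_iff[OF _ assms(2)] pprob_space[OF assms(1)] pball_subset by blast
  thus ?thesis by (simp add: emeasure_distr[OF me pball_sets])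
qed

lemma pball_null:
  assumes "pprob m" "AE y in m. y \<notin> pball n w" shows "emeasure m (pball n w) = 0"
proof -
  have "pball n w \<in> sets m" using assms(1) by (simp add: pprob_def pball_sets)
  moreover have "{y \<in> space m. \<not> y \<notin> pball n w} = pball n w"
    using pball_subset[of n w] pprob_space[OF assms(1)] by auto
  ultimately show ?thesis
    using AE_iff_measurable[of "pball n w" m "\<lambda>y. y \<notin> pball n w"] assms(2) by simp
qed

text \<open>Every ball of positive measure meets the subgroup, hence is a translate of the ball around 0.\<close>

lemma idempotent_balls:
  assumes "idempotent p \<mu>" "x \<in> Qp" "y \<in> Qp"
    and pos: "emeasure \<mu> (pball n x) \<noteq> 0" "emeasure \<mu> (pball n y) \<noteq> 0"
  shows "emeasure \<mu> (pball n x) = emeasure \<mu> (pball n y)"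
proof -
  obtain K m x0 where K: "compact_subgroup p K" and m: "haar_distr p K m" and x0: "x0 \<in> Qp"
    and \<mu>: "\<mu> = pshift p m x0" using assms(1) by (auto simp: idempotent_def)
  have pm: "pprob m" using m by (simp add: haar_distr_def pprob_def)
  interpret prob_space m using pm by (simp add: pprob_def)
  have K1: "emeasure m K = 1" and inv: "\<And>k. k \<in> K \<Longrightarrow> distr m BQ (\<lambda>y. padd p y k) = m"
    using m by (auto simp: haar_distr_def)
  have KO: "K \<subseteq> Qp" using K by (auto simp: compact_subgroup_def)
  have Ks: "K \<in> sets m" using K1 emeasure_notin_sets by force
  have aeK: "AE y in m. y \<in> K" using K1 Ks by (simp add: emeasure_eq_1_AE AE_in_set_eq_1 emeasure_eq_measure)
  have main: "emeasure m (pball n w) = emeasure m (pball n pzero)"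
    if w: "w \<in> Qp" "emeasure m (pball n w) \<noteq> 0" for w
  proof -
    have "pball n w \<inter> K \<noteq> {}"
    proof
      assume e: "pball n w \<inter> K = {}"
      have "AE y in m. y \<notin> pball n w" using aeK by (rule eventually_mono) (use e in blast)
      from pball_null[OF pm this] have "emeasure m (pball n w) = 0" .
      thus False using w by simp
    qed
    then obtain k where k: "k \<in> pball n w" "k \<in> K" by blast
    have kO: "k \<in> Qp" using k KO by auto
    have "padd p k (pneg p k) = pzero"
    proof (rule padic_eqI)
      show "evZ N (\<lambda>n. rep (padd p k (pneg p k)) n - rep pzero n)" for N
        using evZ_add[OF rep_padd[OF kO pneg_Omega[OF kO], of N] rep_pneg[OF kO, of N]] by simp
    qed (simp_all add: padd_Omega pneg_Omega kO)
    thus ?thesis using distr_padd_pball[OF pm kO kO, of n] inv[OF k(2)] pball_eq[OF k(1)] by simp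
  qed
  have e: "emeasure \<mu> (pball n z) = emeasure m (pball n (padd p z (pneg p x0)))" if "z \<in> Qp" for z
    unfolding \<mu> pshift_def by (rule distr_padd_pball[OF pm x0 that])
  have O: "padd p x (pneg p x0) \<in> Qp" "padd p y (pneg p x0) \<in> Qp"
    by (intro padd_Omega pneg_Omega assms x0)+
  show ?thesis using main[OF O(1)] main[OF O(2)] pos unfolding e[OF assms(2)] e[OF assms(3)] by simp
qed

subsection \<open>Haar measures and their mixtures\<close>

text \<open>The digit at index a of a mixture of the two Haar distributions: forced to be 0 with
  probability r, uniform otherwise. All later digits are uniform in both components, so the mixture
  remains a product measure.\<close>

definition digit_pmf :: "real \<Rightarrow> nat pmf" where
  "digit_pmf r = bind_pmf (bernoulli_pmf r) (\<lambda>b. if b then return_pmf 0 else pmf_of_set {..<p})"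

lemma pmf_digit_pmf:
  assumes "0 \<le> r" "r \<le> 1" "j < p"
  shows "pmf (digit_pmf r) j = (if j = 0 then r else 0) + (1 - r) / real p"
  using assms p_pos lessThan_empty_iff[of p] by (auto simp: digit_pmf_def pmf_bind pmf_of_set indicator_def)

lemma set_digit_pmf: "set_pmf (digit_pmf r) \<subseteq> {..<p}"
  using p_pos by (auto simp: digit_pmf_def set_pmf_of_set lessThan_empty_iff split: if_splits)

definition digit_measure :: "int \<Rightarrow> real \<Rightarrow> int \<Rightarrow> nat measure" where
  "digit_measure a r i = measure_pmf (if i = a then digit_pmf r else pmf_of_set {..<p})"

text \<open>The mixture of the Haar distributions of \<open>p\<^bsup>a+1\<^esup> \<Delta>\<close> (weight \<open>r\<close>) and \<open>p\<^sup>a \<Delta>\<close> (weight \<open>1 - r\<close>),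
  built from independent digits; reduction modulo \<open>p\<close> only serves to stay inside \<open>Qp\<close>.\<close>

definition hmix :: "int \<Rightarrow> real \<Rightarrow> padic measure" where
  "hmix a r = distr (Pi\<^sub>M UNIV (digit_measure a r)) BQ (\<lambda>w i. if i < a then 0 else w i mod p)"

lemma prob_digit_measure: "prob_space (digit_measure a r i)"
  unfolding digit_measure_def by (rule prob_space_measure_pmf)

lemma hmix_map: "(\<lambda>w i. if i < a then 0 else w i mod p) \<in> measurable (Pi\<^sub>M UNIV (digit_measure a r)) BQ"
proof (rule measurable_into)
  show "(\<lambda>i. if i < a then 0 else w i mod p) \<in> Qp" for w :: "int \<Rightarrow> nat"
    by (rule OmegaI[of _ a]) auto
  fix i
  have 1: "(\<lambda>w. w i) \<in> measurable (Pi\<^sub>M UNIV (digit_measure a r)) (digit_measure a r i)"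
    by (rule measurable_component_singleton) simp
  have 2: "(\<lambda>d. if i < a then 0 else d mod p) \<in> measurable (digit_measure a r i) (count_space UNIV)"
    unfolding digit_measure_def by simp
  show "(\<lambda>w. if i < a then 0 else w i mod p) \<in> measurable (Pi\<^sub>M UNIV (digit_measure a r)) (count_space UNIV)"
    using measurable_compose[OF 1 2] .
qed

lemma pprob_hmix: "pprob (hmix a r)"
  unfolding hmix_def by (intro pprob_distr hmix_map prob_space_PiM prob_digit_measure)

lemma hmix_low: "AE x in hmix a r. x \<in> pball a pzero"
proof -
  have "AE w in Pi\<^sub>M UNIV (digit_measure a r). (\<lambda>i. if i < a then 0 else w i mod p) \<in> pball a pzero"
    by (rule AE_I2) (auto simp: pball_def pzero_def intro!: OmegaI[of _ a])
  moreover have S: "{x \<in> space BQ. x \<in> pball a pzero} \<in> sets BQ" by measurable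
  ultimately show ?thesis unfolding hmix_def AE_distr_iff[OF hmix_map S] by simp
qed

text \<open>Independence of the digits: the digit at a contributes its own weight and each of the n
  - a - 1 later ones contributes 1/p.\<close>

lemma hmix_ball:
  assumes z: "z \<in> Qp" and n: "a + 1 \<le> n"
  shows "emeasure (hmix a r) (pball n z) =
    (if \<forall>i<a. z i = 0 then ennreal (pmf (digit_pmf r) (z a) * (1 / real p) ^ nat (n - a - 1)) else 0)"
proof (cases "\<forall>i<a. z i = 0")
  case False
  have "AE x in hmix a r. x \<notin> pball n z" using hmix_low
  proof (rule eventually_mono)
    fix x assume "x \<in> pball a pzero"
    hence x: "x i = 0" if "i < a" for i using that by (simp add: pball_def pzero_def)
    from False obtain i where "i < a" "z i \<noteq> 0" by blast
    thus "x \<notin> pball n z" using x[of i] n by (auto simp: pball_def intro!: exI[of _ i])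
  qed
  from pball_null[OF pprob_hmix this] have "emeasure (hmix a r) (pball n z) = 0" .
  thus ?thesis using False by (simp only: if_False)
next
  case True
  interpret product_prob_space "digit_measure a r" UNIV
    by (intro product_prob_spaceI prob_digit_measure)
  let ?X = "\<lambda>i. {d. d mod p = z i}"
  let ?P = "Pi\<^sub>M UNIV (digit_measure a r)"
  have "(\<lambda>w i. if i < a then 0 else w i mod p) -` pball n z \<inter> space ?P
     = {w \<in> space ?P. \<forall>i\<in>{a..<n}. w i \<in> ?X i}" (is "?L = ?R")
  proof (intro equalityI subsetI)
    fix w assume w: "w \<in> ?L"
    have "w i mod p = z i" if "a \<le> i" "i < n" for i
    proof -
      have "(if i < a then 0 else w i mod p) = z i" using w that by (auto simp: pball_def)
      thus ?thesis using that by simp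
    qed
    thus "w \<in> ?R" using w by auto
  next
    fix w assume w: "w \<in> ?R"
    have "(\<lambda>i. if i < a then 0 else w i mod p) \<in> Qp" by (rule OmegaI[of _ a]) auto
    thus "w \<in> ?L" using w True by (auto simp: pball_def)
  qed
  hence "emeasure (hmix a r) (pball n z) = emeasure ?P ?R"
    unfolding hmix_def by (simp add: emeasure_distr[OF hmix_map pball_sets])
  also have "\<dots> = (\<Prod>i\<in>{a..<n}. emeasure (digit_measure a r i) (?X i))"
    by (rule emeasure_PiM_Collect) (auto simp: digit_measure_def)
  also have "\<dots> = (\<Prod>i\<in>{a..<n}. ennreal (if i = a then pmf (digit_pmf r) (z i) else 1 / real p))"
  proof (rule prod.cong[OF refl])
    fix i
    let ?q = "if i = a then digit_pmf r else pmf_of_set {..<p}"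
    have sq: "set_pmf ?q \<subseteq> {..<p}" using set_digit_pmf p_pos by (auto simp: set_pmf_of_set lessThan_empty_iff)
    \<comment> \<open>The digit is almost surely below p already, so the condition modulo p amounts
      to equality.\<close>
    have "emeasure (measure_pmf ?q) (?X i) = emeasure (measure_pmf ?q) {z i}"
      by (rule emeasure_eq_AE) (use sq Omega_less[OF z, of i] in \<open>auto simp: AE_measure_pmf_iff\<close>)
    also have "\<dots> = ennreal (pmf ?q (z i))" by (rule emeasure_pmf_single)
    also have "pmf ?q (z i) = (if i = a then pmf (digit_pmf r) (z i) else 1 / real p)"
      using Omega_less[OF z, of i] p_pos by (auto simp: pmf_of_set lessThan_empty_iff)
    finally show "emeasure (digit_measure a r i) (?X i) = ennreal (if i = a then pmf (digit_pmf r) (z i) else 1 / real p)"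
      by (simp add: digit_measure_def)
  qed
  also have "\<dots> = ennreal (\<Prod>i\<in>{a..<n}. if i = a then pmf (digit_pmf r) (z i) else 1 / real p)"
    by (rule prod_ennreal) auto
  also have "{a..<n} = insert a {a + 1..<n}" using n by auto
  also have "(\<Prod>i\<in>insert a {a + 1..<n}. if i = a then pmf (digit_pmf r) (z i) else 1 / real p)
     = pmf (digit_pmf r) (z a) * (\<Prod>i\<in>{a + 1..<n}. 1 / real p)"
    by (simp add: prod.insert)
  also have "(\<Prod>i\<in>{a + 1..<n}. 1 / real p) = (1 / real p) ^ nat (n - a - 1)"
    by (simp add: diff_diff_eq)
  finally show ?thesis using True by simp
qed

text \<open>The mass of a small ball depends on its centre only through the digits up to index a,
  and translation by an element of p^(a+1) Delta leaves these unchanged.\<close>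

lemma hmix_shift:
  assumes k: "k \<in> Qp" "evZ (a + 1) (rep k)"
  shows "distr (hmix a r) BQ (\<lambda>y. padd p y k) = hmix a r"
proof (rule measure_eqI_balls[OF pprob_distr[OF pprob_prob[OF pprob_hmix] pprob_measurable_padd[OF pprob_hmix k(1)]] pprob_hmix, where a = "a + 1"])
  fix n z assume n: "a + 1 \<le> n" and z: "z \<in> Qp"
  let ?z = "padd p z (pneg p k)"
  have zO: "?z \<in> Qp" by (intro padd_Omega pneg_Omega z k)
  have "evZ (a + 1) (\<lambda>i. rep ?z i - rep z i)"
    using evZ_add[OF rep_padd[OF z pneg_Omega[OF k(1)], of "a + 1"] evZ_diff[OF rep_pneg[OF k(1), of "a + 1"] k(2)]]
    by simp
  hence e: "\<And>i. i < a + 1 \<Longrightarrow> ?z i = z i" using agree_iff[OF zO z, of "a + 1"] by simp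
  have "(\<forall>i<a. ?z i = 0) \<longleftrightarrow> (\<forall>i<a. z i = 0)" "?z a = z a" using e by auto
  thus "emeasure (distr (hmix a r) BQ (\<lambda>y. padd p y k)) (pball n z) = emeasure (hmix a r) (pball n z)"
    unfolding distr_padd_pball[OF pprob_hmix k(1) z] hmix_ball[OF zO n] hmix_ball[OF z n] by (simp only:)
qed

lemma low_iff_evZ: "x \<in> Qp \<Longrightarrow> (\<forall>i<n. x i = 0) \<longleftrightarrow> evZ n (rep x)"
proof -
  assume "x \<in> Qp"
  moreover have "(\<forall>i<n. x i = 0) \<longleftrightarrow> (\<forall>i<n. x i = pzero i)" by (simp add: pzero_def)
  ultimately show ?thesis using agree_iff[of x pzero n] by simp
qed

text \<open>Negation preserves valuations, and the mass of a small ball depends only on whether the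
  digits below a vanish and whether the digit at a does.\<close>

lemma hmix_neg:
  assumes r: "0 \<le> r" "r \<le> 1"
  shows "distr (hmix a r) BQ (pneg p) = hmix a r"
proof (rule measure_eqI_balls[OF pprob_distr[OF pprob_prob[OF pprob_hmix] pprob_measurable_pneg[OF pprob_hmix]] pprob_hmix, where a = "a + 1"])
  fix n z assume n: "a + 1 \<le> n" and z: "z \<in> Qp"
  have zO: "pneg p z \<in> Qp" by (intro pneg_Omega z)
  have low: "(\<forall>i<m. pneg p z i = 0) \<longleftrightarrow> (\<forall>i<m. z i = 0)" for m
  proof -
    have 1: "evZ m (\<lambda>i. rep (pneg p z) i - (- rep z i))" by (rule rep_pneg[OF z])
    have "evZ m (rep (pneg p z)) \<longleftrightarrow> evZ m (rep z)"
    proof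
      assume "evZ m (rep (pneg p z))"
      from evZ_diff[OF 1 this] show "evZ m (rep z)" by simp
    next
      assume "evZ m (rep z)"
      from evZ_diff[OF 1 this] show "evZ m (rep (pneg p z))" by simp
    qed
    thus ?thesis using low_iff_evZ z zO by simp
  qed
  have iff: "(\<forall>i<a + 1. x i = 0) \<longleftrightarrow> (\<forall>i<a. x i = 0) \<and> x a = 0" for x :: padic
    by (auto simp: zle_add1_eq_le order.order_iff_strict)
  have "pneg p z a = 0 \<longleftrightarrow> z a = 0" if "\<forall>i<a. z i = 0"
    using low[of a] low[of "a + 1"] that unfolding iff by blast
  thus "emeasure (distr (hmix a r) BQ (pneg p)) (pball n z) = emeasure (hmix a r) (pball n z)"
    unfolding distr_pneg_pball[OF pprob_hmix z] hmix_ball[OF zO n] hmix_ball[OF z n]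
    using low[of a] pmf_digit_pmf[OF r Omega_less[OF z]] pmf_digit_pmf[OF r Omega_less[OF zO]] by auto
qed

lemma ppow_Omega: "ppow p j \<in> Qp"
  using p_gt_1 by (intro OmegaI[of _ j]) (auto simp: ppow_def)

lemma rep_ppow: "evZ N (\<lambda>n. rep (ppow p j) n - pp j)"
  unfolding evZ_def eventually_sequentially
proof (intro exI allI impI)
  fix n assume "nat (j + 1) \<le> n"
  hence "{i. i < int n \<and> ppow p j i \<noteq> 0} = {j}" by (auto simp: ppow_def)
  thus "rep (ppow p j) n - pp j \<in> pZ N"
    by (simp add: rep_def ptrunc_def) (simp add: ppow_def)
qed

text \<open>Invariance under translation by p^(a+1) multiplies the integral by the value of the
  character there, and this value is 1 only if s is in p^(-a-1) Delta.\<close>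

lemma chf_hmix_zero:
  assumes s: "adic s" "\<not> evZ (-a - 1) s"
  shows "chf (hmix a r) s = 0"
proof -
  let ?k = "ppow p (a + 1)"
  have kr: "evZ (a + 1) (rep ?k)"
    using evZ_add[OF rep_ppow[of "a + 1" "a + 1"] evZ_const[OF powi_in_pZ[OF order.refl]]] by simp
  have me: "(\<lambda>y. padd p y ?k) \<in> measurable (hmix a r) BQ"
    by (rule pprob_measurable_padd) (simp_all add: ppow_Omega pprob_hmix)
  have "chf (hmix a r) s = chf (distr (hmix a r) BQ (\<lambda>y. padd p y ?k)) s"
    by (simp add: hmix_shift[OF ppow_Omega kr])
  also have "\<dots> = (\<integral>y. chi s (padd p y ?k) \<partial>hmix a r)" by (rule chf_distr[OF s(1) me])
  also have "\<dots> = (\<integral>y. chi s y * chi s ?k \<partial>hmix a r)"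
    by (rule Bochner_Integration.integral_cong)
       (simp_all add: chi_padd s ppow_Omega pprob_space[OF pprob_hmix])
  also have "\<dots> = chf (hmix a r) s * chi s ?k" by (simp add: chf_def)
  finally have "chf (hmix a r) s * (chi s ?k - 1) = 0" by (simp add: algebra_simps)
  moreover have "chi s ?k \<noteq> 1"
  proof
    assume "chi s ?k = 1"
    moreover have "chi s ?k = ecis (\<lambda>n. s n * pp (a + 1))"
      unfolding chi_def by (intro ecis_mult_cong s adic_rep ppow_Omega adic_powi rep_ppow)
    ultimately have "evZ 0 (\<lambda>n. s n * pp (a + 1))"
      using ecis_eq_1 adic_mult[OF s(1) adic_powi] by metis
    hence "evZ (-a - 1) s" unfolding evZ_def pZ_mult_powi by simp
    thus False using s by simp
  qed
  ultimately show ?thesis by simp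
qed

text \<open>The distribution lives on p^a Delta, with annihilator p^(-a) Delta. This, the vanishing
  outside p^(-a-1) Delta and evenness are all that the counterexamples use of the characteristic
  function.\<close>

lemma chf_hmix_cong:
  assumes "adic s" "adic t" "evZ (-a) (\<lambda>n. s n - t n)"
  shows "chf (hmix a r) s = chf (hmix a r) t"
  unfolding chf_def
proof (rule integral_cong_AE)
  show "chi s \<in> borel_measurable (hmix a r)" "chi t \<in> borel_measurable (hmix a r)"
    unfolding pprob_measurable[OF pprob_hmix] using assms by (auto intro: measurable_chi)
  show "AE x in hmix a r. chi s x = chi t x" using hmix_low
  proof (rule eventually_mono)
    fix x assume "x \<in> pball a pzero"
    hence "x \<in> Qp" "\<forall>i<a. x i = 0" by (auto simp: pball_def pzero_def)
    thus "chi s x = chi t x" using chi_cong assms by blast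
  qed
qed

lemma chf_hmix_neg:
  assumes "0 \<le> r" "r \<le> 1" "adic s"
  shows "chf (hmix a r) (\<lambda>n. - s n) = chf (hmix a r) s"
proof -
  have me: "pneg p \<in> measurable (hmix a r) BQ"
    by (rule pprob_measurable_pneg) (simp add: pprob_hmix)
  have "chf (hmix a r) s = chf (distr (hmix a r) BQ (pneg p)) s" by (simp add: hmix_neg assms)
  also have "\<dots> = (\<integral>y. chi s (pneg p y) \<partial>hmix a r)" by (rule chf_distr[OF assms(3) me])
  also have "\<dots> = chf (hmix a r) (\<lambda>n. - s n)"
    unfolding chf_def by (rule Bochner_Integration.integral_cong)
      (simp_all add: chi_pneg assms pprob_space[OF pprob_hmix])
  finally show ?thesis ..
qed

text \<open>For r = 1 the digit at a is 0 almost surely, whence the offset: the Haar distribution of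
  p^b Delta is \<open>hmix (b - 1) 1\<close>.\<close>

lemma haar_hmix: "haar_distr p (pball (a + 1) pzero) (hmix a 1)"
  unfolding haar_distr_def
proof (intro conjI ballI)
  show "prob_space (hmix a 1)" "sets (hmix a 1) = sets BQ" using pprob_hmix by (auto simp: pprob_def)
  have "pmf (digit_pmf 1) (pzero a) = 1" using pmf_digit_pmf[of 1 0] by (simp add: pzero_def)
  thus "emeasure (hmix a 1) (pball (a + 1) pzero) = 1"
    by (simp add: hmix_ball) (simp add: pzero_def)
  fix k assume "k \<in> pball (a + 1) pzero"
  thus "distr (hmix a 1) BQ (\<lambda>y. padd p y k) = hmix a 1"
    by (intro hmix_shift) (auto simp: pball_pzero_iff)
qed

text \<open>The balls of radius p^(-a-1) around 0 and p^a have the masses 1/2 + 1/(2p) and 1/(2p),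
  which are positive and different, whereas an idempotent distribution gives equal mass to balls of
  equal radius that it charges.\<close>

lemma hmix_not_idempotent: "\<not> idempotent p (hmix a (1 / 2))"
proof
  assume I: "idempotent p (hmix a (1 / 2))"
  have z: "pzero a = 0" "\<forall>i<a. pzero i = 0" "ppow p a a = 1" "\<forall>i<a. ppow p a i = 0"
    by (auto simp: pzero_def ppow_def)
  have e1: "emeasure (hmix a (1 / 2)) (pball (a + 1) pzero) = ennreal (1 / 2 + (1 / 2) / real p)"
    using pmf_digit_pmf[of "1 / 2" 0] hmix_ball[where z = pzero and a = a and n = "a + 1" and r = "1 / 2"] by (simp add: z)
  have e2: "emeasure (hmix a (1 / 2)) (pball (a + 1) (ppow p a)) = ennreal ((1 / 2) / real p)"
    using pmf_digit_pmf[of "1 / 2" 1] hmix_ball[where z = "ppow p a" and a = a and n = "a + 1" and r = "1 / 2"] p_gt_1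
    by (simp add: z ppow_Omega)
  have pos: "(1 / 2) / real p > 0" using p_pos by simp
  have "emeasure (hmix a (1 / 2)) (pball (a + 1) pzero) = emeasure (hmix a (1 / 2)) (pball (a + 1) (ppow p a))"
    by (rule idempotent_balls[OF I]) (use e1 e2 pos in \<open>auto simp: ppow_Omega\<close>)
  thus False unfolding e1 e2 using pos by simp
qed

lemma pZ_lev:
  assumes "A \<in> pZ k" "A \<notin> pZ b" obtains c where "c < b" "lev c (\<lambda>_. A)"
proof -
  have "k \<le> b" using assms pZ_mono[of b k A] by force
  have "A \<in> pZ m \<or> (\<exists>c<m. lev c (\<lambda>_. A))" if "k \<le> m" for m using that
  proof (induction m rule: int_ge_induct)
    case base show ?case using assms by simp
  next
    case (step m)
    show ?case
    proof (cases "A \<in> pZ m")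
      case True
      then obtain i :: int where i: "A = of_int i * pp m" by (auto simp: pZ_def)
      show ?thesis
      proof (cases "int p dvd i")
        case True
        then obtain j where "i = int p * j" by blast
        hence "A = of_int j * pp (m + 1)" by (simp add: i powi_add)
        thus ?thesis by (simp only: pZ_I simp_thms)
      next
        case False
        from lev_const[OF this, of m] show ?thesis unfolding i by (intro disjI2 exI[of _ m]) simp
      qed
    next
      case False
      thus ?thesis using step by force
    qed
  qed
  from this[OF \<open>k \<le> b\<close>] show ?thesis using assms that by blast
qed

text \<open>The two hypotheses determine the characteristic function: the character of x on p^b
  Delta and zero elsewhere, exactly as for the shifted Haar distribution.\<close>

lemma conc_shift_haar:
  assumes \<mu>: "pprob \<mu>" and x: "x \<in> Qp" "AE y in \<mu>. y \<in> pball (-b) x"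
    and zero: "\<And>c s. adic s \<Longrightarrow> c < b \<Longrightarrow> lev c s \<Longrightarrow> chf \<mu> s = 0"
  shows "\<mu> = pshift p (hmix (-b - 1) 1) x"
proof -
  let ?m = "hmix (-b - 1) 1"
  have me: "(\<lambda>y. padd p y x) \<in> measurable ?m BQ"
    by (rule pprob_measurable_padd) (simp_all add: x pprob_hmix)
  have ps: "pprob (pshift p ?m x)" unfolding pshift_def by (rule pprob_distr[OF pprob_prob[OF pprob_hmix] me])
  have "prob_space ?m" by (rule pprob_prob[OF pprob_hmix])
  then interpret P: prob_space ?m .
  have mK: "emeasure ?m (pball (-b) pzero) = 1" using haar_hmix[of "-b - 1"] by (simp add: haar_distr_def)
  have mS: "pball (-b) pzero \<in> sets ?m" using pprob_hmix by (simp add: pprob_def pball_sets)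
  have aem: "AE y in ?m. y \<in> pball (-b) pzero"
    using mK mS by (simp add: P.AE_in_set_eq_1 P.emeasure_eq_measure)
  have ae: "AE y in pshift p ?m x. y \<in> pball (-b) x"
  proof -
    have "AE y in ?m. padd p y x \<in> pball (-b) x" using aem
    proof (rule eventually_mono)
      fix y assume "y \<in> pball (-b) pzero"
      hence y: "y \<in> Qp" "evZ (-b) (rep y)" by (auto simp: pball_pzero_iff)
      have "evZ (-b) (\<lambda>n. rep (padd p y x) n - rep x n)"
        using evZ_add[OF rep_padd[OF y(1) x(1), of "-b"] y(2)] by (rule evZ_eq) simp
      thus "padd p y x \<in> pball (-b) x" using x y by (simp add: pball_iff padd_Omega)
    qed
    moreover have S: "{z \<in> space BQ. z \<in> pball (-b) x} \<in> sets BQ" by measurable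
    ultimately show ?thesis unfolding pshift_def AE_distr_iff[OF me S] by simp
  qed
  \<comment> \<open>Uniqueness is available on subgroups only, so the coset x + p^(-b) Delta is
    enclosed in some p^L Delta.\<close>
  obtain L where L: "L \<le> -b" "\<forall>i<L. x i = 0" using Omega_low[OF x(1)] by blast
  have sub: "pball (-b) x \<subseteq> pball (- (-L)) pzero"
    using pball_mono[OF L(1), of x] L(2) by (auto simp: pball_def pzero_def)
  show ?thesis
  proof (rule measure_eqI_char[OF \<mu> ps, where J = "-L"])
    show "AE x in \<mu>. x \<in> pball (- (-L)) pzero" using x(2) by (rule eventually_mono) (use sub in blast)
    show "AE x in pshift p ?m x. x \<in> pball (- (-L)) pzero" using ae by (rule eventually_mono) (use sub in blast)
    fix A k assume A: "A \<in> pZ k"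
    have ad: "adic (\<lambda>_. A)" by (rule adic_const[OF A])
    show "chf \<mu> (\<lambda>_. A) = chf (pshift p ?m x) (\<lambda>_. A)"
    proof (cases "A \<in> pZ b")
      case True
      thus ?thesis using chf_ball[OF \<mu> ad evZ_const x] chf_ball[OF ps ad evZ_const x(1) ae] by simp
    next
      case False
      then obtain c where c: "c < b" "lev c (\<lambda>_. A)" using pZ_lev[OF A] by blast
      have "chf (pshift p ?m x) (\<lambda>_. A) = (\<integral>y. chi (\<lambda>_. A) (padd p y x) \<partial>?m)"
        unfolding pshift_def by (rule chf_distr[OF ad me])
      also have "\<dots> = (\<integral>y. chi (\<lambda>_. A) y * chi (\<lambda>_. A) x \<partial>?m)"
        by (rule Bochner_Integration.integral_cong)
          (simp_all add: chi_padd ad x pprob_space[OF pprob_hmix])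
      also have "\<dots> = chf ?m (\<lambda>_. A) * chi (\<lambda>_. A) x" by (simp add: chf_def)
      also have "chf ?m (\<lambda>_. A) = 0" by (rule chf_hmix_zero[OF ad]) (simp add: evZ_const_iff False)
      finally show ?thesis using zero[OF ad c] by simp
    qed
  qed
qed

subsection \<open>Consequences of the functional equation\<close>

text \<open>The strong triangle inequality: a summand of larger valuation does not change the
  valuation. This reads off the valuations of 2, \<alpha> and 1 + \<alpha> from leading
  digits.\<close>

lemma lev_shift:
  assumes "lev b s" "evZ (b + 1) (\<lambda>n. t n - s n)" shows "lev b t"
  using assms unfolding lev_def evZ_def
proof eventually_elim
  case (elim n)
  then obtain i j :: int where ij: "s n = of_int i * pp b" "\<not> int p dvd i"
    "t n - s n = of_int j * pp (b + 1)" by (auto simp: pZ_def)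
  have "t n = of_int (i + j * int p) * pp b"
    using ij(1,3) by (simp add: powi_add algebra_simps)
  moreover have "\<not> int p dvd i + j * int p" using ij(2) by (simp add: dvd_add_left_iff)
  ultimately show ?case by blast
qed

text \<open>Pigeonhole on the powers of the residue of \<open>s\<close> modulo \<open>p\<^sup>N\<close>.\<close>

lemma unit_power_near_1:
  assumes s: "adic s" "lev 0 s" obtains e where "e > 0" "evZ (int N) (\<lambda>n. s n ^ e - 1)"
proof -
  obtain A where A: "evZ (int N + 1) (\<lambda>n. s n - A)" using adicD s by blast
  have "\<forall>\<^sub>F n in sequentially. (\<exists>i::int. s n = of_int i * pp 0 \<and> \<not> int p dvd i) \<and> s n - A \<in> pZ (int N + 1)"
    using s(2) A unfolding lev_def evZ_def by eventually_elim simp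
  from eventually_happens'[OF sequentially_bot this]
  obtain m i where i: "s m = of_int i" "\<not> int p dvd i" and m: "s m - A \<in> pZ (int N + 1)" by auto
  let ?M = "int p ^ N"
  have "\<not> inj (\<lambda>e::nat. i ^ e mod ?M)"
  proof
    assume "inj (\<lambda>e::nat. i ^ e mod ?M)"
    moreover have "range (\<lambda>e::nat. i ^ e mod ?M) \<subseteq> {0..<?M}" by auto
    hence "finite (range (\<lambda>e::nat. i ^ e mod ?M))" by (rule finite_subset) simp
    ultimately show False using finite_imageD[of "\<lambda>e::nat. i ^ e mod ?M" UNIV] by auto
  qed
  then obtain e f :: nat where ef: "e < f" "i ^ e mod ?M = i ^ f mod ?M"
    unfolding inj_def by (metis linorder_neqE_nat)
  have "coprime i ?M" using i(2) prime_int_p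
    by (metis coprime_commute coprime_power_left_iff prime_imp_coprime)
  hence cop: "coprime (i ^ e) ?M" by auto
  have "[i ^ e * i ^ (f - e) = i ^ e * 1] (mod ?M)"
    using ef by (simp add: cong_def flip: power_add)
  hence "[i ^ (f - e) = 1] (mod ?M)" using cong_mult_lcancel[OF cop] by blast
  then obtain l where l: "i ^ (f - e) - 1 = ?M * l" by (auto simp: cong_iff_dvd_diff)
  have "evZ (int N) (\<lambda>n. s n ^ (f - e) - of_int i ^ (f - e))"
  proof -
    have base: "evZ (int N) (\<lambda>n. s n - of_int i)"
    proof -
      have "evZ (int N + 1) (\<lambda>n. s n - s m)" by (rule evZ_trans[OF A evZ_const[OF pZ_sym[OF m]]])
      thus ?thesis unfolding i(1) by (rule evZ_mono) simp
    qed
    have D0: "evZ 0 s" by (rule lev_evZ[OF s(2)])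
    have i0: "evZ 0 (\<lambda>_. of_int i)" using pZ_I[of i 0] by (simp add: evZ_const_iff)
    have "evZ (int N) (\<lambda>n. s n ^ j - of_int i ^ j) \<and> evZ 0 (\<lambda>n. s n ^ j)" for j
    proof (induction j)
      case 0
      show ?case using pZ_I[of 1 0] by (simp add: evZ_def)
    next
      case (Suc j)
      have "evZ (int N + 0) (\<lambda>n. (s n - of_int i) * s n ^ j)" using base Suc by (intro evZ_mult) auto
      moreover have "evZ (0 + int N) (\<lambda>n. of_int i * (s n ^ j - of_int i ^ j))" using i0 Suc by (intro evZ_mult) auto
      ultimately have "evZ (int N) (\<lambda>n. (s n - of_int i) * s n ^ j + of_int i * (s n ^ j - of_int i ^ j))"
        by (intro evZ_add) auto
      moreover have "evZ (0 + 0) (\<lambda>n. s n * s n ^ j)" using D0 Suc by (intro evZ_mult) auto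
      ultimately show ?case by (simp add: algebra_simps)
    qed
    thus ?thesis by blast
  qed
  moreover have "evZ (int N) (\<lambda>_. of_int i ^ (f - e) - 1)"
  proof -
    have "(of_int i ^ (f - e) - 1 :: real) = of_int (i ^ (f - e) - 1)" by simp
    also have "\<dots> = of_int l * pp (int N)" unfolding l by simp
    finally show ?thesis by (simp only: evZ_const_iff pZ_I)
  qed
  ultimately have "evZ (int N) (\<lambda>n. s n ^ (f - e) - 1)" using evZ_add by fastforce
  thus ?thesis using ef by (intro that[of "f - e"]) auto
qed

lemma chf_zero: assumes "pprob \<mu>" shows "chf \<mu> (\<lambda>_. 0) = 1"
proof (rule chf_AE_const[OF assms adic_0])
  show "AE x in \<mu>. chi (\<lambda>_. 0) x = 1"
    by (rule AE_I2) (simp add: chi_def ecis_0[OF adic_0] evZ_const_iff)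
qed

text \<open>The frequencies p^k tend to 0, where the value is 1. This supplies the first level at
  which concentration occurs.\<close>

lemma chf_nonzero:
  assumes "pprob \<mu>" obtains b where "chf \<mu> (\<lambda>_. pp b) \<noteq> 0"
proof -
  have "(\<lambda>k. chf \<mu> (\<lambda>_. pp (int k))) \<longlonglongrightarrow> chf \<mu> (\<lambda>_. 0)"
  proof (rule chf_tendsto[OF assms adic_powi adic_0])
    fix N
    have "\<forall>\<^sub>F k in sequentially. N \<le> int k"
      using eventually_ge_at_top[of "nat N"] by eventually_elim simp
    thus "\<forall>\<^sub>F k in sequentially. evZ N (\<lambda>n. pp (int k) - 0)"
      by eventually_elim (simp only: diff_0_right evZ_const_iff powi_in_pZ)
  qed
  hence "(\<lambda>k. chf \<mu> (\<lambda>_. pp (int k))) \<longlonglongrightarrow> 1" by (simp add: chf_zero[OF assms])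
  hence "\<forall>\<^sub>F k in sequentially. chf \<mu> (\<lambda>_. pp (int k)) \<noteq> 0"
    by (rule tendsto_imp_eventually_ne) simp
  from eventually_happens'[OF sequentially_bot this]
  obtain k :: nat where "chf \<mu> (\<lambda>_. pp (int k)) \<noteq> 0" ..
  thus ?thesis by (rule that)
qed

text \<open>The moduli at \<kappa>^e w, for e = 1, 2, ..., do not decrease and start at \<kappa> w,
  while along exponents with \<kappa>^e near 1 they tend to the modulus at w.\<close>

lemma chf_unit_orbit:
  assumes \<mu>: "pprob \<mu>" and \<kappa>: "adic \<kappa>" "lev 0 \<kappa>"
    and le: "\<And>w. adic w \<Longrightarrow> norm (chf \<mu> w) \<le> norm (chf \<mu> (\<lambda>n. \<kappa> n * w n))" and w: "adic w"
  shows "norm (chf \<mu> (\<lambda>n. \<kappa> n * w n)) \<le> norm (chf \<mu> w)"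
proof -
  have iter: "norm (chf \<mu> (\<lambda>n. \<kappa> n * w n)) \<le> norm (chf \<mu> (\<lambda>n. \<kappa> n ^ Suc e * w n))" for e
  proof (induction e)
    case (Suc e)
    have "adic (\<lambda>n. \<kappa> n ^ Suc e * w n)" by (intro adic_mult adic_power \<kappa> w)
    from le[OF this] Suc show ?case by (simp add: mult.assoc)
  qed simp
  have "\<forall>N. \<exists>e>0. evZ (int N) (\<lambda>n. \<kappa> n ^ e - 1)" using unit_power_near_1[OF \<kappa>] by metis
  then obtain e where e: "\<And>N. e N > 0" "\<And>N. evZ (int N) (\<lambda>n. \<kappa> n ^ e N - 1)" by metis
  obtain b where b: "evZ b w" using adicD w by blast
  have "(\<lambda>N. chf \<mu> (\<lambda>n. \<kappa> n ^ e N * w n)) \<longlonglongrightarrow> chf \<mu> w"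
  proof (rule chf_tendsto[OF \<mu> _ w])
    show "adic (\<lambda>n. \<kappa> n ^ e N * w n)" for N by (intro adic_mult adic_power \<kappa> w)
    fix N
    have "\<forall>\<^sub>F k in sequentially. N - b \<le> int k"
      using eventually_ge_at_top[of "nat (N - b)"] by eventually_elim simp
    thus "\<forall>\<^sub>F k in sequentially. evZ N (\<lambda>n. \<kappa> n ^ e k * w n - w n)"
    proof eventually_elim
      case (elim k)
      from evZ_mult[OF e(2)[of k] b] have "evZ (int k + b) (\<lambda>n. \<kappa> n ^ e k * w n - w n)"
        by (rule evZ_eq) (simp add: algebra_simps)
      thus ?case by (rule evZ_mono) (use elim in simp)
    qed
  qed
  hence "(\<lambda>N. norm (chf \<mu> (\<lambda>n. \<kappa> n ^ e N * w n))) \<longlonglongrightarrow> norm (chf \<mu> w)" by (rule tendsto_norm)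
  moreover have "norm (chf \<mu> (\<lambda>n. \<kappa> n * w n)) \<le> norm (chf \<mu> (\<lambda>n. \<kappa> n ^ e N * w n))" for N
    using iter[of "e N - 1"] e(1)[of N] by simp
  ultimately show ?thesis by (intro LIMSEQ_le_const) auto
qed

text \<open>Applied with x and y the moduli of one characteristic function at w and at \<kappa> w or
  -\<kappa> w: as x is nonzero and y does not exceed it, the scaling factor has to be 1.\<close>

lemma chf_norm_1_of_scaled:
  assumes "pprob \<mu>" "adic s" "x = norm (chf \<mu> s) * y" "y \<le> x" "x \<noteq> 0" "y \<ge> 0"
  shows "norm (chf \<mu> s) = 1"
proof -
  have "y > 0" using assms(3,5,6) by (cases "y = 0") auto
  moreover have "y \<le> norm (chf \<mu> s) * y" using assms(3,4) by simp
  ultimately have "1 \<le> norm (chf \<mu> s)" by simp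
  with chf_norm_le[OF assms(1,2)] show ?thesis by simp
qed

lemma heyde_diag:
  assumes sm: "sym_model p \<alpha> M \<xi>1 \<xi>2" and a: "\<alpha> \<in> Qp" and u: "adic u"
  defines "f \<equiv> chf (distr M BQ \<xi>1)" and "g \<equiv> chf (distr M BQ \<xi>2)"
  shows "norm (g (\<lambda>n. (1 - rep \<alpha> n) * u n)) = norm (f (\<lambda>n. 2 * u n)) * norm (g (\<lambda>n. (1 + rep \<alpha> n) * u n))"
proof -
  have "pprob (distr M BQ \<xi>1)" using sm by (auto simp: sym_model_def intro: pprob_distr)
  with heyde[OF sm a u u] have "f (\<lambda>n. 2 * u n) * g (\<lambda>n. (1 + rep \<alpha> n) * u n) = g (\<lambda>n. (1 - rep \<alpha> n) * u n)"
    unfolding f_def g_def by (simp add: chf_zero algebra_simps flip: mult_2)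
  thus ?thesis by (metis norm_mult)
qed

text \<open>Equal levels of 1 - \<alpha> and 1 + \<alpha> make \<kappa> a unit. The numbers b - e
  and b + k - e are the levels of 2 w / (1 - \<alpha>) and -2 \<alpha> w / (1 - \<alpha>), the
  frequencies at which the other characteristic function gets modulus 1.\<close>

lemma heyde_unit:
  fixes M :: "'a measure"
  assumes sm: "sym_model p \<alpha> M \<xi>1 \<xi>2" and a: "\<alpha> \<in> Qp"
    and l2: "lev 0 (\<lambda>_. 2)" and lm: "lev e (\<lambda>n. 1 - rep \<alpha> n)" and lp: "lev e (\<lambda>n. 1 + rep \<alpha> n)" and la: "lev k (rep \<alpha>)"
    and w: "adic w" "lev b w"
  defines "f \<equiv> chf (distr M BQ \<xi>1)" and "g \<equiv> chf (distr M BQ \<xi>2)"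
  shows "g w \<noteq> 0 \<Longrightarrow> conc (distr M BQ \<xi>1) (b - e)"
    and "f w \<noteq> 0 \<Longrightarrow> conc (distr M BQ \<xi>2) (b + k - e)"
proof -
  have P: "prob_space M" and x: "\<xi>1 \<in> measurable M BQ" "\<xi>2 \<in> measurable M BQ"
    using sm by (auto simp: sym_model_def)
  let ?\<mu> = "distr M BQ \<xi>1" and ?\<nu> = "distr M BQ \<xi>2"
  have pm: "pprob ?\<mu>" "pprob ?\<nu>" by (intro pprob_distr P x)+
  have ar: "adic (rep \<alpha>)" by (rule adic_rep[OF a])
  have am: "adic (\<lambda>n. 1 - rep \<alpha> n)" and ap: "adic (\<lambda>n. 1 + rep \<alpha> n)" by (intro adic_intros ar)+
  obtain t where t: "adic t" "lev (-e) t"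
    and invw: "\<And>N v. adic v \<Longrightarrow> evZ N (\<lambda>n. (1 - rep \<alpha> n) * (t n * v n) - v n)"
    by (rule lev_inverse_mult[OF am lm]) (rule that)
  define \<kappa> where "\<kappa> = (\<lambda>n. (1 + rep \<alpha> n) * t n)"
  have \<kappa>: "adic \<kappa>" "lev 0 \<kappa>"
    unfolding \<kappa>_def using adic_mult[OF ap t(1)] lev_mult[OF lp t(2)] by simp_all
  have \<kappa>': "adic (\<lambda>n. - \<kappa> n)" "lev 0 (\<lambda>n. - \<kappa> n)" using \<kappa> adic_minus lev_minus by auto
  have G: "norm (g v) = norm (f (\<lambda>n. 2 * (t n * v n))) * norm (g (\<lambda>n. \<kappa> n * v n))" if v: "adic v" for v
  proof -
    have tv: "adic (\<lambda>n. t n * v n)" by (intro adic_mult t v)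
    have "g (\<lambda>n. (1 - rep \<alpha> n) * (t n * v n)) = g v"
      unfolding g_def by (rule chf_cong[OF pm(2) _ v invw[OF v]]) (intro adic_intros tv ar)
    thus ?thesis using heyde_diag[OF sm a tv] by (simp add: f_def g_def \<kappa>_def mult.assoc)
  qed
  have F: "norm (f v) = norm (g (\<lambda>n. - 2 * (rep \<alpha> n * (t n * v n)))) * norm (f (\<lambda>n. - \<kappa> n * v n))" if v: "adic v" for v
  proof -
    \<comment> \<open>For u = -v / (1 - \<alpha>) the pair (\<alpha> u, u) gives f on the right the
      argument \<alpha> u - u = v and g the argument 0.\<close>
    define u where "u = (\<lambda>n. - (t n * v n))"
    have u: "adic u" unfolding u_def by (intro adic_intros t v)
    have au: "adic (\<lambda>n. rep \<alpha> n * u n)" by (intro adic_mult ar u)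
    have "f (\<lambda>n. rep \<alpha> n * u n + u n) * g (\<lambda>n. rep \<alpha> n * u n + u n * rep \<alpha> n) =
        f (\<lambda>n. rep \<alpha> n * u n - u n) * g (\<lambda>n. rep \<alpha> n * u n - u n * rep \<alpha> n)"
      unfolding f_def g_def by (rule heyde[OF sm a au u])
    moreover have "f (\<lambda>n. rep \<alpha> n * u n - u n) = f v"
      unfolding f_def
    proof (rule chf_cong[OF pm(1) _ v])
      show "evZ N (\<lambda>n. rep \<alpha> n * u n - u n - v n)" for N
        using invw[OF v, of N] by (rule evZ_eq) (simp add: u_def algebra_simps)
    qed (intro adic_intros u ar)
    moreover have "g (\<lambda>n. rep \<alpha> n * u n - u n * rep \<alpha> n) = 1"
      by (simp add: g_def chf_zero[OF pm(2)] mult.commute)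
    moreover have "(\<lambda>n. rep \<alpha> n * u n + u n) = (\<lambda>n. - \<kappa> n * v n)"
      by (simp add: u_def \<kappa>_def algebra_simps)
    moreover have "(\<lambda>n. rep \<alpha> n * u n + u n * rep \<alpha> n) = (\<lambda>n. - 2 * (rep \<alpha> n * (t n * v n)))"
      by (simp add: u_def algebra_simps)
    ultimately have "f (\<lambda>n. - \<kappa> n * v n) * g (\<lambda>n. - 2 * (rep \<alpha> n * (t n * v n))) = f v" by simp
    thus ?thesis by (metis norm_mult mult.commute)
  qed
  show "conc ?\<mu> (b - e)" if nz: "g w \<noteq> 0"
  proof (rule chf_conc[OF pm(1)])
    let ?s = "\<lambda>n. 2 * (t n * w n)"
    show s: "adic ?s" by (intro adic_intros t w)
    show "lev (b - e) ?s" using lev_mult[OF l2 lev_mult[OF t(2) w(2)]] by simp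
    have le: "norm (g v) \<le> norm (g (\<lambda>n. \<kappa> n * v n))" if v: "adic v" for v
    proof -
      have "norm (f (\<lambda>n. 2 * (t n * v n))) \<le> 1" unfolding f_def by (intro chf_norm_le pm adic_intros t v)
      thus ?thesis unfolding G[OF v] by (intro mult_left_le_one_le) auto
    qed
    show "norm (chf ?\<mu> ?s) = 1"
      using chf_unit_orbit[OF pm(2) \<kappa> le[unfolded g_def] w(1)] G[OF w(1)] nz
      unfolding f_def g_def by (intro chf_norm_1_of_scaled[OF pm(1) s]) auto
  qed
  show "conc ?\<nu> (b + k - e)" if nz: "f w \<noteq> 0"
  proof (rule chf_conc[OF pm(2)])
    let ?s = "\<lambda>n. - 2 * (rep \<alpha> n * (t n * w n))"
    have "adic (\<lambda>n. - (2 * (rep \<alpha> n * (t n * w n))))" by (intro adic_intros t w ar)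
    thus s: "adic ?s" by simp
    have "lev (0 + (k + (-e + b))) (\<lambda>n. - (2 * (rep \<alpha> n * (t n * w n))))"
      by (intro lev_minus lev_mult l2 la t w)
    thus "lev (b + k - e) ?s" by (simp add: algebra_simps)
    have le: "norm (f v) \<le> norm (f (\<lambda>n. - \<kappa> n * v n))" if v: "adic v" for v
    proof -
      have "adic (\<lambda>n. - (2 * (rep \<alpha> n * (t n * v n))))" by (intro adic_intros t v ar)
      hence "norm (g (\<lambda>n. - 2 * (rep \<alpha> n * (t n * v n)))) \<le> 1" unfolding g_def by (intro chf_norm_le pm) simp
      thus ?thesis unfolding F[OF v] by (intro mult_left_le_one_le) auto
    qed
    show "norm (chf ?\<nu> ?s) = 1"
      using chf_unit_orbit[OF pm(1) \<kappa>' le[unfolded f_def] w(1)] F[OF w(1)] nz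
      unfolding f_def g_def by (intro chf_norm_1_of_scaled[OF pm(2) s]) auto
  qed
qed

text \<open>Here 1 - \<alpha> is strictly more divisible than 1 + \<alpha>, and \<kappa> denotes (1
  - \<alpha>) / (1 + \<alpha>), whose powers tend to 0; hence |g| = 1 everywhere. The diagonal
  equation then forces |f| = 1 as well. The level l of 2 is arbitrary, which covers p = 2.\<close>

lemma heyde_degenerate:
  fixes M :: "'a measure"
  assumes sm: "sym_model p \<alpha> M \<xi>1 \<xi>2" and a: "\<alpha> \<in> Qp"
    and l2: "lev l (\<lambda>_. 2)" and lp: "lev d (\<lambda>n. 1 + rep \<alpha> n)" and Dm: "evZ (d + 1) (\<lambda>n. 1 - rep \<alpha> n)"
  shows "conc (distr M BQ \<xi>1) b" "conc (distr M BQ \<xi>2) b"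
proof -
  have P: "prob_space M" and x: "\<xi>1 \<in> measurable M BQ" "\<xi>2 \<in> measurable M BQ"
    using sm by (auto simp: sym_model_def)
  let ?\<mu> = "distr M BQ \<xi>1" and ?\<nu> = "distr M BQ \<xi>2"
  define f where "f = chf ?\<mu>"
  define g where "g = chf ?\<nu>"
  have pm: "pprob ?\<mu>" "pprob ?\<nu>" by (intro pprob_distr P x)+
  have ar: "adic (rep \<alpha>)" by (rule adic_rep[OF a])
  have am: "adic (\<lambda>n. 1 - rep \<alpha> n)" and ap: "adic (\<lambda>n. 1 + rep \<alpha> n)" by (intro adic_intros ar)+
  obtain t where t: "adic t" "lev (-d) t"
    and invw: "\<And>N v. adic v \<Longrightarrow> evZ N (\<lambda>n. (1 + rep \<alpha> n) * (t n * v n) - v n)"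
    by (rule lev_inverse_mult[OF ap lp]) (rule that)
  define \<kappa> where "\<kappa> = (\<lambda>n. (1 - rep \<alpha> n) * t n)"
  have \<kappa>: "adic \<kappa>" "evZ 1 \<kappa>"
    unfolding \<kappa>_def using adic_mult[OF am t(1)] evZ_mult[OF Dm lev_evZ[OF t(2)]] by simp_all
  have G: "norm (g (\<lambda>n. \<kappa> n * v n)) = norm (f (\<lambda>n. 2 * (t n * v n))) * norm (g v)" if v: "adic v" for v
  proof -
    have tv: "adic (\<lambda>n. t n * v n)" by (intro adic_mult t v)
    have "g (\<lambda>n. (1 + rep \<alpha> n) * (t n * v n)) = g v"
      unfolding g_def by (rule chf_cong[OF pm(2) _ v invw[OF v]]) (intro adic_intros tv ar)
    thus ?thesis using heyde_diag[OF sm a tv] by (simp add: f_def g_def \<kappa>_def mult.assoc)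
  qed
  have g1: "norm (g v) = 1" if v: "adic v" for v
  proof -
    have kv: "adic (\<lambda>n. \<kappa> n ^ m * v n)" for m by (intro adic_mult adic_power \<kappa> v)
    have step: "norm (g (\<lambda>n. \<kappa> n ^ m * v n)) \<le> norm (g v)" for m
    proof (induction m)
      case (Suc m)
      have "norm (f (\<lambda>n. 2 * (t n * (\<kappa> n ^ m * v n)))) \<le> 1"
        unfolding f_def by (intro chf_norm_le pm adic_intros t kv)
      hence "norm (g (\<lambda>n. \<kappa> n * (\<kappa> n ^ m * v n))) \<le> norm (g (\<lambda>n. \<kappa> n ^ m * v n))"
        unfolding G[OF kv] by (intro mult_left_le_one_le) auto
      with Suc show ?case by (simp add: mult.assoc)
    qed simp
    obtain c where c: "evZ c v" using adicD v by blast
    have Dk: "evZ (int m) (\<lambda>n. \<kappa> n ^ m)" for m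
    proof (induction m)
      case 0 show ?case using powi_in_pZ[of 0 0] by (simp add: evZ_def)
    next
      case (Suc m)
      from evZ_mult[OF \<kappa>(2) this] show ?case by simp
    qed
    have "(\<lambda>m. chf ?\<nu> (\<lambda>n. \<kappa> n ^ m * v n)) \<longlonglongrightarrow> chf ?\<nu> (\<lambda>_. 0)"
    proof (rule chf_tendsto[OF pm(2) kv adic_0])
      fix N
      have "\<forall>\<^sub>F m in sequentially. N - c \<le> int m"
        using eventually_ge_at_top[of "nat (N - c)"] by eventually_elim simp
      thus "\<forall>\<^sub>F m in sequentially. evZ N (\<lambda>n. \<kappa> n ^ m * v n - 0)"
      proof eventually_elim
        case (elim m)
        from evZ_mult[OF Dk[of m] c] have "evZ N (\<lambda>n. \<kappa> n ^ m * v n)" by (rule evZ_mono) (use elim in simp)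
        thus ?case by simp
      qed
    qed
    hence "(\<lambda>m. norm (g (\<lambda>n. \<kappa> n ^ m * v n))) \<longlonglongrightarrow> norm (1::complex)"
      unfolding g_def chf_zero[OF pm(2)] by (rule tendsto_norm)
    hence "norm (1::complex) \<le> norm (g v)" by (rule LIMSEQ_le_const2) (use step in auto)
    moreover have "norm (g v) \<le> 1" unfolding g_def by (intro chf_norm_le pm v)
    ultimately show ?thesis by simp
  qed
  show "conc ?\<nu> b" using chf_conc[OF pm(2) adic_powi lev_powi] g1[OF adic_powi] by (simp add: g_def)
  \<comment> \<open>The exponent is chosen so that 2 w / (1 + \<alpha>) has valuation l - d + (b + d
    - l) = b.\<close>
  have w: "adic (\<lambda>_. pp (b + d - l))" by (rule adic_powi)
  have "norm (f (\<lambda>n. 2 * (t n * pp (b + d - l)))) = 1"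
    using G[OF w] g1[OF w] g1[OF adic_mult[OF \<kappa>(1) w]] by simp
  moreover have "lev b (\<lambda>n. 2 * (t n * pp (b + d - l)))"
    using lev_mult[OF l2 lev_mult[OF t(2) lev_powi[of "b + d - l"]]] by (simp add: algebra_simps)
  moreover have "adic (\<lambda>n. 2 * (t n * pp (b + d - l)))" by (intro adic_intros t)
  ultimately show "conc ?\<mu> b" using chf_conc[OF pm(1)] by (simp add: f_def)
qed

section \<open>From levels of concentration to Haar distributions\<close>

lemma conc_min:
  assumes "conc \<mu> c" "\<not> conc \<mu> d" obtains b where "\<And>c. conc \<mu> c \<longleftrightarrow> b \<le> c"
proof -
  have "\<exists>b. conc \<mu> b \<and> \<not> conc \<mu> (b - 1)"
  proof (rule ccontr)
    assume no: "\<nexists>b. conc \<mu> b \<and> \<not> conc \<mu> (b - 1)"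
    have "conc \<mu> (c - int n)" for n
    proof (induction n)
      case (Suc n)
      have "c - int (Suc n) = (c - int n) - 1" by simp
      thus ?case using no Suc by metis
    qed (use assms in simp)
    from this[of "nat (c - d)"] show False using assms conc_mono[OF assms(1), of d] by (cases "d \<le> c") auto
  qed
  then obtain b where b: "conc \<mu> b" "\<not> conc \<mu> (b - 1)" by blast
  have "conc \<mu> c \<longleftrightarrow> b \<le> c" for c
    using b conc_mono[of \<mu> b c] conc_mono[of \<mu> c "b - 1"] by force
  thus ?thesis by (rule that)
qed

lemma conc_chf_nonzero:
  assumes "pprob \<mu>" "conc \<mu> b" shows "chf \<mu> (\<lambda>_. pp b) \<noteq> 0"
  using conc_chf[OF assms(1) adic_powi lev_evZ[OF lev_powi] assms(2)] by auto

lemma idempotent_degenerate: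
  assumes "degenerate p \<mu>" shows "idempotent p \<mu>"
proof -
  obtain x where x: "x \<in> Qp" "\<mu> = return BQ x" using assms by (auto simp: degenerate_def)
  show ?thesis unfolding idempotent_def
    by (intro exI[of _ "{pzero}"] exI[of _ "return BQ pzero"] exI[of _ x])
       (simp add: x compact_subgroup_pzero haar_return pshift_return)
qed

lemma conc_idempotent:
  assumes \<mu>: "pprob \<mu>" and b: "conc \<mu> b"
    and zero: "\<forall>c s. adic s \<longrightarrow> c < b \<longrightarrow> lev c s \<longrightarrow> chf \<mu> s = 0"
  shows "\<exists>x\<in>Qp. \<mu> = pshift p (hmix (-b - 1) 1) x"
proof -
  obtain x where x: "x \<in> Qp" "AE y in \<mu>. y \<in> pball (-b) x" using b unfolding conc_def by blast
  have "\<mu> = pshift p (hmix (-b - 1) 1) x" by (rule conc_shift_haar[OF \<mu> x]) (use zero in blast)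
  with x(1) show ?thesis by blast
qed

lemma degenerateI: "pprob \<mu> \<Longrightarrow> (\<And>b. conc \<mu> b) \<Longrightarrow> degenerate p \<mu>"
  by (erule conc_all_degenerate) (auto simp: degenerate_def)

lemma degenerate_common_haar:
  assumes "degenerate p \<mu>" "degenerate p \<nu>"
  shows "\<exists>K m x1 x2. compact_subgroup p K \<and> haar_distr p K m \<and>
                    x1 \<in> Qp \<and> x2 \<in> Qp \<and> \<mu> = pshift p m x1 \<and> \<nu> = pshift p m x2"
proof -
  obtain x1 x2 where x: "x1 \<in> Qp" "x2 \<in> Qp" "\<mu> = return BQ x1" "\<nu> = return BQ x2"
    using assms unfolding degenerate_def by blast
  show ?thesis
    by (intro exI[of _ "{pzero}"] exI[of _ "return BQ pzero"] exI[of _ x1] exI[of _ x2])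
       (use x compact_subgroup_pzero haar_return pshift_return in auto)
qed

text \<open>Both distributions are concentrated at the same levels. If b is the least of them, a
  nonzero value at level c gives concentration at level c, so both characteristic functions vanish
  below b and both distributions are shifts of the same Haar distribution.\<close>

lemma common_haar:
  assumes \<mu>: "pprob \<mu>" and \<nu>: "pprob \<nu>"
    and g: "\<And>b w. adic w \<Longrightarrow> lev b w \<Longrightarrow> chf \<nu> w \<noteq> 0 \<Longrightarrow> conc \<mu> b"
    and f: "\<And>b w. adic w \<Longrightarrow> lev b w \<Longrightarrow> chf \<mu> w \<noteq> 0 \<Longrightarrow> conc \<nu> b"
  shows "\<exists>K m x1 x2. compact_subgroup p K \<and> haar_distr p K m \<and>
                    x1 \<in> Qp \<and> x2 \<in> Qp \<and> \<mu> = pshift p m x1 \<and> \<nu> = pshift p m x2"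
proof -
  have iff: "conc \<mu> b \<longleftrightarrow> conc \<nu> b" for b
    using g[OF adic_powi lev_powi conc_chf_nonzero[OF \<nu>]] f[OF adic_powi lev_powi conc_chf_nonzero[OF \<mu>]] by blast
  show ?thesis
  proof (cases "\<forall>b. conc \<mu> b")
    case True
    thus ?thesis using iff degenerateI \<mu> \<nu> by (intro degenerate_common_haar) auto
  next
    case False
    then obtain d where d: "\<not> conc \<mu> d" by blast
    obtain c where "chf \<nu> (\<lambda>_. pp c) \<noteq> 0" using chf_nonzero[OF \<nu>] .
    hence "conc \<mu> c" using g[OF adic_powi lev_powi] by blast
    from conc_min[OF this d] obtain b where b: "\<And>c. conc \<mu> c \<longleftrightarrow> b \<le> c" by metis
    have z: "\<forall>c s. adic s \<longrightarrow> c < b \<longrightarrow> lev c s \<longrightarrow> chf \<mu> s = 0" "\<forall>c s. adic s \<longrightarrow> c < b \<longrightarrow> lev c s \<longrightarrow> chf \<nu> s = 0"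
      using f g iff b not_le by metis+
    have cb: "conc \<mu> b" "conc \<nu> b" using b iff by auto
    obtain x1 where x1: "x1 \<in> Qp" "\<mu> = pshift p (hmix (-b - 1) 1) x1"
      using conc_idempotent[OF \<mu> cb(1) z(1)] by blast
    obtain x2 where x2: "x2 \<in> Qp" "\<nu> = pshift p (hmix (-b - 1) 1) x2"
      using conc_idempotent[OF \<nu> cb(2) z(2)] by blast
    show ?thesis
      by (intro exI[of _ "pball (-b - 1 + 1) pzero"] exI[of _ "hmix (-b - 1) 1"] exI[of _ x1] exI[of _ x2] conjI
          compact_subgroup_pball haar_hmix x1 x2)
  qed
qed

text \<open>The least levels satisfy b \<le> b' \<le> b + 1. If b' = b, the first hypothesis makes
  the characteristic function of \<nu> vanish below b'; if b' = b + 1, the second makes that of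
  \<mu> vanish below b. In either case one distribution has no gap.\<close>

lemma one_idempotent:
  assumes \<mu>: "pprob \<mu>" and \<nu>: "pprob \<nu>"
    and g: "\<And>b w. adic w \<Longrightarrow> lev b w \<Longrightarrow> chf \<nu> w \<noteq> 0 \<Longrightarrow> conc \<mu> b"
    and f: "\<And>b w. adic w \<Longrightarrow> lev b w \<Longrightarrow> chf \<mu> w \<noteq> 0 \<Longrightarrow> conc \<nu> (b + 1)"
  shows "idempotent p \<mu> \<or> idempotent p \<nu>"
proof (cases "(\<forall>b. conc \<mu> b) \<or> (\<forall>b. conc \<nu> b)")
  case True
  thus ?thesis using degenerateI \<mu> \<nu> idempotent_degenerate by blast
next
  case False
  then obtain d d' where d: "\<not> conc \<mu> d" "\<not> conc \<nu> d'" by blast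
  obtain c where "chf \<nu> (\<lambda>_. pp c) \<noteq> 0" using chf_nonzero[OF \<nu>] .
  hence "conc \<mu> c" using g[OF adic_powi lev_powi] by blast
  from conc_min[OF this d(1)] obtain b where b: "\<And>c. conc \<mu> c \<longleftrightarrow> b \<le> c" by metis
  obtain c' where "chf \<mu> (\<lambda>_. pp c') \<noteq> 0" using chf_nonzero[OF \<mu>] .
  hence "conc \<nu> (c' + 1)" using f[OF adic_powi lev_powi] by blast
  from conc_min[OF this d(2)] obtain b' where b': "\<And>c. conc \<nu> c \<longleftrightarrow> b' \<le> c" by metis
  have "conc \<nu> b'" using b' by simp
  from g[OF adic_powi lev_powi conc_chf_nonzero[OF \<nu> this]] have bb': "b \<le> b'" using b by simp
  have "conc \<mu> b" using b by simp
  from f[OF adic_powi lev_powi conc_chf_nonzero[OF \<mu> this]] have "b' \<le> b + 1" using b' by simp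
  with bb' consider "b' = b" | "b' = b + 1" by linarith
  thus ?thesis
  proof cases
    case 1
    have z: "\<forall>c s. adic s \<longrightarrow> c < b' \<longrightarrow> lev c s \<longrightarrow> chf \<nu> s = 0"
      using g b 1 not_le by metis
    obtain x where "x \<in> Qp" "\<nu> = pshift p (hmix (-b' - 1) 1) x"
      using conc_idempotent[OF \<nu> \<open>conc \<nu> b'\<close> z] by blast
    thus ?thesis unfolding idempotent_def using compact_subgroup_pball[of "-b' - 1 + 1"] haar_hmix[of "-b' - 1"] by blast
  next
    case 2
    have z: "\<forall>c s. adic s \<longrightarrow> c < b \<longrightarrow> lev c s \<longrightarrow> chf \<mu> s = 0"
      using f b' 2 by (metis add_le_cancel_right not_le)
    obtain x where "x \<in> Qp" "\<mu> = pshift p (hmix (-b - 1) 1) x"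
      using conc_idempotent[OF \<mu> \<open>conc \<mu> b\<close> z] by blast
    thus ?thesis unfolding idempotent_def using compact_subgroup_pball[of "-b - 1 + 1"] haar_hmix[of "-b - 1"] by blast
  qed
qed

section \<open>Leading digits of \<alpha>\<close>

lemma Delta0_facts:
  assumes "c \<in> Delta0 p"
  shows "c \<in> Qp" "evZ 0 (rep c)" "evZ 1 (\<lambda>n. rep c n - real (c 0))"
    "evZ 2 (\<lambda>n. rep c n - (real (c 0) + real (c 1) * real p))" "0 < c 0" "c 0 < p"
proof -
  show O: "c \<in> Qp" and "0 < c 0" using assms by (auto simp: Delta0_def Delta_def)
  thus "c 0 < p" by (simp add: Omega_less)
  have low: "\<forall>i<0. c i = 0" using assms by (auto simp: Delta0_def Delta_def)
  show "evZ 0 (rep c)" by (rule evZ_rep[OF low])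
  have 0: "ptrunc p c 0 = 0" by (rule ptrunc_low[OF low]) simp
  have 1: "ptrunc p c 1 = real (c 0)" using ptrunc_step[OF O, of 0] by (simp add: 0)
  have 2: "ptrunc p c 2 = real (c 0) + real (c 1) * real p" using ptrunc_step[OF O, of 1] by (simp add: 1)
  show "evZ 1 (\<lambda>n. rep c n - real (c 0))" using rep_trunc[OF O, of 1] by (simp add: 1)
  show "evZ 2 (\<lambda>n. rep c n - (real (c 0) + real (c 1) * real p))" using rep_trunc[OF O, of 2] by (simp add: 2)
qed

lemma lev_of_int: "\<not> int p dvd i \<Longrightarrow> lev 0 (\<lambda>_. of_int i)"
  using lev_const[of i 0] by simp

lemma alpha_facts:
  assumes c: "c \<in> Delta0 p" and \<alpha>: "\<alpha> = pmul p (ppow p k) c"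
  shows "\<alpha> \<in> Qp" "lev k (rep \<alpha>)" "k = 0 \<Longrightarrow> evZ 1 (\<lambda>n. rep \<alpha> n - real (c 0))"
    "k = 0 \<Longrightarrow> evZ 2 (\<lambda>n. rep \<alpha> n - (real (c 0) + real (c 1) * real p))"
proof -
  note cf = Delta0_facts[OF c]
  show "\<alpha> \<in> Qp" unfolding \<alpha> by (intro pmul_Omega ppow_Omega cf)
  have r: "evZ N (\<lambda>n. rep \<alpha> n - pp k * rep c n)" for N
  proof -
    have "evZ (N + 0) (\<lambda>n. (rep (ppow p k) n - pp k) * rep c n)"
      by (rule evZ_mult[OF rep_ppow cf(2)])
    hence "evZ N (\<lambda>n. rep (ppow p k) n * rep c n - pp k * rep c n)" by (simp add: algebra_simps)
    from evZ_trans[OF rep_pmul[OF ppow_Omega cf(1)] this] show ?thesis unfolding \<alpha> .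
  qed
  have "\<not> int p dvd int (c 0)" using cf(5,6) by (simp add: nat_dvd_not_less)
  from lev_shift[OF lev_of_int[OF this], of "rep c"] cf(3) have "lev 0 (rep c)" by simp
  from lev_mult[OF lev_powi[of k] this] have "lev k (\<lambda>n. pp k * rep c n)" by simp
  thus "lev k (rep \<alpha>)" by (rule lev_shift[OF _ r])
  show "evZ 1 (\<lambda>n. rep \<alpha> n - real (c 0))" if "k = 0"
    using evZ_trans[OF r[of 1] _] cf(3) that by simp
  show "evZ 2 (\<lambda>n. rep \<alpha> n - (real (c 0) + real (c 1) * real p))" if "k = 0"
    using evZ_trans[OF r[of 2] _] cf(4) that by simp
qed

subsection \<open>Counterexamples\<close>

text \<open>The bounds on a and b place both mixtures on p^(-1) Delta, the common compact support
  for the inversion.\<close>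

lemma counterexampleI:
  assumes a: "\<alpha> \<in> Qp" and ab: "-1 \<le> a" "-1 \<le> b"
    and eq: "\<And>u v. adic u \<Longrightarrow> adic v \<Longrightarrow>
      chf (hmix a (1/2)) (\<lambda>n. u n + v n) * chf (hmix b (1/2)) (\<lambda>n. u n + v n * rep \<alpha> n) =
      chf (hmix a (1/2)) (\<lambda>n. u n - v n) * chf (hmix b (1/2)) (\<lambda>n. u n - v n * rep \<alpha> n)"
  shows "\<exists>(M::(padic \<times> padic) measure) \<xi>1 \<xi>2. sym_model p \<alpha> M \<xi>1 \<xi>2 \<and>
            \<not> idempotent p (distr M BQ \<xi>1) \<and> \<not> idempotent p (distr M BQ \<xi>2)"
proof -
  have c: "AE x in hmix a (1/2). x \<in> pball (-1) pzero" "AE x in hmix b (1/2). x \<in> pball (-1) pzero"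
    using AE_pball_mono[where X = "\<lambda>x. x", OF hmix_low ab(1)] AE_pball_mono[where X = "\<lambda>x. x", OF hmix_low ab(2)] .
  note cs = cond_symmetricI[OF pprob_hmix pprob_hmix a c eq]
  show ?thesis
    by (intro exI[of _ "hmix a (1/2) \<Otimes>\<^sub>M hmix b (1/2)"] exI[of _ fst] exI[of _ snd] conjI)
       (simp_all add: cs hmix_not_idempotent)
qed

text \<open>Both sides of the functional equation vanish unless the arguments on one side
  lie in the supports of the two characteristic functions.\<close>

lemma equation_on_supports:
  fixes F G :: "(nat \<Rightarrow> real) \<Rightarrow> complex"
  assumes a: "\<alpha> \<in> Qp" and u: "adic u" and v: "adic v"
    and F: "\<And>s. adic s \<Longrightarrow> \<not> evZ i s \<Longrightarrow> F s = 0" and G: "\<And>s. adic s \<Longrightarrow> \<not> evZ j s \<Longrightarrow> G s = 0"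
    and eq: "\<And>v. adic v \<Longrightarrow> evZ i (\<lambda>n. u n + v n) \<Longrightarrow> evZ j (\<lambda>n. u n + v n * rep \<alpha> n) \<Longrightarrow>
      F (\<lambda>n. u n + v n) * G (\<lambda>n. u n + v n * rep \<alpha> n) = F (\<lambda>n. u n - v n) * G (\<lambda>n. u n - v n * rep \<alpha> n)"
  shows "F (\<lambda>n. u n + v n) * G (\<lambda>n. u n + v n * rep \<alpha> n) = F (\<lambda>n. u n - v n) * G (\<lambda>n. u n - v n * rep \<alpha> n)"
proof -
  have ar: "adic (rep \<alpha>)" by (rule adic_rep[OF a])
  have ad: "adic (\<lambda>n. u n + v n)" "adic (\<lambda>n. u n + v n * rep \<alpha> n)" "adic (\<lambda>n. u n - v n)" "adic (\<lambda>n. u n - v n * rep \<alpha> n)"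
    by (intro adic_intros u v ar)+
  show ?thesis
  proof (cases "evZ i (\<lambda>n. u n + v n) \<and> evZ j (\<lambda>n. u n + v n * rep \<alpha> n)")
    case True thus ?thesis using eq[OF v] by blast
  next
    case nP: False
    show ?thesis
    proof (cases "evZ i (\<lambda>n. u n - v n) \<and> evZ j (\<lambda>n. u n - v n * rep \<alpha> n)")
      case True thus ?thesis using eq[OF adic_minus[OF v]] by simp
    next
      case False
      have "F (\<lambda>n. u n + v n) * G (\<lambda>n. u n + v n * rep \<alpha> n) = 0" using nP F G ad by auto
      moreover have "F (\<lambda>n. u n - v n) * G (\<lambda>n. u n - v n * rep \<alpha> n) = 0" using False F G ad by auto
      ultimately show ?thesis by (simp only:)
    qed
  qed
qed

text \<open>F is supported on Delta and depends on its argument modulo p. On the support (1 -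
  \<alpha>) v is in Delta, so (1 + \<alpha>) v is in p Delta; hence u + \<alpha> v = u - v and u + v
  = u - \<alpha> v modulo p, and the two factors trade places.\<close>

lemma counterexample_unit:
  assumes a: "\<alpha> \<in> Qp" and lm: "lev d (\<lambda>n. 1 - rep \<alpha> n)" and Dp: "evZ (d + 1) (\<lambda>n. 1 + rep \<alpha> n)"
    and u: "adic u" and v: "adic v"
  defines "F \<equiv> chf (hmix (-1) (1/2))"
  shows "F (\<lambda>n. u n + v n) * F (\<lambda>n. u n + v n * rep \<alpha> n) = F (\<lambda>n. u n - v n) * F (\<lambda>n. u n - v n * rep \<alpha> n)"
proof -
  have ar: "adic (rep \<alpha>)" by (rule adic_rep[OF a])
  have zero: "F s = 0" if "adic s" "\<not> evZ 0 s" for s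
    unfolding F_def using chf_hmix_zero[of s "-1"] that by simp
  have cong: "F s = F t" if "adic s" "adic t" "evZ 1 (\<lambda>n. s n - t n)" for s t
    unfolding F_def using chf_hmix_cong[of s t "-1"] that by simp
  have A: "F (\<lambda>n. u n + v n) * F (\<lambda>n. u n + v n * rep \<alpha> n) = F (\<lambda>n. u n - v n) * F (\<lambda>n. u n - v n * rep \<alpha> n)"
    if v: "adic v" and P: "evZ 0 (\<lambda>n. u n + v n)" "evZ 0 (\<lambda>n. u n + v n * rep \<alpha> n)" for v
  proof -
    have "evZ 0 (\<lambda>n. (1 - rep \<alpha> n) * v n)" using evZ_diff[OF P] by (rule evZ_eq) (simp add: algebra_simps)
    moreover obtain j where "evZ j v" using adicD v by blast
    ultimately have "evZ (0 - d) v" using lev_cancel[OF lm] by blast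
    from evZ_mult[OF Dp this] have 1: "evZ 1 (\<lambda>n. (1 + rep \<alpha> n) * v n)" by simp
    have ad: "adic (\<lambda>n. u n + v n)" "adic (\<lambda>n. u n + v n * rep \<alpha> n)" "adic (\<lambda>n. u n - v n)" "adic (\<lambda>n. u n - v n * rep \<alpha> n)"
      by (intro adic_intros u v ar)+
    have "F (\<lambda>n. u n + v n * rep \<alpha> n) = F (\<lambda>n. u n - v n)"
      by (rule cong[OF ad(2,3)], rule evZ_eq[OF 1]) (simp add: algebra_simps)
    moreover have "F (\<lambda>n. u n + v n) = F (\<lambda>n. u n - v n * rep \<alpha> n)"
      by (rule cong[OF ad(1,4)], rule evZ_eq[OF 1]) (simp add: algebra_simps)
    ultimately show ?thesis by simp
  qed
  show ?thesis by (rule equation_on_supports[OF a u v zero zero A])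
qed

text \<open>F lives on p^(-1) Delta modulo Delta, and G on Delta modulo p. On the supports v is in
  p^(-1) Delta and u in Delta, so F sees only v and -v and is even, while the arguments of G differ
  by 2 \<alpha> v, which is in p Delta.\<close>

lemma counterexample_pos:
  assumes a: "\<alpha> \<in> Qp" and lm: "lev 0 (\<lambda>n. 1 - rep \<alpha> n)" and Da: "evZ 1 (rep \<alpha>)" and D2: "evZ 2 (\<lambda>n. 2 * rep \<alpha> n)"
    and u: "adic u" and v: "adic v"
  defines "F \<equiv> chf (hmix 0 (1/2))" and "G \<equiv> chf (hmix (-1) (1/2))"
  shows "F (\<lambda>n. u n + v n) * G (\<lambda>n. u n + v n * rep \<alpha> n) = F (\<lambda>n. u n - v n) * G (\<lambda>n. u n - v n * rep \<alpha> n)"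
proof -
  have ar: "adic (rep \<alpha>)" by (rule adic_rep[OF a])
  have zero: "F s = 0" if "adic s" "\<not> evZ (-1) s" for s
    unfolding F_def using chf_hmix_zero[of s 0] that by simp
  have cong: "F s = F t" if "adic s" "adic t" "evZ 0 (\<lambda>n. s n - t n)" for s t
    unfolding F_def using chf_hmix_cong[of s t 0] that by simp
  have neg: "F (\<lambda>n. - s n) = F s" if "adic s" for s
    unfolding F_def using chf_hmix_neg that by simp
  have zeroG: "G s = 0" if "adic s" "\<not> evZ 0 s" for s
    unfolding G_def using chf_hmix_zero[of s "-1"] that by simp
  have congG: "G s = G t" if "adic s" "adic t" "evZ 1 (\<lambda>n. s n - t n)" for s t
    unfolding G_def using chf_hmix_cong[of s t "-1"] that by simp
  have A: "F (\<lambda>n. u n + v n) * G (\<lambda>n. u n + v n * rep \<alpha> n) = F (\<lambda>n. u n - v n) * G (\<lambda>n. u n - v n * rep \<alpha> n)"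
    if v: "adic v" and P: "evZ (-1) (\<lambda>n. u n + v n)" "evZ 0 (\<lambda>n. u n + v n * rep \<alpha> n)" for v
  proof -
    have "evZ (-1) (\<lambda>n. (1 - rep \<alpha> n) * v n)"
      using evZ_diff[OF P(1) evZ_mono[OF P(2), of "-1"]] by (rule_tac evZ_eq) (auto simp: algebra_simps)
    moreover obtain j where "evZ j v" using adicD v by blast
    ultimately have Dv: "evZ (-1) v" using lev_cancel[OF lm] by force
    have "evZ 0 (\<lambda>n. v n * rep \<alpha> n)" using evZ_mult[OF Dv Da] by simp
    from evZ_diff[OF P(2) this] have Du: "evZ 0 u" by simp
    have 1: "evZ 1 (\<lambda>n. v n * (2 * rep \<alpha> n))" using evZ_mult[OF Dv D2] by simp
    have ad: "adic (\<lambda>n. u n + v n)" "adic (\<lambda>n. u n + v n * rep \<alpha> n)" "adic (\<lambda>n. u n - v n)" "adic (\<lambda>n. u n - v n * rep \<alpha> n)"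
      by (intro adic_intros u v ar)+
    have "F (\<lambda>n. u n + v n) = F v"
      by (rule cong[OF ad(1) v]) (use Du in simp)
    moreover have "F (\<lambda>n. u n - v n) = F (\<lambda>n. - v n)"
      by (rule cong[OF ad(3) adic_minus[OF v]]) (use Du in simp)
    moreover have "G (\<lambda>n. u n + v n * rep \<alpha> n) = G (\<lambda>n. u n - v n * rep \<alpha> n)"
      by (rule congG[OF ad(2,4)], rule evZ_eq[OF 1]) (simp add: algebra_simps)
    ultimately show ?thesis using neg[OF v] by simp
  qed
  show ?thesis by (rule equation_on_supports[OF a u v zero zeroG A])
qed

text \<open>The mirror image: now v is in p^(-1-k) Delta, hence in Delta, and so is u. The arguments
  of F differ by 2 v, which is in p Delta, and the even function G sees only \<alpha> v and
  -\<alpha> v.\<close>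

lemma counterexample_neg:
  assumes a: "\<alpha> \<in> Qp" and lm: "lev k (\<lambda>n. 1 - rep \<alpha> n)" and la: "lev k (rep \<alpha>)" and D2: "evZ (k + 2) (\<lambda>_. 2)" and k: "k \<le> -1"
    and u: "adic u" and v: "adic v"
  defines "F \<equiv> chf (hmix (-1) (1/2))" and "G \<equiv> chf (hmix 0 (1/2))"
  shows "F (\<lambda>n. u n + v n) * G (\<lambda>n. u n + v n * rep \<alpha> n) = F (\<lambda>n. u n - v n) * G (\<lambda>n. u n - v n * rep \<alpha> n)"
proof -
  have ar: "adic (rep \<alpha>)" by (rule adic_rep[OF a])
  have zero: "F s = 0" if "adic s" "\<not> evZ 0 s" for s
    unfolding F_def using chf_hmix_zero[of s "-1"] that by simp
  have cong: "F s = F t" if "adic s" "adic t" "evZ 1 (\<lambda>n. s n - t n)" for s t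
    unfolding F_def using chf_hmix_cong[of s t "-1"] that by simp
  have neg: "G (\<lambda>n. - s n) = G s" if "adic s" for s
    unfolding G_def using chf_hmix_neg that by simp
  have zeroG: "G s = 0" if "adic s" "\<not> evZ (-1) s" for s
    unfolding G_def using chf_hmix_zero[of s 0] that by simp
  have congG: "G s = G t" if "adic s" "adic t" "evZ 0 (\<lambda>n. s n - t n)" for s t
    unfolding G_def using chf_hmix_cong[of s t 0] that by simp
  have A: "F (\<lambda>n. u n + v n) * G (\<lambda>n. u n + v n * rep \<alpha> n) = F (\<lambda>n. u n - v n) * G (\<lambda>n. u n - v n * rep \<alpha> n)"
    if v: "adic v" and P: "evZ 0 (\<lambda>n. u n + v n)" "evZ (-1) (\<lambda>n. u n + v n * rep \<alpha> n)" for v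
  proof -
    have "evZ (-1) (\<lambda>n. (1 - rep \<alpha> n) * v n)"
      using evZ_diff[OF evZ_mono[OF P(1), of "-1"] P(2)] by (rule_tac evZ_eq) (auto simp: algebra_simps)
    moreover obtain j where "evZ j v" using adicD v by blast
    ultimately have Dv: "evZ (-1 - k) v" using lev_cancel[OF lm] by force
    have "evZ 0 v" by (rule evZ_mono[OF Dv]) (use k in simp)
    from evZ_diff[OF P(1) this] have Du: "evZ 0 u" by simp
    have va: "adic (\<lambda>n. v n * rep \<alpha> n)" by (intro adic_mult v ar)
    have 1: "evZ 1 (\<lambda>n. 2 * v n)" using evZ_mult[OF D2 Dv] by simp
    have ad: "adic (\<lambda>n. u n + v n)" "adic (\<lambda>n. u n + v n * rep \<alpha> n)" "adic (\<lambda>n. u n - v n)" "adic (\<lambda>n. u n - v n * rep \<alpha> n)"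
      by (intro adic_intros u v ar)+
    have "F (\<lambda>n. u n + v n) = F (\<lambda>n. u n - v n)"
      by (rule cong[OF ad(1,3)], rule evZ_eq[OF 1]) (simp add: algebra_simps)
    moreover have "G (\<lambda>n. u n + v n * rep \<alpha> n) = G (\<lambda>n. v n * rep \<alpha> n)"
      by (rule congG[OF ad(2) va]) (use Du in simp)
    moreover have "G (\<lambda>n. u n - v n * rep \<alpha> n) = G (\<lambda>n. - (v n * rep \<alpha> n))"
      by (rule congG[OF ad(4) adic_minus[OF va]]) (use Du in simp)
    ultimately show ?thesis using neg[OF va] by simp
  qed
  show ?thesis by (rule equation_on_supports[OF a u v zero zeroG A])
qed

section \<open>Case distinction by the valuations of 2, 1 - \<alpha> and 1 + \<alpha>\<close>

lemma lev_two: "p > 2 \<Longrightarrow> lev 0 (\<lambda>_. 2)" "p = 2 \<Longrightarrow> lev 1 (\<lambda>_. 2)"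
proof -
  show "lev 0 (\<lambda>_. 2)" if "p > 2"
    using lev_of_int[of 2] zdvd_not_zless[of 2 "int p"] that by simp
  show "lev 1 (\<lambda>_. 2)" if "p = 2"
    using lev_powi[of 1] that by simp
qed

lemma evZ_1: "evZ 0 (\<lambda>_. 1)"
  using powi_in_pZ[of 0 0] by (simp add: evZ_def)

lemma lev_1: "lev 0 (\<lambda>_. 1)"
  using lev_powi[of 0] by simp

text \<open>The summand of smaller valuation dominates. For k = 0 cancellation may occur, and the
  leading digits of \<alpha> decide.\<close>

lemma lev_one_pm:
  assumes "lev k s" "k \<noteq> 0"
  shows "lev (min k 0) (\<lambda>n. 1 - s n)" "lev (min k 0) (\<lambda>n. 1 + s n)"
proof -
  have "lev (min k 0) (\<lambda>n. 1 - s n) \<and> lev (min k 0) (\<lambda>n. 1 + s n)"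
  proof (cases "k > 0")
    case True
    have "evZ 1 s" by (rule evZ_mono[OF lev_evZ[OF assms(1)]]) (use True in simp)
    hence "evZ (0 + 1) (\<lambda>n. (1 - s n) - 1)" "evZ (0 + 1) (\<lambda>n. (1 + s n) - 1)"
      using evZ_minus[of 1 s] by simp_all
    from lev_shift[OF lev_1 this(1)] lev_shift[OF lev_1 this(2)] show ?thesis using True by simp
  next
    case False
    hence "k + 1 \<le> 0" using assms by simp
    from evZ_mono[OF evZ_1 this] have "evZ (k + 1) (\<lambda>n. (1 - s n) - (- s n))" "evZ (k + 1) (\<lambda>n. (1 + s n) - s n)"
      by simp_all
    from lev_shift[OF lev_minus[OF assms(1)] this(1)] lev_shift[OF assms(1) this(2)] show ?thesis
      using False by simp
  qed
  thus "lev (min k 0) (\<lambda>n. 1 - s n)" "lev (min k 0) (\<lambda>n. 1 + s n)" by auto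
qed

lemma characterization:
  fixes M :: "'a measure"
  assumes c: "c \<in> Delta0 p" and \<alpha>: "\<alpha> = pmul p (ppow p k) c" and sm: "sym_model p \<alpha> M \<xi>1 \<xi>2"
  defines "\<mu>1 \<equiv> distr M BQ \<xi>1" and "\<mu>2 \<equiv> distr M BQ \<xi>2"
  shows "p > 2 \<Longrightarrow> k = 0 \<Longrightarrow> c 0 = 1 \<Longrightarrow> degenerate p \<mu>1 \<and> degenerate p \<mu>2"
    and "p > 2 \<Longrightarrow> k = 0 \<Longrightarrow> c 0 \<noteq> p - 1 \<Longrightarrow>
       \<exists>K m x1 x2. compact_subgroup p K \<and> haar_distr p K m \<and>
         x1 \<in> Qp \<and> x2 \<in> Qp \<and> \<mu>1 = pshift p m x1 \<and> \<mu>2 = pshift p m x2"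
    and "p = 2 \<Longrightarrow> k = 0 \<Longrightarrow> c 0 = 1 \<Longrightarrow> c 1 = 0 \<Longrightarrow> degenerate p \<mu>1 \<and> degenerate p \<mu>2"
    and "p > 2 \<Longrightarrow> \<bar>k\<bar> = 1 \<Longrightarrow> idempotent p \<mu>1 \<or> idempotent p \<mu>2"
proof -
  note af = alpha_facts[OF c \<alpha>]
  note cf = Delta0_facts[OF c]
  have pm: "pprob \<mu>1" "pprob \<mu>2"
    unfolding \<mu>1_def \<mu>2_def using sm by (auto simp: sym_model_def intro: pprob_distr)
  show deg: "degenerate p \<mu>1 \<and> degenerate p \<mu>2" if p2: "p > 2" and k: "k = 0" and c0: "c 0 = 1"
  proof -
    have a1: "evZ 1 (\<lambda>n. rep \<alpha> n - 1)" using af(3)[OF k] c0 by simp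
    have "lev 0 (\<lambda>n. 1 + rep \<alpha> n)" by (rule lev_shift[OF lev_two(1)[OF p2]]) (use a1 in simp)
    from heyde_degenerate[OF sm af(1) lev_two(1)[OF p2] this] evZ_sym[OF a1]
    show ?thesis using degenerateI pm by (simp add: \<mu>1_def \<mu>2_def)
  qed
  show "degenerate p \<mu>1 \<and> degenerate p \<mu>2" if p2: "p = 2" and k: "k = 0" and c0: "c 0 = 1" and c1: "c 1 = 0"
  proof -
    have a1: "evZ 2 (\<lambda>n. rep \<alpha> n - 1)" using af(4)[OF k] c0 c1 by simp
    \<comment> \<open>As \<alpha> is 1 modulo 4, 1 + \<alpha> is 2 modulo 4, while 1 - \<alpha> is
      divisible by 4.\<close>
    have "lev 1 (\<lambda>n. 1 + rep \<alpha> n)" by (rule lev_shift[OF lev_two(2)[OF p2]]) (use a1 in simp)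
    from heyde_degenerate[OF sm af(1) lev_two(2)[OF p2] this] evZ_sym[OF a1]
    show ?thesis using degenerateI pm by (simp add: \<mu>1_def \<mu>2_def)
  qed
  show "\<exists>K m x1 x2. compact_subgroup p K \<and> haar_distr p K m \<and>
         x1 \<in> Qp \<and> x2 \<in> Qp \<and> \<mu>1 = pshift p m x1 \<and> \<mu>2 = pshift p m x2"
    if p2: "p > 2" and k: "k = 0" and c0: "c 0 \<noteq> p - 1"
  proof (cases "c 0 = 1")
    case True
    with deg p2 k show ?thesis by (intro degenerate_common_haar) auto
  next
    case False
    have a1: "evZ 1 (\<lambda>n. rep \<alpha> n - real (c 0))" by (rule af(3)[OF k])
    \<comment> \<open>Here 2 \<le> c 0 \<le> p - 2, so both 1 - \<alpha> and 1 + \<alpha> are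
      units.\<close>
    have "\<not> int p dvd int (c 0) - 1"
      using zdvd_not_zless[of "int (c 0) - 1" "int p"] cf(5,6) False by simp
    hence "\<not> int p dvd 1 - int (c 0)" by (metis dvd_minus_iff minus_diff_eq)
    from lev_of_int[OF this] have lm: "lev 0 (\<lambda>n. 1 - rep \<alpha> n)"
      by (rule lev_shift) (use evZ_minus[OF a1] in simp)
    have "\<not> int p dvd 1 + int (c 0)"
      using zdvd_not_zless[of "1 + int (c 0)" "int p"] cf(5,6) c0 by simp
    from lev_of_int[OF this] have lp: "lev 0 (\<lambda>n. 1 + rep \<alpha> n)"
      by (rule lev_shift) (use a1 in simp)
    have la: "lev 0 (rep \<alpha>)" using af(2) k by simp
    note hu = heyde_unit[OF sm af(1) lev_two(1)[OF p2] lm lp la]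
    show ?thesis
      by (rule common_haar[OF pm]) (use hu in \<open>simp_all add: \<mu>1_def \<mu>2_def\<close>)
  qed
  show "idempotent p \<mu>1 \<or> idempotent p \<mu>2" if p2: "p > 2" and k: "\<bar>k\<bar> = 1"
  proof -
    have "k \<noteq> 0" using k by auto
    from lev_one_pm[OF af(2) this]
    have lm: "lev (min k 0) (\<lambda>n. 1 - rep \<alpha> n)" and lp: "lev (min k 0) (\<lambda>n. 1 + rep \<alpha> n)" .
    note hu = heyde_unit[OF sm af(1) lev_two(1)[OF p2] lm lp af(2)]
    \<comment> \<open>For k = 1 the common level is e = 0 and the levels obtained are b and b + 1;
      for k = -1 it is e = -1 and they are b + 1 and b, so the two distributions exchange
      roles.\<close>
    from k consider "k = 1" | "k = -1" by linarith
    thus ?thesis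
    proof cases
      case 1
      show ?thesis
        by (rule one_idempotent[OF pm]) (use hu 1 in \<open>simp_all add: \<mu>1_def \<mu>2_def\<close>)
    next
      case 2
      have "idempotent p \<mu>2 \<or> idempotent p \<mu>1"
        by (rule one_idempotent[OF pm(2,1)]) (use hu 2 in \<open>simp_all add: \<mu>1_def \<mu>2_def\<close>)
      thus ?thesis by blast
    qed
  qed
qed

lemma counterexamples:
  assumes c: "c \<in> Delta0 p" and \<alpha>: "\<alpha> = pmul p (ppow p k) c"
    and cases: "(p > 2 \<and> k = 0 \<and> c 0 = p - 1) \<or> (p = 2 \<and> k = 0 \<and> c 0 = 1 \<and> c 1 = 1) \<or>
         (p = 2 \<and> \<bar>k\<bar> = 1) \<or> (p \<ge> 2 \<and> \<bar>k\<bar> \<ge> 2)"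
  shows "\<exists>(M::(padic \<times> padic) measure) \<xi>1 \<xi>2. sym_model p \<alpha> M \<xi>1 \<xi>2 \<and>
            \<not> idempotent p (distr M BQ \<xi>1) \<and> \<not> idempotent p (distr M BQ \<xi>2)"
proof -
  note af = alpha_facts[OF c \<alpha>]
  have unit: ?thesis if "lev d (\<lambda>n. 1 - rep \<alpha> n)" "evZ (d + 1) (\<lambda>n. 1 + rep \<alpha> n)" for d
    by (rule counterexampleI[OF af(1), of "-1" "-1"])
       (simp_all only: order.refl counterexample_unit[OF af(1) that])
  \<comment> \<open>The cases with nonzero k are regrouped by sign. What counts is that 2 \<alpha>
    for positive k, or 2 / \<alpha> for negative k, has valuation at least 2.\<close>
  consider "p > 2" "k = 0" "c 0 = p - 1" | "p = 2" "k = 0" "c 0 = 1" "c 1 = 1"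
    | "k \<ge> 1" "p = 2 \<or> k \<ge> 2" | "k \<le> -1" "p = 2 \<or> k \<le> -2"
    using cases by fastforce
  thus ?thesis
  proof cases
    case 1
    have a1: "evZ 1 (\<lambda>n. rep \<alpha> n - (real p - 1))" using af(3) 1 by (simp add: of_nat_diff)
    have pD: "evZ 1 (\<lambda>_. real p)" using powi_in_pZ[of 1 1] by (simp add: evZ_const_iff)
    have "evZ 1 (\<lambda>n. (1 - rep \<alpha> n) - 2)" using evZ_minus[OF evZ_add[OF a1 pD]] by (rule evZ_eq) simp
    hence "lev 0 (\<lambda>n. 1 - rep \<alpha> n)" using lev_shift[OF lev_two(1)[OF 1(1)]] by simp
    moreover have "evZ 1 (\<lambda>n. 1 + rep \<alpha> n)" using evZ_add[OF a1 pD] by (rule evZ_eq) simp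
    ultimately show ?thesis using unit[of 0] by simp
  next
    case 2
    \<comment> \<open>As \<alpha> is 3 modulo 4, 1 - \<alpha> has valuation exactly 1 and 1 +
      \<alpha> at least 2.\<close>
    have a1: "evZ 2 (\<lambda>n. rep \<alpha> n - 3)" using af(4) 2 by simp
    have "pp 2 = 4" using 2(1) by simp
    hence pD: "evZ 2 (\<lambda>_. 4)" using powi_in_pZ[OF order.refl, of 2] by (simp only: evZ_const_iff)
    have "evZ 2 (\<lambda>n. (1 - rep \<alpha> n) - 2)" using evZ_minus[OF evZ_add[OF a1 pD]] by (rule evZ_eq) simp
    hence "lev 1 (\<lambda>n. 1 - rep \<alpha> n)" using lev_shift[OF lev_two(2)[OF 2(1)]] by simp
    moreover have "evZ 2 (\<lambda>n. 1 + rep \<alpha> n)" using evZ_add[OF a1 pD] by (rule evZ_eq) simp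
    ultimately show ?thesis using unit[of 1] by simp
  next
    case 3
    have lm: "lev 0 (\<lambda>n. 1 - rep \<alpha> n)" using lev_one_pm(1)[OF af(2)] 3 by simp
    have Da: "evZ 1 (rep \<alpha>)" by (rule evZ_mono[OF lev_evZ[OF af(2)]]) (use 3 in simp)
    have D2: "evZ 2 (\<lambda>n. 2 * rep \<alpha> n)"
    proof (cases "p = 2")
      case True
      show ?thesis using evZ_mult[OF lev_evZ[OF lev_two(2)[OF True]] Da] by simp
    next
      case False
      have "evZ 2 (rep \<alpha>)" by (rule evZ_mono[OF lev_evZ[OF af(2)]]) (use 3 False in simp)
      from evZ_add[OF this this] show ?thesis by simp
    qed
    show ?thesis
      by (rule counterexampleI[OF af(1), of 0 "-1"]) (simp, simp, rule counterexample_pos[OF af(1) lm Da D2])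
  next
    case 4
    have lm: "lev k (\<lambda>n. 1 - rep \<alpha> n)" using lev_one_pm(1)[OF af(2)] 4 by (simp add: min_def)
    have D2: "evZ (k + 2) (\<lambda>_. 2)"
    proof (cases "p = 2")
      case True
      show ?thesis by (rule evZ_mono[OF lev_evZ[OF lev_two(2)[OF True]]]) (use 4 in simp)
    next
      case False
      have "evZ 0 (\<lambda>_. 2)" using evZ_add[OF evZ_1 evZ_1] by simp
      thus ?thesis by (rule evZ_mono) (use 4 False in simp)
    qed
    show ?thesis
      by (rule counterexampleI[OF af(1), of "-1" 0]) (simp, simp, rule counterexample_neg[OF af(1) lm af(2) D2 4(1)])
  qed
qed

end

theorem theorem1:
  fixes p :: nat and k :: int and c :: padic
  assumes "prime p" and "c \<in> Delta0 p"
  defines "\<alpha> \<equiv> pmul p (ppow p k) c"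
  shows "(\<forall>(M::'a measure) \<xi>1 \<xi>2. sym_model p \<alpha> M \<xi>1 \<xi>2 \<longrightarrow>
            (let \<mu>1 = distr M (pborel p) \<xi>1; \<mu>2 = distr M (pborel p) \<xi>2 in
              ((p > 2 \<and> k = 0 \<and> c 0 \<noteq> p - 1) \<longrightarrow>
                 (\<exists>K m x1 x2. compact_subgroup p K \<and> haar_distr p K m \<and>
                    x1 \<in> Omega p \<and> x2 \<in> Omega p \<and> \<mu>1 = pshift p m x1 \<and> \<mu>2 = pshift p m x2) \<and>
                 (c 0 = 1 \<longrightarrow> degenerate p \<mu>1 \<and> degenerate p \<mu>2)) \<and>
              ((p = 2 \<and> k = 0 \<and> c 0 = 1 \<and> c 1 = 0) \<longrightarrow> degenerate p \<mu>1 \<and> degenerate p \<mu>2) \<and>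
              ((p > 2 \<and> \<bar>k\<bar> = 1) \<longrightarrow> idempotent p \<mu>1 \<or> idempotent p \<mu>2)))
       \<and>
       (((p > 2 \<and> k = 0 \<and> c 0 = p - 1) \<or> (p = 2 \<and> k = 0 \<and> c 0 = 1 \<and> c 1 = 1) \<or>
         (p = 2 \<and> \<bar>k\<bar> = 1) \<or> (p \<ge> 2 \<and> \<bar>k\<bar> \<ge> 2)) \<longrightarrow>
         (\<exists>(M::(padic \<times> padic) measure) \<xi>1 \<xi>2. sym_model p \<alpha> M \<xi>1 \<xi>2 \<and>
            \<not> idempotent p (distr M (pborel p) \<xi>1) \<and> \<not> idempotent p (distr M (pborel p) \<xi>2)))"
proof -
  interpret padic_prime p by unfold_locales fact
  have \<alpha>: "\<alpha> = pmul p (ppow p k) c" by (simp add: \<alpha>_def)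
  show ?thesis
  proof (intro conjI allI impI)
    fix M :: "'a measure" and \<xi>1 \<xi>2
    assume "sym_model p \<alpha> M \<xi>1 \<xi>2"
    note ch = characterization[OF assms(2) \<alpha> this]
    show "let \<mu>1 = distr M (pborel p) \<xi>1; \<mu>2 = distr M (pborel p) \<xi>2 in
              ((p > 2 \<and> k = 0 \<and> c 0 \<noteq> p - 1) \<longrightarrow>
                 (\<exists>K m x1 x2. compact_subgroup p K \<and> haar_distr p K m \<and>
                    x1 \<in> Omega p \<and> x2 \<in> Omega p \<and> \<mu>1 = pshift p m x1 \<and> \<mu>2 = pshift p m x2) \<and>
                 (c 0 = 1 \<longrightarrow> degenerate p \<mu>1 \<and> degenerate p \<mu>2)) \<and>
              ((p = 2 \<and> k = 0 \<and> c 0 = 1 \<and> c 1 = 0) \<longrightarrow> degenerate p \<mu>1 \<and> degenerate p \<mu>2) \<and>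
              ((p > 2 \<and> \<bar>k\<bar> = 1) \<longrightarrow> idempotent p \<mu>1 \<or> idempotent p \<mu>2)"
      unfolding Let_def
    proof (intro conjI impI; elim conjE)
      assume "2 < p" "k = 0" "c 0 \<noteq> p - 1"
      thus "\<exists>K m x1 x2. compact_subgroup p K \<and> haar_distr p K m \<and> x1 \<in> Omega p \<and> x2 \<in> Omega p \<and>
          distr M (pborel p) \<xi>1 = pshift p m x1 \<and> distr M (pborel p) \<xi>2 = pshift p m x2" by (rule ch(2))
    qed (use ch(1,3,4) in blast)+
  qed (rule counterexamples[OF assms(2) \<alpha>])
qed

end
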